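(* Let $\Omega_0\subset\mathbb{R}^2$ be a bounded simply connected set which has an acute corner at $x=0$ (that is, a corner at $x=0$ of some angle $\alpha$ with $0<\alpha<\pi/2$), and let $\omega_0=\chi_{\Omega_0}$. Let $\omega(\cdot,t)=\chi_{\Omega(t)}$ be the corresponding unique (Yudovich) vortex patch solution of the 2D incompressible Euler equations with initial data $\omega_0$, and let $\Phi_t(0)$ be the particle trajectory starting at $0$. Then a cusp develops instantaneously at the image of $x=0$ under the flow, in the following sense: there exists a positive function $t=t(r)$, defined for small $r>0$, with $t(r)\to 0$ as $r\to 0^+$, such that $$\lim_{r\to 0^+}\frac{\left|B_r\big(\Phi_{t(r)}(0)\big)\cap\Omega(t(r))\right|}{|B_r|}=0 .$$
   Context: The 2D Euler equations in vorticity form on $\mathbb{R}^2$ are $\partial_t\omega+u\cdot\nabla\omega=0$, $u=\nabla^\perp\Delta^{-1}\omega$, $\omega(0,x)=\omega_0(x)$, where $\nabla^\perp=(-\partial_{x_2},\partial_{x_1})$. For $\omega_0\in L^1\cap L^\infty$ there is a unique global weak solution $\omega\in L^\infty_t(L^1\cap L^\infty)$ (Yudovich), transported by a unique flow map: $\partial_t\Phi_t(x)=u(t,\Phi_t(x))$, $\Phi_0(x)=x$. If $\omega_0=\chi_{\Omega_0}$ is a characteristic function, then $\omega(\cdot,t)=\chi_{\Omega(t)}$ with $\Omega(t)=\Phi_t(\Omega_0)$ (a vortex patch). $B_r(x)$ is the disc of radius $r$ centered at $x$, $|B_r|=\pi r^2$, $|\cdot|$ is Lebesgue measure, and $\Delta$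 between sets denotes the symmetric difference. Corner: a simply connected set $\Omega$ has a corner at $x=0$ of angle $0<\alpha<\pi$ if there exists a sector $\mathcal{S}$ (with vertex at $0$) of opening $\alpha$ such that $\lim_{r\to0}\frac{|B_r(0)\cap(\Omega\Delta\mathcal{S})|}{|B_r|}=0$. *)

theory Defs
  imports "HOL-Analysis.Analysis"
begin

definition perp_grad :: "(real^2 \<Rightarrow> real) \<Rightarrow> real^2 \<Rightarrow> real^2" where
  "perp_grad f x = vector [- frechet_derivative f (at x) (axis 2 1), frechet_derivative f (at x) (axis 1 1)]"

definition laplace_fundamental :: "real^2 \<Rightarrow> real" where
  "laplace_fundamental x = ln (norm x) / (2 * pi)"

text \<open>The velocity is \<open>\<nabla>\<^sup>\<bottom> \<Delta>\<^sup>-\<^sup>1 \<omega>\<close>, where \<open>\<Delta>\<^sup>-\<^sup>1\<close> is convolution with the fundamental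
  solution of the Laplacian. The perpendicular gradient is taken under the integral, because the
  logarithmic potential of a function in \<open>L\<^sup>1 \<inter> L\<^sup>\<infinity>\<close> need not converge, whereas the integral below
  always does. The kernel has no meaning at the single point \<open>y = x\<close>, which is a null set.\<close>

definition velocity :: "(real^2 \<Rightarrow> real) \<Rightarrow> real^2 \<Rightarrow> real^2" where
  "velocity \<omega> x = (LINT y|lebesgue. \<omega> y *\<^sub>R perp_grad laplace_fundamental (x - y))"

lemma perp_grad_laplace_fundamental:
  assumes "x \<noteq> 0"
  shows "perp_grad laplace_fundamental x = (1 / (2 * pi * (norm x)\<^sup>2)) *\<^sub>R vector [- x $ 2, x $ 1]"
proof -
  have "((\<lambda>x. ln (norm x)) has_derivative (\<lambda>h. (x \<bullet> h) / (norm x)\<^sup>2)) (at x)"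
    by (rule has_derivative_eq_rhs [OF has_derivative_ln [OF _ has_derivative_norm [OF assms]]])
      (use assms in \<open>auto simp: fun_eq_iff sgn_div_norm inner_commute power2_eq_square field_simps\<close>)
  then have "(laplace_fundamental has_derivative (\<lambda>h. (x \<bullet> h) / (norm x)\<^sup>2 / (2 * pi))) (at x)"
    unfolding laplace_fundamental_def
    by (simp only: divide_inverse) (rule has_derivative_mult_left)
  then have "frechet_derivative laplace_fundamental (at x) = (\<lambda>h. (x \<bullet> h) / (norm x)\<^sup>2 / (2 * pi))"
    by (rule frechet_derivative_at [symmetric])
  then show ?thesis
    by (simp add: perp_grad_def vec_eq_iff forall_2 inner_axis field_simps)
qed

text \<open>Test functions of class \<open>C\<^sup>1\<close> with compact support in space-time. Restricted to
  \<open>t \<ge> 0\<close>, they need not vanish at \<open>t = 0\<close>.\<close>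

definition test_function :: "(real \<times> (real^2) \<Rightarrow> real) \<Rightarrow> bool" where
  "test_function \<phi> \<longleftrightarrow>
     (\<forall>p. \<phi> differentiable (at p)) \<and>
     (\<forall>v. continuous_on UNIV (\<lambda>p. frechet_derivative \<phi> (at p) v)) \<and>
     bounded {p. \<phi> p \<noteq> 0}"

text \<open>The space-time derivative of \<open>\<phi>\<close> in the direction \<open>(1, u)\<close> is \<open>\<partial>\<^sub>t \<phi> + u \<cdot> \<nabla> \<phi>\<close>.
  The representative of \<open>\<omega>\<close> is required to satisfy the \<open>L\<^sup>1 \<inter> L\<^sup>\<infinity>\<close> bound at every time, not just at
  almost every time.\<close>

definition yudovich_solution :: "(real^2 \<Rightarrow> real) \<Rightarrow> (real \<Rightarrow> real^2 \<Rightarrow> real) \<Rightarrow> bool" where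
  "yudovich_solution \<omega>\<^sub>0 \<omega> \<longleftrightarrow>
     set_borel_measurable lebesgue ({0..} \<times> UNIV) (\<lambda>(t, x). \<omega> t x) \<and>
     (\<exists>C. \<forall>t\<ge>0. integrable lebesgue (\<omega> t) \<and> (LINT x|lebesgue. \<bar>\<omega> t x\<bar>) \<le> C \<and>
       (AE x in lebesgue. \<bar>\<omega> t x\<bar> \<le> C)) \<and>
     (\<forall>\<phi>. test_function \<phi> \<longrightarrow>
       (LINT p:{0..} \<times> UNIV|lebesgue.
          (case p of (t, x) \<Rightarrow> \<omega> t x * frechet_derivative \<phi> (at (t, x)) (1, velocity (\<omega> t) x)))
       + (LINT x|lebesgue. \<omega>\<^sub>0 x * \<phi> (0, x)) = 0)"

definition flow_map :: "(real \<Rightarrow> real^2 \<Rightarrow> real^2) \<Rightarrow> (real \<Rightarrow> real^2 \<Rightarrow> real^2) \<Rightarrow> bool" where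
  "flow_map u \<Phi> \<longleftrightarrow>
     (\<forall>x. \<Phi> 0 x = x) \<and>
     (\<forall>x. \<forall>t\<ge>0. ((\<lambda>s. \<Phi> s x) has_vector_derivative u t (\<Phi> t x)) (at t within {0..}))"

definition sector :: "real \<Rightarrow> real \<Rightarrow> (real^2) set" where
  "sector \<beta> \<alpha> = {vector [s * cos \<theta>, s * sin \<theta>] | s \<theta>. 0 < s \<and> \<beta> < \<theta> \<and> \<theta> < \<beta> + \<alpha>}"

definition has_corner_at_0 :: "(real^2) set \<Rightarrow> real \<Rightarrow> bool" where
  "has_corner_at_0 \<Omega> \<alpha> \<longleftrightarrow> 0 < \<alpha> \<and> \<alpha> < pi \<and>
     (\<exists>\<beta>. ((\<lambda>r. measure lebesgue (ball 0 r \<inter> sym_diff \<Omega> (sector \<beta> \<alpha>)) / measure lebesgue (ball (0::real^2) r))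
            \<longlongrightarrow> 0) (at_right 0))"

end

theory Submission
  imports Defs
begin

text \<open>Identify the plane with \<open>\<complex>\<close> and let \<open>X\<close> be the trajectory starting at the corner. At distance
  about \<open>2\<^sup>-\<^sup>i\<close> from \<open>X\<close>, the velocity relative to \<open>X\<close> is the linear field \<open>m\<^sub>i (t) * cnj h\<close> up to an error
  of the order of that distance, where the coefficient \<open>m\<^sub>i\<close> integrates the vorticity at distances
  larger than \<open>2\<^sup>-\<^sup>i\<close> against \<open>- \<i> / (2 * pi * (cnj h)\<^sup>2)\<close>. Each dyadic shell contributes a bounded amount to
  \<open>m\<^sub>i\<close>, so \<open>m\<^sub>i\<close> grows linearly in \<open>i\<close>, and on the time scale \<open>t \<sim> s / i\<close> the corner is deformed
  by an amount of order one while all error terms still tend to zero.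

  In the limit the corner stays a sector, spanned by two vectors \<open>e1 s\<close> and \<open>e2 s\<close> that obey
  \<open>e' = m s * cnj e\<close>, where \<open>s * m s\<close> is the integral over \<open>{0..s}\<close> of the coefficient \<open>a\<close> produced by one
  shell of the sector. For an initial opening below \<open>pi / 2\<close> this system has an explicit solution in
  terms of a scalar function, and the opening of the sector tends to zero as \<open>s\<close> grows. An induction
  over \<open>i\<close>, controlling the deviation of \<open>m\<^sub>i (t)\<close> from its limit for almost every \<open>t\<close>, transfers this to the
  solution: averages over discs of radius \<open>2\<^sup>-\<^sup>J\<close> around \<open>X\<close> at times \<open>t \<sim> S / J\<close> are close to those of a
  sector with small opening.\<close>

section \<open>Continuously differentiable functions\<close>

text \<open>The velocity is only log-Lipschitz, so no single linear field describes the flow near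
  the corner at all small scales. The induction closes because scale \<open>i\<close> is driven by
  the larger scales only: at time \<open>t\<close>, shell \<open>l\<close> is a sector of model time
  proportional to \<open>l * t\<close>, and the shell contributions over \<open>l < i\<close> form a
  Riemann sum for the integral of \<open>a\<close>. This is the origin of the nonlocal relation
  between \<open>m\<close> and \<open>a\<close>. One scale costs an error of order
  \<open>eps i + T * (1 + M)\<close>, where \<open>eps i\<close> is the initial deviation from the
  sector, \<open>T\<close> the time span and \<open>M\<close> the error so far. With
  \<open>T\<close> of order \<open>1 / J\<close>, a discrete Gronwall argument gives
  \<open>M = o(J)\<close> at scale \<open>J\<close>; thus \<open>T * M\<close> tends to 0 although
  \<open>M\<close> need not stay bounded. An opening below pi/2 makes the initial value of the
  scalar function positive. From there it grows without bound, and the opening is a decreasing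
  function of it. A second obstacle is low regularity: the equation holds weakly and the trajectory
  enters only with a bounded derivative. Hence the dynamics is tested against smooth averages that
  follow the trajectory, and conclusions hold for almost every time.\<close>

definition C1 :: "('a::euclidean_space \<Rightarrow> 'b::real_normed_vector) \<Rightarrow> bool" where
  "C1 f \<longleftrightarrow> (\<forall>x. f differentiable (at x)) \<and> (\<forall>v. continuous_on UNIV (\<lambda>x. frechet_derivative f (at x) v))"

lemma C1I:
  assumes "\<And>x. (f has_derivative f' x) (at x)" "\<And>v. continuous_on UNIV (\<lambda>x. f' x v)"
  shows "C1 f"
proof -
  have "frechet_derivative f (at x) = f' x" for x
    using frechet_derivative_at[OF assms(1)] by simp
  then show ?thesis
    unfolding C1_def using assms by (auto simp: differentiable_def)
qed

lemma C1D: "C1 f \<Longrightarrow> (f has_derivative frechet_derivative f (at x)) (at x)"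
  by (simp add: C1_def frechet_derivative_works)

lemma C1_continuous: "C1 f \<Longrightarrow> continuous_on A f"
  by (meson C1D continuous_at_imp_continuous_on has_derivative_continuous)

lemma C1_bounded_linear: "C1 f \<Longrightarrow> bounded_linear (frechet_derivative f (at x))"
  using C1D has_derivative_bounded_linear by blast

lemma frechet_expand:
  assumes "C1 f"
  shows "frechet_derivative f (at x) v = (\<Sum>b\<in>Basis. (v \<bullet> b) *\<^sub>R frechet_derivative f (at x) b)"
proof -
  interpret bounded_linear "frechet_derivative f (at x)" by (rule C1_bounded_linear[OF assms])
  have "frechet_derivative f (at x) v = frechet_derivative f (at x) (\<Sum>b\<in>Basis. (v \<bullet> b) *\<^sub>R b)"
    by (simp add: euclidean_representation)
  also have "\<dots> = (\<Sum>b\<in>Basis. (v \<bullet> b) *\<^sub>R frechet_derivative f (at x) b)"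
    by (simp add: sum scaleR)
  finally show ?thesis .
qed

text \<open>Expanding the direction in the basis reduces joint continuity in point and direction to
  the fixed directions in \<open>C1\<close>.\<close>

lemma C1_continuous_derivative:
  assumes "C1 f" "continuous_on A g" "continuous_on A h"
  shows "continuous_on A (\<lambda>x. frechet_derivative f (at (g x)) (h x))"
proof -
  have "continuous_on A (\<lambda>x. frechet_derivative f (at (g x)) b)" for b
    by (rule continuous_on_compose2[OF _ assms(2), of UNIV]) (use assms(1) in \<open>auto simp: C1_def\<close>)
  then show ?thesis
    by (subst frechet_expand[OF assms(1)]) (intro continuous_intros assms)
qed

lemma frechet_bound:
  fixes B :: real
  assumes "C1 f" "\<And>b. b \<in> Basis \<Longrightarrow> norm (frechet_derivative f (at x) b) \<le> B"
  shows "norm (frechet_derivative f (at x) v) \<le> DIM('a) * B * norm (v::'a::euclidean_space)"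
proof -
  have "norm (frechet_derivative f (at x) v) \<le> (\<Sum>b\<in>Basis. norm ((v \<bullet> b) *\<^sub>R frechet_derivative f (at x) b))"
    by (subst frechet_expand[OF assms(1)]) (rule norm_sum)
  also have "\<dots> \<le> (\<Sum>b\<in>(Basis::'a set). norm v * B)"
    by (intro sum_mono) (auto intro!: mult_mono assms(2) simp: Basis_le_norm)
  finally show ?thesis by (simp add: mult_ac)
qed

lemma C1_compose:
  assumes "C1 f" "C1 g"
  shows "C1 (\<lambda>x. f (g x))"
proof (rule C1I)
  show "((\<lambda>x. f (g x)) has_derivative (\<lambda>v. frechet_derivative f (at (g x)) (frechet_derivative g (at x) v))) (at x)" for x
    using has_derivative_compose[OF C1D[OF assms(2)] C1D[OF assms(1)]] .
  show "continuous_on UNIV (\<lambda>x. frechet_derivative f (at (g x)) (frechet_derivative g (at x) v))" for v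
    by (rule C1_continuous_derivative[OF assms(1) C1_continuous[OF assms(2)]])
       (use assms(2) in \<open>simp add: C1_def\<close>)
qed

lemma C1_const [intro, simp]: "C1 (\<lambda>x. c)"
  by (rule C1I[of _ "\<lambda>x v. 0"]) (auto intro!: derivative_eq_intros)

lemma C1_linear: "bounded_linear f \<Longrightarrow> C1 f"
  by (rule C1I[of _ "\<lambda>x v. f v"]) (auto intro: bounded_linear_imp_has_derivative)

lemma C1_add: "C1 f \<Longrightarrow> C1 g \<Longrightarrow> C1 (\<lambda>x. f x + g x)"
  by (rule C1I[OF has_derivative_add[OF C1D C1D]]) (auto intro!: continuous_intros C1_continuous_derivative)

lemma C1_diff: "C1 f \<Longrightarrow> C1 g \<Longrightarrow> C1 (\<lambda>x. f x - g x)"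
  by (rule C1I[OF has_derivative_diff[OF C1D C1D]]) (auto intro!: continuous_intros C1_continuous_derivative)

lemma C1_mult:
  fixes f g :: "'a::euclidean_space \<Rightarrow> 'b::real_normed_algebra"
  assumes "C1 f" "C1 g"
  shows "C1 (\<lambda>x. f x * g x)"
  by (rule C1I[OF has_derivative_mult[OF C1D C1D]])
     (intro assms continuous_on_add continuous_on_mult C1_continuous_derivative C1_continuous
        continuous_on_id continuous_on_const)+

lemma C1_bounded_linear_compose: "bounded_linear h \<Longrightarrow> C1 f \<Longrightarrow> C1 (\<lambda>x. h (f x))" for f :: "'a::euclidean_space \<Rightarrow> 'b::euclidean_space"
  by (rule C1_compose[OF C1_linear])

lemma C1_real:
  fixes f :: "real \<Rightarrow> 'b::real_normed_vector"
  assumes "\<And>x. (f has_vector_derivative f' x) (at x)" "continuous_on UNIV f'"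
  shows "C1 f"
  by (rule C1I[OF assms(1)[unfolded has_vector_derivative_def]]) (intro continuous_intros assms)

lemma C1_inverse:
  fixes f :: "'a::euclidean_space \<Rightarrow> real"
  assumes "C1 f" "\<And>x. f x \<noteq> 0"
  shows "C1 (\<lambda>x. inverse (f x))"
  by (rule C1I[OF Deriv.has_derivative_inverse[OF assms(2) C1D[OF assms(1)]]])
     (intro assms continuous_on_minus continuous_on_mult continuous_on_inverse C1_continuous_derivative
        C1_continuous[OF assms(1)] continuous_on_id continuous_on_const ballI)+

section \<open>Cutoffs and the linearised Biot--Savart kernel\<close>

text \<open>Squaring removes the kink of the positive part, so that all cutoffs below can be
  assembled algebraically from this one function.\<close>

lemma C1_pos_square: "C1 (\<lambda>x::real. (max 0 x)\<^sup>2)"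
proof (rule C1_real[where f'="\<lambda>x. 2 * max 0 x"])
  show "continuous_on UNIV (\<lambda>x::real. 2 * max 0 x)" by (intro continuous_intros)
  fix x :: real
  consider "x < 0" | "x > 0" | "x = 0" by linarith
  then have "((\<lambda>x. (max 0 x)\<^sup>2) has_real_derivative 2 * max 0 x) (at x)"
  proof cases
    case 1
    then have "\<forall>\<^sub>F y in nhds x. (max 0 y)\<^sup>2 = (0::real)"
      using eventually_nhds_in_open[of "{..<0}" x] by (auto elim!: eventually_mono)
    from DERIV_cong_ev[OF refl this refl, THEN iffD2, OF DERIV_const] show ?thesis using 1 by simp
  next
    case 2
    then have "\<forall>\<^sub>F y in nhds x. (max 0 y)\<^sup>2 = y\<^sup>2"
      using eventually_nhds_in_open[of "{0<..}" x] by (auto elim!: eventually_mono simp: max_def)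
    from DERIV_cong_ev[OF refl this refl, THEN iffD2, OF DERIV_power[OF DERIV_ident]] show ?thesis using 2 by simp
  next
    case 3
    have "((\<lambda>h. ((max 0 (0 + h))\<^sup>2 - (max 0 0)\<^sup>2) / h) \<longlongrightarrow> 0) (at (0::real))"
    proof (rule Lim_null_comparison[of _ "\<lambda>h. \<bar>h\<bar>"])
      show "((\<lambda>h::real. \<bar>h\<bar>) \<longlongrightarrow> 0) (at 0)" by (auto intro!: tendsto_eq_intros)
    qed (auto simp: power2_eq_square max_def intro!: always_eventually)
    then show ?thesis using 3 by (simp add: DERIV_def)
  qed
  then show "((\<lambda>x. (max 0 x)\<^sup>2) has_vector_derivative 2 * max 0 x) (at x)"
    by (simp add: has_real_derivative_iff_has_vector_derivative)
qed

text \<open>The standard quotient \<open>p / (p + q)\<close> with \<open>p\<close>, \<open>q\<close>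
  nonnegative and never both zero. It is applied to squared norms, so the thresholds 1 and 4
  correspond to the radii 1 and 2.\<close>

definition ramp :: "real \<Rightarrow> real" where
  "ramp x = (max 0 (x - 1))\<^sup>2 / ((max 0 (x - 1))\<^sup>2 + (max 0 (4 - x))\<^sup>2)"

text \<open>The denominator agrees with \<open>x\<^sup>2\<close> wherever \<open>ramp x\<close> does not vanish.\<close>

definition ramp_over_square :: "real \<Rightarrow> real" where
  "ramp_over_square x = ramp x * inverse ((max 0 x)\<^sup>2 + (max 0 (1 - x))\<^sup>2)"

lemma ramp_denominator: "0 < (max 0 (x - 1))\<^sup>2 + (max 0 (4 - x))\<^sup>2" for x :: real
  by (cases "x < 4") (auto simp: max_def add_nonneg_pos add_pos_nonneg)

lemma ramp_over_square_denominator: "0 < (max 0 x)\<^sup>2 + (max 0 (1 - x))\<^sup>2" for x :: real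
  by (cases "x < 1") (auto simp: max_def add_nonneg_pos add_pos_nonneg)

lemma ramp_0: "x \<le> 1 \<Longrightarrow> ramp x = 0" and ramp_1: "4 \<le> x \<Longrightarrow> ramp x = 1"
  and ramp_bounds: "0 \<le> ramp x" "ramp x \<le> 1"
  using ramp_denominator[of x] by (auto simp: ramp_def max_def divide_le_eq_1)

lemma ramp_mono:
  assumes "x \<le> y" shows "ramp x \<le> ramp y"
proof -
  define a b c d where "a = (max 0 (x - 1))\<^sup>2" and "b = (max 0 (4 - x))\<^sup>2"
    and "c = (max 0 (y - 1))\<^sup>2" and "d = (max 0 (4 - y))\<^sup>2"
  have "0 \<le> a" "0 \<le> d" "a \<le> c" "d \<le> b" unfolding a_def b_def c_def d_def
    using assms by (auto intro!: power_mono)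
  then have "a * d \<le> c * b" by (intro mult_mono) auto
  then show ?thesis
    using ramp_denominator[of x] ramp_denominator[of y]
    unfolding ramp_def a_def[symmetric] b_def[symmetric] c_def[symmetric] d_def[symmetric]
    by (simp add: divide_le_eq le_divide_eq field_simps)
qed

lemma C1_ramp: "C1 ramp"
proof -
  have 1: "C1 (\<lambda>x::real. (max 0 (x - 1))\<^sup>2)" "C1 (\<lambda>x::real. (max 0 (4 - x))\<^sup>2)"
    by (rule C1_compose[OF C1_pos_square], intro C1_diff C1_const C1_linear bounded_linear_ident)+
  show ?thesis unfolding ramp_def divide_inverse
    using ramp_denominator by (intro C1_mult C1_inverse C1_add 1) (simp add: less_imp_neq[symmetric])
qed

lemma C1_ramp_over_square: "C1 ramp_over_square"
proof -
  have 1: "C1 (\<lambda>x::real. (max 0 (1 - x))\<^sup>2)"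
    by (rule C1_compose[OF C1_pos_square], intro C1_diff C1_const C1_linear bounded_linear_ident)
  show ?thesis unfolding ramp_over_square_def
    using ramp_over_square_denominator
    by (intro C1_mult C1_inverse C1_add 1 C1_ramp C1_pos_square) (simp add: less_imp_neq[symmetric])
qed

lemma ramp_over_square_eq: "ramp_over_square x = (if x = 0 then 0 else ramp x / x\<^sup>2)"
  by (cases "x \<le> 1") (auto simp: ramp_over_square_def ramp_0 max_def divide_inverse)

lemma C1_norm_square: "C1 (\<lambda>z::complex. (norm z)\<^sup>2)"
proof -
  have "C1 (\<lambda>z::complex. Re z * Re z + Im z * Im z)"
    by (intro C1_add C1_mult C1_linear bounded_linear_Re bounded_linear_Im)
  then show ?thesis unfolding cmod_power2 unfolding power2_eq_square .
qed

text \<open>Biot--Savart kernel and its linearisation: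
  \<open>bs (h - w) - bs (- w) \<approx> strain w * cnj h\<close>.\<close>

definition bs :: "complex \<Rightarrow> complex" where
  "bs z = \<i> / (2 * pi * cnj z)"

definition strain :: "complex \<Rightarrow> complex" where
  "strain w = - \<i> / (2 * pi * (cnj w)\<^sup>2)"

definition far :: "complex \<Rightarrow> real" where "far w = ramp ((norm w)\<^sup>2)"

text \<open>This is \<open>far w * strain w\<close> (see \<open>far_strain_eq\<close>) in a form
  without division by \<open>cnj w\<close>. Since \<open>1 / (cnj w)^2 = w^2 / norm w ^ 4\<close>,
  the singularity is absorbed in \<open>ramp_over_square\<close>, and smoothness at 0 follows by
  composition.\<close>

definition far_strain :: "complex \<Rightarrow> complex" where
  "far_strain w = - \<i> / (2 * pi) * w\<^sup>2 * ramp_over_square ((norm w)\<^sup>2)"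

text \<open>As \<open>strain\<close> is homogeneous of degree -2, the rescaled weights
  \<open>b^2 * far_strain (b * w)\<close> agree far out for all \<open>b > 0\<close>. Their
  difference for \<open>b = 2\<close> and \<open>b = 1\<close> is therefore supported in the shell
  of radii between 1/2 and 2.\<close>

definition shell_strain :: "complex \<Rightarrow> complex" where
  "shell_strain w = 4 * far_strain (2 * w) - far_strain w"

lemma far_strain_eq: "far_strain w = far w * strain w"
proof (cases "w = 0")
  case False
  have "w\<^sup>2 / ((norm w)\<^sup>2)\<^sup>2 = 1 / (cnj w)\<^sup>2"
  proof -
    have "(complex_of_real ((norm w)\<^sup>2))\<^sup>2 = w\<^sup>2 * (cnj w)\<^sup>2"
      unfolding complex_norm_square by (simp add: power_mult_distrib)
    then show ?thesis using False by (simp add: field_simps)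
  qed
  then show ?thesis using False
    by (simp add: far_strain_def far_def strain_def ramp_over_square_eq divide_simps)
qed (simp add: far_strain_def strain_def)

lemma far_cases: "norm w \<le> 1 \<Longrightarrow> far w = 0" "2 \<le> norm w \<Longrightarrow> far w = 1" "0 \<le> far w" "far w \<le> 1"
  unfolding far_def using ramp_bounds power_mono[of 2 "norm w" 2]
  by (auto intro!: ramp_0 ramp_1 simp: abs_square_le_1 power_le_one)

lemma C1_far: "C1 far"
  unfolding far_def by (rule C1_compose[OF C1_ramp C1_norm_square])

lemma C1_far_strain: "C1 far_strain"
proof -
  have "C1 (\<lambda>w::complex. - \<i> / (2 * pi) * (w * w) * complex_of_real (ramp_over_square ((norm w)\<^sup>2)))"
    by (intro C1_mult C1_const C1_linear[OF bounded_linear_ident]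
        C1_bounded_linear_compose[OF bounded_linear_of_real] C1_compose[OF C1_ramp_over_square C1_norm_square])
  then show ?thesis unfolding far_strain_def power2_eq_square[of "_::complex"] .
qed

lemma C1_shell_strain: "C1 shell_strain"
  unfolding shell_strain_def
  by (intro C1_mult C1_diff C1_const C1_far_strain C1_compose[OF C1_far_strain] C1_linear bounded_linear_ident)

lemma shell_strain_0: "2 \<le> norm w \<Longrightarrow> shell_strain w = 0"
  by (simp add: shell_strain_def far_strain_eq far_cases norm_mult strain_def field_simps power2_eq_square)

lemma norm_far_strain_le: "norm (far_strain w) \<le> 1"
proof (cases "norm w \<le> 1")
  case True then show ?thesis by (simp add: far_strain_eq far_cases)
next
  case False
  have "norm (far_strain w) \<le> 1 / (2 * pi * (norm w)\<^sup>2)"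
    using far_cases[of w] by (simp add: far_strain_eq strain_def norm_mult norm_divide norm_power divide_right_mono)
  also have "\<dots> \<le> 1"
  proof -
    have "1 \<le> (norm w)\<^sup>2" "1 \<le> 2 * pi" using False pi_gt3 by (auto simp: one_le_power)
    then have "1 * 1 \<le> (2 * pi) * (norm w)\<^sup>2" by (intro mult_mono) auto
    then show ?thesis by (simp add: divide_le_eq_1)
  qed
  finally show ?thesis .
qed

section \<open>Lebesgue measure in the different coordinates of the plane\<close>

text \<open>Lebesgue measure is determined by its values on boxes, and a map that matches the
  coordinate axes pulls a box back to a box with the same side lengths. It serves to identify both
  \<open>real^2\<close> and \<open>real \<times> real\<close> with the complex plane.\<close>

lemma lborel_distr_basis_permuting:
  fixes f :: "'a::euclidean_space \<Rightarrow> 'b::euclidean_space"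
  assumes bij: "bij_betw f Basis Basis" and inner: "\<And>x b. b \<in> Basis \<Longrightarrow> f x \<bullet> f b = x \<bullet> b"
    and meas: "f \<in> borel_measurable borel"
  shows "distr lborel borel f = lborel"
proof (rule lborel_eqI[symmetric])
  fix l u :: 'b assume lu: "\<And>b. b \<in> Basis \<Longrightarrow> l \<bullet> b \<le> u \<bullet> b"
  let ?p = "\<lambda>z. \<Sum>b\<in>Basis. (z \<bullet> f b) *\<^sub>R b"
  have B: "Basis = f ` Basis" using bij by (simp add: bij_betw_def)
  have p: "?p z \<bullet> b = z \<bullet> f b" if "b \<in> Basis" for z b
    using that by (simp add: inner_sum_left inner_Basis if_distrib cong: if_cong)
  have "f -` box l u = box (?p l) (?p u)"
    unfolding box_def by (subst B) (auto simp: p inner)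
  then have "emeasure (distr lborel borel f) (box l u) = emeasure lborel (box (?p l) (?p u))"
    using meas by (simp add: emeasure_distr)
  also have "\<dots> = (\<Prod>b\<in>Basis. (?p u - ?p l) \<bullet> b)"
    by (rule emeasure_lborel_box) (use lu B p in auto)
  also have "(\<Prod>b\<in>Basis. (?p u - ?p l) \<bullet> b) = (\<Prod>b\<in>Basis. (u - l) \<bullet> f b)"
    by (rule prod.cong) (auto simp: inner_diff_left p)
  also have "\<dots> = (\<Prod>b\<in>Basis. (u - l) \<bullet> b)"
    by (rule prod.reindex_bij_betw[OF bij])
  finally show "emeasure (distr lborel borel f) (box l u) = (\<Prod>b\<in>Basis. (u - l) \<bullet> b)" .
qed simp

definition cx :: "real^2 \<Rightarrow> complex" where "cx x = Complex (x $ 1) (x $ 2)"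
definition vc :: "complex \<Rightarrow> real^2" where "vc z = vector [Re z, Im z]"

lemma cx_vc [simp]: "cx (vc z) = z" and vc_cx [simp]: "vc (cx x) = x"
  and vc_nth [simp]: "vc z $ 1 = Re z" "vc z $ 2 = Im z" and Re_cx [simp]: "Re (cx x) = x $ 1" "Im (cx x) = x $ 2"
  by (simp_all add: cx_def vc_def vec_eq_iff forall_2)

lemma norm_cx [simp]: "norm (cx x) = norm x"
  by (simp add: cmod_def norm_vec_def L2_set_def sum_2)

lemma bounded_linear_cx: "bounded_linear cx"
  by (rule bounded_linear_intro[where K=1]) (simp_all add: complex_eq_iff)

lemma norm_vc [simp]: "norm (vc z) = norm z"
  by (metis cx_vc norm_cx)

lemma bounded_linear_vc: "bounded_linear vc"
  by (rule bounded_linear_intro[where K=1]) (auto simp: vec_eq_iff forall_2)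

lemma cx_borel [measurable]: "cx \<in> borel_measurable borel" and vc_borel [measurable]: "vc \<in> borel_measurable borel"
  using bounded_linear_cx bounded_linear_vc
  by (auto intro!: borel_measurable_continuous_onI linear_continuous_on)

lemma distr_cx: "distr lborel borel cx = lborel"
proof (rule lborel_distr_basis_permuting[OF _ _ cx_borel])
  have B: "(Basis :: (real^2) set) = {axis 1 1, axis 2 1}"
    by (auto simp: Basis_vec_def UNIV_2)
  have c: "cx (axis 1 1) = 1" "cx (axis 2 1) = \<i>"
    by (auto simp: complex_eq_iff axis_def)
  have a: "axis 1 1 $ (2::2) = (0::real)" "axis 2 1 $ (1::2) = (0::real)"
    by (auto simp: axis_def)
  show "bij_betw cx Basis Basis"
    by (auto simp: bij_betw_def inj_on_def B c Basis_complex_def complex_eq_iff axis_def)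
  show "cx x \<bullet> cx b = x \<bullet> b" if "b \<in> Basis" for x b
    using that by (auto simp: B c inner_axis inner_complex_def a)
qed

lemma distr_Complex: "distr lborel borel (\<lambda>p. Complex (fst p) (snd p)) = lborel"
proof (rule lborel_distr_basis_permuting)
  show "bij_betw (\<lambda>p. Complex (fst p) (snd p)) Basis Basis"
    by (auto simp: bij_betw_def inj_on_def Basis_prod_def Basis_complex_def complex_eq_iff)
  show "Complex (fst x) (snd x) \<bullet> Complex (fst b) (snd b) = x \<bullet> b" if "b \<in> Basis" for x b :: "real \<times> real"
    by (auto simp: inner_complex_def inner_prod_def)
  show "(\<lambda>p. Complex (fst p) (snd p)) \<in> borel_measurable borel"
    unfolding Complex_eq by (intro borel_measurable_continuous_onI continuous_intros)
qed

section \<open>Singular integrals by dyadic decomposition\<close>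

lemma emeasure_ball_complex: "0 \<le> r \<Longrightarrow> emeasure lborel (ball (c::complex) r) = ennreal (pi * r\<^sup>2)"
  by (simp add: emeasure_ball unit_ball_vol_2)

text \<open>Every point of the support, apart from the centre where \<open>f\<close> may be
  singular, is charged to one ball; the resulting series of multiples of indicators is integrated
  term by term.\<close>

lemma nn_integral_le_sum_balls:
  fixes f :: "complex \<Rightarrow> ennreal"
  assumes "\<And>z. z \<noteq> c \<Longrightarrow> f z \<noteq> 0 \<Longrightarrow> \<exists>n. z \<in> ball c (r n) \<and> f z \<le> ennreal (a n)" "\<And>n. 0 \<le> r n" "\<And>n. 0 \<le> a n"
    and "(\<lambda>n. a n * (pi * (r n)\<^sup>2)) sums S" 
  shows "(\<integral>\<^sup>+z. f z \<partial>lborel) \<le> ennreal S"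
proof -
  have "AE z in lborel. z \<noteq> c" by (rule AE_lborel_singleton)
  then have "(\<integral>\<^sup>+z. f z \<partial>lborel) \<le> (\<integral>\<^sup>+z. (\<Sum>n. ennreal (a n) * indicator (ball c (r n)) z) \<partial>lborel)"
  proof (rule nn_integral_mono_AE[OF AE_mp], intro AE_I2 impI)
    fix z assume z: "z \<noteq> c"
    show "f z \<le> (\<Sum>i. ennreal (a i) * indicator (ball c (r i)) z)"
    proof (cases "f z = 0")
      case False
    then obtain n where n: "z \<in> ball c (r n)" "f z \<le> ennreal (a n)" using assms(1)[OF z] by blast
    then have "f z \<le> (\<Sum>i\<in>{n}. ennreal (a i) * indicator (ball c (r i)) z)" by simp
    also have "\<dots> \<le> (\<Sum>i. ennreal (a i) * indicator (ball c (r i)) z)"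
      by (rule sum_le_suminf) auto
    finally show ?thesis .
    qed simp
  qed
  also have "\<dots> = (\<Sum>n. (\<integral>\<^sup>+z. ennreal (a n) * indicator (ball c (r n)) z \<partial>lborel))"
    by (rule nn_integral_suminf) (intro borel_measurable_times_ennreal borel_measurable_indicator, simp_all)
  also have "\<dots> = (\<Sum>n. ennreal (a n * (pi * (r n)\<^sup>2)))"
    using assms(2,3) by (simp add: nn_integral_cmult_indicator emeasure_ball_complex ennreal_mult)
  also have "\<dots> = ennreal S"
    using assms by (intro suminf_ennreal_eq) auto
  finally show ?thesis .
qed

text \<open>In the ball of radius \<open>R / 2^n\<close> but outside the next smaller one the
  integrand is at most \<open>2 * 2^n / R\<close>, and the contributions form a geometric series.
  The exact value is \<open>2 * pi * R\<close>; a factor 2 is lost.\<close>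

lemma nn_integral_inverse_norm_ball:
  fixes c :: complex
  assumes "0 < R"
  shows "(\<integral>\<^sup>+z. ennreal (indicator (ball c R) z / norm (z - c)) \<partial>lborel) \<le> ennreal (4 * pi * R)"
proof (rule nn_integral_le_sum_balls[where r="\<lambda>n. R / 2^n" and a="\<lambda>n. 2 * 2^n / R" and c=c])
  fix z assume z: "z \<noteq> c" and "ennreal (indicator (ball c R) z / norm (z - c)) \<noteq> 0"
  then have in_ball: "z \<in> ball c R" by (auto simp: indicator_def split: if_splits)
  let ?d = "norm (z - c)"
  have d: "0 < ?d" "?d < R" using in_ball z by (auto simp: dist_norm norm_minus_commute)
  obtain N where "R / ?d < 2 ^ N" using real_arch_pow[of 2] by auto
  then have "\<exists>n. R \<le> 2 ^ n * ?d" using d by (intro exI[of _ N]) (simp add: field_simps)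
  \<comment> \<open>The least such \<open>n\<close> locates the dyadic annulus of \<open>z\<close>.
    It is positive because \<open>z\<close> lies inside the ball, so its predecessor is available as
    the index of the radius.\<close>
  then obtain n where n: "R \<le> 2 ^ n * ?d" "\<And>k. k < n \<Longrightarrow> \<not> R \<le> 2 ^ k * ?d"
    using exists_least_iff[of "\<lambda>n. R \<le> 2 ^ n * ?d"] by auto
  then obtain k where k: "n = Suc k" using d by (cases n) auto
  have "2 ^ k * ?d < R" using n(2)[of k] k by auto
  then show "\<exists>n. z \<in> ball c (R / 2^n) \<and> ennreal (indicator (ball c R) z / norm (z - c)) \<le> ennreal (2 * 2^n / R)"
    using n(1) d assms in_ball k
    by (intro exI[of _ k]) (auto simp: dist_norm norm_minus_commute field_simps intro!: ennreal_leI)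
next
  have "(\<lambda>n. (2 * pi * R) * (1 / 2) ^ n) sums ((2 * pi * R) * (1 / (1 - 1 / 2)))"
    by (intro sums_mult geometric_sums) simp
  then show "(\<lambda>n. 2 * 2^n / R * (pi * (R / 2^n)\<^sup>2)) sums (4 * pi * R)"
    using assms by (simp add: power2_eq_square field_simps power_divide)
qed (use assms in auto)

text \<open>The same decomposition outwards: between the radii \<open>2^n * R\<close> and
  \<open>2 * 2^n * R\<close> the cube in the denominator beats the area and leaves a geometric
  series.\<close>

lemma nn_integral_inverse_norm_cube:
  fixes c :: complex
  assumes "0 < R"
  shows "(\<integral>\<^sup>+z. ennreal (indicator (- ball c R) z / norm (z - c) ^ 3) \<partial>lborel) \<le> ennreal (8 * pi / R)"
proof (rule nn_integral_le_sum_balls[where r="\<lambda>n. 2 * 2^n * R" and a="\<lambda>n. 1 / (2^n * R)^3" and c=c])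
  fix z assume z: "z \<noteq> c" and "ennreal (indicator (- ball c R) z / norm (z - c) ^ 3) \<noteq> 0"
  then have in_ball: "z \<notin> ball c R" by (auto simp: indicator_def split: if_splits)
  let ?d = "norm (z - c)"
  have d: "R \<le> ?d" using in_ball z by (auto simp: dist_norm norm_minus_commute)
  obtain N where "?d / R < 2 ^ N" using real_arch_pow[of 2] by auto
  then have "\<exists>n. ?d < 2 ^ n * R" using assms by (intro exI[of _ N]) (simp add: field_simps)
  then obtain n where n: "?d < 2 ^ n * R" "\<And>k. k < n \<Longrightarrow> \<not> ?d < 2 ^ k * R"
    using exists_least_iff[of "\<lambda>n. ?d < 2 ^ n * R"] by auto
  then obtain k where k: "n = Suc k" using d by (cases n) auto
  have k1: "2 ^ k * R \<le> ?d" using n(2)[of k] k by auto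
  have "1 / ?d ^ 3 \<le> 1 / (2 ^ k * R) ^ 3"
    using assms k1 z by (intro divide_left_mono power_mono mult_pos_pos zero_less_power) auto
  then show "\<exists>n. z \<in> ball c (2 * 2^n * R) \<and> ennreal (indicator (- ball c R) z / norm (z - c) ^ 3) \<le> ennreal (1 / (2^n * R)^3)"
    using n(1) in_ball k
    by (intro exI[of _ k]) (auto simp: dist_norm norm_minus_commute intro!: ennreal_leI)
next
  have "(\<lambda>n. (4 * pi / R) * (1 / 2) ^ n) sums ((4 * pi / R) * (1 / (1 - 1 / 2)))"
    by (intro sums_mult geometric_sums) simp
  moreover have "1 / (2^n * R)^3 * (pi * (2 * 2^n * R)\<^sup>2) = (4 * pi / R) * (1 / 2) ^ n" for n
    using assms by (simp add: power2_eq_square power3_eq_cube field_simps)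
  ultimately show "(\<lambda>n. 1 / (2^n * R)^3 * (pi * (2 * 2^n * R)\<^sup>2)) sums (8 * pi / R)" by simp
qed (use assms in auto)

section \<open>The velocity of a bounded vorticity\<close>

definition vel :: "(complex \<Rightarrow> real) \<Rightarrow> complex \<Rightarrow> complex" where
  "vel w x = (LINT y|lborel. w y * bs (x - y))"

lemma bs_borel [measurable]: "bs \<in> borel_measurable borel"
proof -
  have "cnj \<in> borel_measurable borel"
    by (intro borel_measurable_continuous_onI continuous_intros)
  then show ?thesis unfolding bs_def by measurable
qed

lemma norm_bs: "norm (bs z) = 1 / (2 * pi * norm z)"
  by (simp add: bs_def norm_divide norm_mult)

lemma norm_bs_le: "norm (bs z) \<le> 1 / norm z"
  unfolding norm_bs using pi_gt3
  by (cases "z = 0") (auto intro!: frac_le simp: mult_le_cancel_right1)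

lemma indicator_over_norm_measurable:
  assumes "A \<in> sets borel"
  shows "(\<lambda>y::complex. indicator A y / norm (y - c) ^ n :: real) \<in> borel_measurable lborel"
  using assms by (intro borel_measurable_divide borel_measurable_power borel_measurable_norm borel_measurable_diff
      borel_measurable_indicator) auto

text \<open>One time slice of a patch solution. The bounds hold at every point rather than almost
  everywhere, which is arranged later by clipping; \<open>C0\<close> is only an upper bound for the
  mass, so that one constant can serve all times.\<close>

locale vortex =
  fixes w :: "complex \<Rightarrow> real" and C0 :: real
  assumes meas [measurable]: "w \<in> borel_measurable borel"
    and bounds: "\<And>y. 0 \<le> w y" "\<And>y. w y \<le> 1"
    and integrable: "integrable lborel w" and mass: "(LINT y|lborel. w y) \<le> C0"
begin

lemma C0_nonneg: "0 \<le> C0"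
  using Bochner_Integration.integral_nonneg[of lborel w, OF bounds(1)] mass by linarith

lemma abs_w: "\<bar>w y\<bar> \<le> 1" using bounds[of y] by simp

text \<open>The kernel is split at distance 1: inside, \<open>w\<close> is at most 1 and the kernel
  is locally integrable; outside, the kernel is at most 1 and the mass bound applies.\<close>

lemma integrable_times_bs: "integrable lborel (\<lambda>y. w y * bs (x - y))"
    and norm_vel_le: "norm (vel w x) \<le> 4 * pi + C0"
proof -
  have 1: "norm (w y * bs (x - y)) \<le> indicator (ball x 1) y / norm (y - x) + w y" for y
  proof (cases "y \<in> ball x 1")
    case True
    then have "norm (w y * bs (x - y)) \<le> 1 * (1 / norm (y - x))"
      unfolding norm_mult using norm_bs_le[of "x - y"] abs_w[of y]
      by (intro mult_mono) (auto simp: norm_minus_commute)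
    then show ?thesis using True bounds[of y] by simp
  next
    case False
    then have "1 \<le> norm (x - y)" by (auto simp: dist_norm)
    then have "norm (bs (x - y)) \<le> 1"
      using norm_bs_le[of "x - y"] divide_le_eq_1[of 1 "norm (x - y)"] by linarith
    then show ?thesis using False bounds[of y]
      by (simp add: norm_mult mult_left_le)
  qed
  have 2: "(\<integral>\<^sup>+y. norm (w y * bs (x - y)) \<partial>lborel) \<le> ennreal (4 * pi + C0)"
  proof -
    have "(\<integral>\<^sup>+y. norm (w y * bs (x - y)) \<partial>lborel) \<le> (\<integral>\<^sup>+y. ennreal (indicator (ball x 1) y / norm (y - x)) + ennreal (w y) \<partial>lborel)"
      using 1 bounds by (intro nn_integral_mono) (simp flip: ennreal_plus)
    also have "\<dots> = (\<integral>\<^sup>+y. ennreal (indicator (ball x 1) y / norm (y - x)) \<partial>lborel) + (\<integral>\<^sup>+y. ennreal (w y) \<partial>lborel)"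
    proof (rule nn_integral_add[OF measurable_compose[OF _ measurable_ennreal] measurable_compose[OF _ measurable_ennreal]])
      show "(\<lambda>y. indicator (ball x 1) y / norm (y - x) :: real) \<in> borel_measurable lborel"
        using indicator_over_norm_measurable[of "ball x 1" x 1] by simp
    qed simp
    also have "\<dots> \<le> ennreal (4 * pi * 1) + ennreal C0"
      using nn_integral_inverse_norm_ball[of 1 x] integrable mass bounds
      by (intro add_mono) (auto simp: nn_integral_eq_integral intro!: ennreal_leI)
    finally show ?thesis using C0_nonneg by (simp flip: ennreal_plus)
  qed
  show *: "integrable lborel (\<lambda>y. w y * bs (x - y))"
    using 2 by (intro integrableI_bounded) (auto simp: less_top[symmetric] top_unique)
  have "ennreal (norm (vel w x)) \<le> (\<integral>\<^sup>+y. norm (w y * bs (x - y)) \<partial>lborel)"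
    unfolding vel_def by (rule integral_norm_bound_ennreal[OF *])
  also note 2
  finally show "norm (vel w x) \<le> 4 * pi + C0" using C0_nonneg by (simp flip: ennreal_plus)
qed

text \<open>For \<open>b > 0\<close> the length scale is \<open>1 / b\<close>: the weight equals
  \<open>strain (y - X)\<close> at distances of at least \<open>2 / b\<close> and vanishes below
  \<open>1 / b\<close>. The factor \<open>b^2\<close> undoes the scaling of
  \<open>strain\<close>.\<close>

definition far_coeff :: "real \<Rightarrow> complex \<Rightarrow> complex" where
  "far_coeff b X = (LINT y|lborel. w y * (b\<^sup>2 * far_strain (b *\<^sub>R (y - X))))"

lemma integrable_times_bounded:
  fixes f :: "complex \<Rightarrow> 'a::{real_normed_field, banach, second_countable_topology}"
  assumes [measurable]: "f \<in> borel_measurable borel" and "\<And>y. norm (f y) \<le> B"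
  shows "integrable lborel (\<lambda>y. of_real (w y) * f y)" 
    and "norm (LINT y|lborel. of_real (w y) * f y) \<le> B * C0"
proof -
  have 1: "norm (of_real (w y) * f y) \<le> B * w y" for y
    using mult_right_mono[OF assms(2)[of y] bounds(1)[of y]] bounds(1)[of y]
    by (simp add: norm_mult mult.commute[of "w y"])
  have 2: "integrable lborel (\<lambda>y. B * w y)" using integrable by simp
  show 3: "integrable lborel (\<lambda>y. of_real (w y) * f y)"
    by (rule Bochner_Integration.integrable_bound[OF 2]) (use 1 in \<open>auto intro!: AE_I2 order_trans[OF 1]\<close>)
  have "norm (LINT y|lborel. of_real (w y) * f y) \<le> (LINT y|lborel. B * w y)"
    by (rule order_trans[OF integral_norm_bound integral_mono[OF integrable_norm[OF 3] 2]]) (rule 1)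
  also have "\<dots> \<le> B * C0"
    using mult_left_mono[OF mass, of B] order_trans[OF norm_ge_zero assms(2)] by simp
  finally show "norm (LINT y|lborel. of_real (w y) * f y) \<le> B * C0" .
qed

lemma far_strain_borel: "(\<lambda>y. complex_of_real (b\<^sup>2) * far_strain (b *\<^sub>R (y - X))) \<in> borel_measurable borel"
  by (intro borel_measurable_continuous_onI continuous_intros
        continuous_on_compose2[OF C1_continuous[OF C1_far_strain, of UNIV]]) auto

lemma norm_far_coeff_le: "norm (far_coeff b X) \<le> b\<^sup>2 * C0"
  unfolding far_coeff_def using norm_far_strain_le
  by (intro integrable_times_bounded(2) far_strain_borel[unfolded of_real_power])
     (simp add: norm_mult norm_power mult_left_le)

text \<open>The exact remainder of the first-order expansion of \<open>1 / (a - b)\<close> in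
  \<open>a\<close>. It is quadratic in \<open>h\<close> and decays like the inverse cube of
  \<open>z\<close>, which makes the far part integrable.\<close>

lemma bs_expansion:
  assumes "z \<noteq> 0" "h \<noteq> z"
  shows "bs (h - z) - bs (- z) - strain z * cnj h = \<i> / (2 * pi) * (cnj h)\<^sup>2 / (cnj (h - z) * (cnj z)\<^sup>2)"
proof -
  define a b where "a = cnj h" and "b = cnj z"
  have ab: "b \<noteq> 0" "a - b \<noteq> 0" "b - a \<noteq> 0" using assms by (auto simp: a_def b_def)
  have e: "c / (2 * p * (a - b)) + c / (2 * p * b) + c / (2 * p * b\<^sup>2) * a = c / (2 * p) * a\<^sup>2 / ((a - b) * b\<^sup>2)"
    if "p \<noteq> 0" for c p :: complex
  proof -
    have "1 / (a - b) + 1 / b + a / b\<^sup>2 = a\<^sup>2 / ((a - b) * b\<^sup>2)"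
      using ab by (simp add: divide_simps power2_eq_square) (simp add: algebra_simps)
    moreover have "c / (2 * p * (a - b)) + c / (2 * p * b) + c / (2 * p * b\<^sup>2) * a = c / (2 * p) * (1 / (a - b) + 1 / b + a / b\<^sup>2)"
      by (simp add: distrib_left)
    ultimately show ?thesis by simp
  qed
  show ?thesis using e[of "complex_of_real pi" \<i>]
    unfolding bs_def strain_def complex_cnj_diff complex_cnj_minus a_def[symmetric] b_def[symmetric] by simp
qed

text \<open>The part of the velocity gradient that can grow logarithmically as the scale shrinks is
  contained in \<open>far_coeff\<close>. After its removal the error is proportional to the length
  \<open>1 / b\<close> itself.\<close>

lemma vel_expansion:
  assumes b: "0 < b" and R: "1 \<le> R" and h: "norm h \<le> R / b"
  shows "norm (vel w (X + h) - vel w X - far_coeff b X * cnj h) \<le> (24 * pi * R + 4 * pi * R ^ 3) / b"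
proof -
  define \<rho> where "\<rho> = R / b"
  have \<rho>: "0 < \<rho>" and h: "norm h \<le> \<rho>" using b R h by (auto simp: \<rho>_def)
  define D where "D y = bs (X + h - y) - bs (X - y) - (b\<^sup>2 * far_strain (b *\<^sub>R (y - X))) * cnj h" for y
  \<comment> \<open>Majorant of \<open>D\<close>: near \<open>X\<close> the two kernels and the
    linear term are bounded separately, away from \<open>X\<close> the quadratic remainder is used.
    The ball of radius \<open>3 * \<rho>\<close> about \<open>X + h\<close> covers the near
    region.\<close>
  define E where "E y = indicator (ball (X + h) (3 * \<rho>)) y / norm (y - (X + h)) + indicator (ball X (2 * \<rho>)) y / norm (y - X)
    + R * b * indicator (ball X (2 * \<rho>)) y + \<rho>\<^sup>2 * (indicator (- ball X (2 * \<rho>)) y / norm (y - X) ^ 3)" for y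
  have DE: "norm (D y) \<le> E y" for y
  proof (cases "y \<in> ball X (2 * \<rho>)")
    case True
    then have "y \<in> ball (X + h) (3 * \<rho>)"
      using h norm_triangle_ineq[of "X - y" h] by (simp add: dist_norm algebra_simps)
    moreover have "norm (D y) \<le> norm (bs (X + h - y)) + norm (bs (X - y)) + norm (b\<^sup>2 * far_strain (b *\<^sub>R (y - X)) * cnj h)"
      unfolding D_def by (intro order_trans[OF norm_triangle_ineq4] add_mono) auto
    moreover have "norm (b\<^sup>2 * far_strain (b *\<^sub>R (y - X)) * cnj h) \<le> b\<^sup>2 * 1 * \<rho>"
      unfolding norm_mult using h norm_far_strain_le by (intro mult_mono) (auto simp: norm_power)
    moreover have "b\<^sup>2 * 1 * \<rho> = R * b" using b by (simp add: power2_eq_square \<rho>_def)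
    ultimately show ?thesis using True norm_bs_le[of "X + h - y"] norm_bs_le[of "X - y"]
      unfolding E_def by (simp add: norm_minus_commute)
  next
    case False
    define z where "z = y - X"
    have z: "2 * \<rho> \<le> norm z" using False by (auto simp: z_def dist_norm norm_minus_commute)
    then have z0: "z \<noteq> 0" "h \<noteq> z" using \<rho> h by auto
    have bz: "2 \<le> norm (b *\<^sub>R z)"
      using b R mult_left_mono[OF z, of b] by (auto simp: \<rho>_def)
    have "b\<^sup>2 * far_strain (b *\<^sub>R z) = strain z"
      using b far_cases(2)[OF bz] by (simp add: far_strain_eq strain_def power_mult_distrib scaleR_conv_of_real)
    then have "D y = bs (h - z) - bs (- z) - strain z * cnj h"
      unfolding D_def z_def by (simp add: algebra_simps)
    then have D: "norm (D y) = (norm h)\<^sup>2 / (2 * pi * norm (h - z) * (norm z)\<^sup>2)"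
      unfolding bs_expansion[OF z0] by (simp add: norm_mult norm_divide norm_power flip: complex_cnj_diff)
    have hz: "norm z / 2 \<le> norm (h - z)"
      using norm_triangle_ineq2[of z h] z h by (simp add: norm_minus_commute)
    have "norm z ^ 3 \<le> 2 * pi * norm (h - z) * (norm z)\<^sup>2"
    proof -
      have "norm z * (norm z)\<^sup>2 \<le> (2 * pi * norm (h - z)) * (norm z)\<^sup>2"
      proof (rule mult_right_mono)
        have "2 * 1 * (norm z / 2) \<le> 2 * pi * norm (h - z)"
          using hz pi_gt3 by (intro mult_mono) auto
        then show "norm z \<le> 2 * pi * norm (h - z)" by simp
      qed simp
      then show ?thesis by (simp add: power3_eq_cube power2_eq_square mult_ac)
    qed
    then have "norm (D y) \<le> \<rho>\<^sup>2 / norm z ^ 3"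
      unfolding D using h z0 by (intro frac_le power_mono) auto
    moreover have "0 \<le> indicator (ball (X + h) (3 * \<rho>)) y / norm (y - (X + h))" by simp
    moreover have "E y = indicator (ball (X + h) (3 * \<rho>)) y / norm (y - (X + h)) + \<rho>\<^sup>2 / norm z ^ 3"
      using False by (simp add: E_def z_def)
    ultimately show ?thesis by linarith
  qed
  have "(\<integral>\<^sup>+y. ennreal (E y) \<partial>lborel) \<le> ennreal (4 * pi * (3 * \<rho>)) + ennreal (4 * pi * (2 * \<rho>))
     + ennreal (R * b * (pi * (2 * \<rho>)\<^sup>2)) + ennreal (\<rho>\<^sup>2 * (8 * pi / (2 * \<rho>)))"
  proof -
    have m: "(\<lambda>y::complex. indicator A y / norm (y - c) :: real) \<in> borel_measurable lborel" if "A \<in> sets borel" for A c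
      using indicator_over_norm_measurable[OF that, of c 1] by simp
    have "(\<integral>\<^sup>+y. ennreal (E y) \<partial>lborel) = (\<integral>\<^sup>+y. ennreal (indicator (ball (X + h) (3 * \<rho>)) y / norm (y - (X + h))) + ennreal (indicator (ball X (2 * \<rho>)) y / norm (y - X))
    + ennreal (R * b) * indicator (ball X (2 * \<rho>)) y + ennreal (\<rho>\<^sup>2) * ennreal (indicator (- ball X (2 * \<rho>)) y / norm (y - X) ^ 3) \<partial>lborel)"
      unfolding E_def using b R
      by (intro nn_integral_cong) (auto simp: indicator_def simp flip: ennreal_plus ennreal_mult)
    also have "\<dots> = (\<integral>\<^sup>+y. ennreal (indicator (ball (X + h) (3 * \<rho>)) y / norm (y - (X + h))) \<partial>lborel)
     + (\<integral>\<^sup>+y. ennreal (indicator (ball X (2 * \<rho>)) y / norm (y - X)) \<partial>lborel)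
     + (\<integral>\<^sup>+y. ennreal (R * b) * indicator (ball X (2 * \<rho>)) y \<partial>lborel)
     + (\<integral>\<^sup>+y. ennreal (\<rho>\<^sup>2) * ennreal (indicator (- ball X (2 * \<rho>)) y / norm (y - X) ^ 3) \<partial>lborel)"
    proof -
      have f1: "(\<lambda>y. ennreal (indicator (ball (X + h) (3 * \<rho>)) y / norm (y - (X + h)))) \<in> borel_measurable lborel"
        and f2: "(\<lambda>y. ennreal (indicator (ball X (2 * \<rho>)) y / norm (y - X))) \<in> borel_measurable lborel"
        by (intro measurable_compose[OF m measurable_ennreal], simp)+
      have f3: "(\<lambda>y. ennreal (R * b) * indicator (ball X (2 * \<rho>)) y) \<in> borel_measurable lborel"
        and f4: "(\<lambda>y. ennreal (\<rho>\<^sup>2) * ennreal (indicator (- ball X (2 * \<rho>)) y / norm (y - X) ^ 3)) \<in> borel_measurable lborel"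
        by (intro borel_measurable_times_ennreal borel_measurable_const borel_measurable_indicator
          measurable_compose[OF indicator_over_norm_measurable measurable_ennreal], simp)+
      show ?thesis
        by (rule nn_integral_add[OF borel_measurable_add[OF borel_measurable_add[OF f1 f2] f3] f4,
              unfolded nn_integral_add[OF borel_measurable_add[OF f1 f2] f3] nn_integral_add[OF f1 f2]])
    qed
    also have "\<dots> \<le> ennreal (4 * pi * (3 * \<rho>)) + ennreal (4 * pi * (2 * \<rho>))
     + ennreal (R * b * (pi * (2 * \<rho>)\<^sup>2)) + ennreal (\<rho>\<^sup>2 * (8 * pi / (2 * \<rho>)))"
    proof (intro add_mono nn_integral_inverse_norm_ball)
      show "(\<integral>\<^sup>+y. ennreal (R * b) * indicator (ball X (2 * \<rho>)) y \<partial>lborel) \<le> ennreal (R * b * (pi * (2 * \<rho>)\<^sup>2))"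
        using \<rho> b R by (simp add: nn_integral_cmult_indicator emeasure_ball_complex flip: ennreal_mult)
      have "(\<integral>\<^sup>+y. ennreal (\<rho>\<^sup>2) * ennreal (indicator (- ball X (2 * \<rho>)) y / norm (y - X) ^ 3) \<partial>lborel)
        = ennreal (\<rho>\<^sup>2) * (\<integral>\<^sup>+y. ennreal (indicator (- ball X (2 * \<rho>)) y / norm (y - X) ^ 3) \<partial>lborel)"
        by (intro nn_integral_cmult measurable_compose[OF indicator_over_norm_measurable measurable_ennreal]) auto
      also have "\<dots> \<le> ennreal (\<rho>\<^sup>2) * ennreal (8 * pi / (2 * \<rho>))"
        using \<rho> by (intro mult_left_mono nn_integral_inverse_norm_cube) auto
      also have "\<dots> = ennreal (\<rho>\<^sup>2 * (8 * pi / (2 * \<rho>)))"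
        using \<rho> by (intro ennreal_mult[symmetric]) auto
      finally show "(\<integral>\<^sup>+y. ennreal (\<rho>\<^sup>2) * ennreal (indicator (- ball X (2 * \<rho>)) y / norm (y - X) ^ 3) \<partial>lborel)
         \<le> ennreal (\<rho>\<^sup>2 * (8 * pi / (2 * \<rho>)))" .
    qed (use \<rho> in auto)
    finally show ?thesis .
  qed
  \<comment> \<open>The kernels and the remainder give \<open>12 + 8 + 4\<close> times
    \<open>pi * \<rho>\<close>; the linear term gives the cubic part.\<close>
  also have "\<dots> = ennreal ((24 * pi * R + 4 * pi * R ^ 3) / b)"
  proof -
    have "4 * pi * (3 * \<rho>) + 4 * pi * (2 * \<rho>) + R * b * (pi * (2 * \<rho>)\<^sup>2) + \<rho>\<^sup>2 * (8 * pi / (2 * \<rho>))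
      = (24 * pi * R + 4 * pi * R ^ 3) / b"
      unfolding \<rho>_def using b R by (simp add: field_simps power2_eq_square power3_eq_cube)
    then show ?thesis using b R \<rho> by (simp flip: ennreal_plus)
  qed
  finally have E: "(\<integral>\<^sup>+y. ennreal (E y) \<partial>lborel) \<le> ennreal ((24 * pi * R + 4 * pi * R ^ 3) / b)" .
  have fc: "integrable lborel (\<lambda>y. complex_of_real (w y) * (b\<^sup>2 * far_strain (b *\<^sub>R (y - X))))"
    using norm_far_strain_le
    by (intro integrable_times_bounded(1)[where B="b\<^sup>2"] far_strain_borel)
     (simp add: norm_mult norm_power mult_left_le)
  have eq: "vel w (X + h) - vel w X - far_coeff b X * cnj h = (LINT y|lborel. w y * D y)"
    and int: "integrable lborel (\<lambda>y. complex_of_real (w y) * D y)"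
    unfolding vel_def far_coeff_def D_def right_diff_distrib mult.assoc[symmetric]
    using integrable_times_bs fc[unfolded mult.assoc[symmetric]] by simp_all
  have "ennreal (norm (LINT y|lborel. w y * D y)) \<le> (\<integral>\<^sup>+y. ennreal (norm (w y * D y)) \<partial>lborel)"
    by (rule integral_norm_bound_ennreal[OF int])
  also have "\<dots> \<le> (\<integral>\<^sup>+y. ennreal (E y) \<partial>lborel)"
  proof (intro nn_integral_mono ennreal_leI)
    fix y
    have "norm (w y * D y) \<le> 1 * norm (D y)"
      unfolding norm_mult using abs_w[of y] by (intro mult_right_mono) auto
    then show "norm (w y * D y) \<le> E y" using DE[of y] by simp
  qed
  also note E
  finally show ?thesis unfolding eq using b R by simp
qed

end

section \<open>Wedges, linear maps and polar coordinates\<close>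

definition wedge :: "real \<Rightarrow> real \<Rightarrow> complex set" where
  "wedge \<theta> A = {complex_of_real r * cis t | r t. 0 < r \<and> \<theta> < t \<and> t < \<theta> + A}"

text \<open>If \<open>Im (cnj d1 * d2) = 1\<close>, this is the linear map taking \<open>d1\<close> to \<open>e1\<close> and \<open>d2\<close> to \<open>e2\<close>.\<close>

definition frame_map :: "complex \<Rightarrow> complex \<Rightarrow> complex \<Rightarrow> complex \<Rightarrow> complex \<Rightarrow> complex" where
  "frame_map d1 d2 e1 e2 z = Im (cnj z * d2) *\<^sub>R e1 + Im (cnj d1 * z) *\<^sub>R e2"

lemma frame_map_frame:
  assumes "Im (cnj d1 * d2) = 1"
  shows "frame_map d1 d2 e1 e2 (y1 *\<^sub>R d1 + y2 *\<^sub>R d2) = y1 *\<^sub>R e1 + y2 *\<^sub>R e2"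
proof -
  have "Im (cnj (y1 *\<^sub>R d1 + y2 *\<^sub>R d2) * d2) = y1 * Im (cnj d1 * d2)"
    "Im (cnj d1 * (y1 *\<^sub>R d1 + y2 *\<^sub>R d2)) = y2 * Im (cnj d1 * d2)"
    by (simp_all add: algebra_simps)
  then show ?thesis unfolding frame_map_def using assms by simp
qed

text \<open>Cramer's rule: for a frame of unit area the two imaginary parts are the coordinates of
  \<open>z\<close>.\<close>

lemma frame_map_id:
  assumes "Im (cnj d1 * d2) = 1"
  shows "frame_map d1 d2 d1 d2 z = z"
proof -
  have "Im (cnj z * d2) *\<^sub>R d1 + Im (cnj d1 * z) *\<^sub>R d2 = Im (cnj d1 * d2) *\<^sub>R z"
    by (simp add: complex_eq_iff algebra_simps)
  then show ?thesis using assms by (simp add: frame_map_def)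
qed

lemma frame_map_inverse:
  assumes "Im (cnj d1 * d2) = 1" "Im (cnj e1 * e2) = 1"
  shows "frame_map e1 e2 d1 d2 (frame_map d1 d2 e1 e2 z) = z"
  using frame_map_frame[OF assms(2), of d1 d2 "Im (cnj z * d2)" "Im (cnj d1 * z)"] frame_map_id[OF assms(1), of z]
  by (simp add: frame_map_def[of d1 d2])

lemma bounded_linear_frame_map: "bounded_linear (frame_map d1 d2 e1 e2)"
  unfolding frame_map_def
  by (intro bounded_linear_add bounded_linear_compose[OF bounded_linear_scaleR_left]
      bounded_linear_compose[OF bounded_linear_Im] bounded_linear_compose[OF bounded_linear_mult_left]
      bounded_linear_compose[OF bounded_linear_mult_right] bounded_linear_cnj bounded_linear_ident)

lemma norm_frame_map_le:
  assumes "norm d1 \<le> K" "norm d2 \<le> K" "norm e1 \<le> K" "norm e2 \<le> K"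
  shows "norm (frame_map d1 d2 e1 e2 z) \<le> 2 * K\<^sup>2 * norm z"
proof -
  have K: "0 \<le> K" using assms(1) norm_ge_zero order_trans by blast
  have "\<bar>Im (cnj z * d2)\<bar> \<le> norm z * K" "\<bar>Im (cnj d1 * z)\<bar> \<le> norm z * K"
    using abs_Im_le_cmod[of "cnj z * d2"] abs_Im_le_cmod[of "cnj d1 * z"] mult_left_mono[OF assms(2), of "norm z"]
      mult_left_mono[OF assms(1), of "norm z"]
    by (auto simp: norm_mult mult.commute)
  then have "norm (frame_map d1 d2 e1 e2 z) \<le> (norm z * K) * K + (norm z * K) * K"
    unfolding frame_map_def using assms K
    by (intro norm_triangle_le add_mono) (auto intro!: mult_mono)
  then show ?thesis by (simp add: power2_eq_square mult_ac)
qed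

lemma frame_map_det:
  assumes "Im (cnj d1 * d2) = 1" "Im (cnj e1 * e2) = 1"
  shows "Im (cnj (frame_map d1 d2 e1 e2 1) * frame_map d1 d2 e1 e2 \<i>) = 1"
proof -
  have *: "Im (cnj (a *\<^sub>R e1 + b *\<^sub>R e2) * (c *\<^sub>R e1 + d *\<^sub>R e2)) = (a * d - b * c) * Im (cnj e1 * e2)" for a b c d
    by (simp add: algebra_simps)
  show ?thesis unfolding frame_map_def * using assms by (simp add: algebra_simps)
qed

lemma frame_map_polar:
  "frame_map d1 d2 e1 e2 (r * cis t) = (r * cos t) *\<^sub>R frame_map d1 d2 e1 e2 1 + (r * sin t) *\<^sub>R frame_map d1 d2 e1 e2 \<i>"
proof -
  interpret bounded_linear "frame_map d1 d2 e1 e2" by (rule bounded_linear_frame_map)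
  have "r * cis t = (r * cos t) *\<^sub>R 1 + (r * sin t) *\<^sub>R \<i>"
    by (simp add: complex_eq_iff)
  then show ?thesis by (simp only: add scaleR)
qed

text \<open>An opening below pi makes the wedge an intersection of two half planes, a description
  that linear maps can transport. The work lies in recovering the range of the angle from the signs
  of two sines.\<close>

lemma wedge_eq:
  fixes r1 r2 :: real
  assumes "d1 = r1 * cis \<theta>" "d2 = r2 * cis (\<theta> + A)" "0 < r1" "0 < r2" "0 < A" "A < pi"
  shows "wedge \<theta> A = {z. 0 < Im (cnj z * d2) \<and> 0 < Im (cnj d1 * z)}"
proof -
  have i: "Im (cnj (r * cis t) * d2) = r * r2 * sin (\<theta> + A - t)" "Im (cnj d1 * (r * cis t)) = r * r1 * sin (t - \<theta>)" for r t :: real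
    using assms(1,2) by (simp_all add: sin_diff sin_add algebra_simps)
  show ?thesis
  proof (intro set_eqI iffI)
    fix z assume "z \<in> wedge \<theta> A"
    then obtain r t :: real where z: "z = r * cis t" "0 < r" "\<theta> < t" "t < \<theta> + A" by (auto simp: wedge_def)
    show "z \<in> {z. 0 < Im (cnj z * d2) \<and> 0 < Im (cnj d1 * z)}"
      unfolding z(1) mem_Collect_eq i using z assms by (auto intro!: mult_pos_pos sin_gt_zero)
  next
    fix z assume "z \<in> {z. 0 < Im (cnj z * d2) \<and> 0 < Im (cnj d1 * z)}"
    then have z: "0 < Im (cnj z * d2)" "0 < Im (cnj d1 * z)" by auto
    define t where "t = \<theta> + Arg (z * cis (- \<theta>))"
    have z0: "z \<noteq> 0" using z by auto
    have "z * cis (- \<theta>) = norm z * cis (Arg (z * cis (- \<theta>)))"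
      using cis_Arg[of "z * cis (- \<theta>)"] z0 by (simp add: sgn_eq norm_mult field_simps)
    then have "z * cis (- \<theta>) * cis \<theta> = norm z * cis (Arg (z * cis (- \<theta>))) * cis \<theta>" by simp
    then have zt: "z = norm z * cis t" by (simp add: t_def cis_mult mult.assoc add.commute)
    have t: "- pi < t - \<theta>" "t - \<theta> \<le> pi" using Arg_bounded[of "z * cis (- \<theta>)"] by (auto simp: t_def)
    have s: "0 < sin (\<theta> + A - t)" "0 < sin (t - \<theta>)"
    proof -
      have a: "0 < (norm z * r2) * sin (\<theta> + A - t)" "0 < (norm z * r1) * sin (t - \<theta>)"
        using z unfolding i[of "norm z" t, folded zt] .
      have p: "0 < norm z * r2" "0 < norm z * r1" using z0 assms(3,4) by simp_all
      show "0 < sin (\<theta> + A - t)" by (rule zero_less_mult_pos[OF a(1) p(1)])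
      show "0 < sin (t - \<theta>)" by (rule zero_less_mult_pos[OF a(2) p(2)])
    qed
    have "0 < t - \<theta>"
    proof (rule ccontr)
      assume "\<not> 0 < t - \<theta>"
      then have "0 \<le> sin (- (t - \<theta>))" using t by (intro sin_ge_zero) auto
      then show False using s(2) sin_minus[of "t - \<theta>"] by linarith
    qed
    moreover have "t - \<theta> < A"
    proof (rule ccontr)
      assume "\<not> t - \<theta> < A"
      then have "0 \<le> sin (t - \<theta> - A)" using t assms by (intro sin_ge_zero) auto
      moreover have "sin (t - \<theta> - A) = - sin (\<theta> + A - t)" by (simp add: algebra_simps flip: sin_minus)
      ultimately show False using s by simp
    qed
    ultimately show "z \<in> wedge \<theta> A" unfolding wedge_def using zt z0
      by (intro CollectI exI[of _ "norm z"] exI[of _ t]) auto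
  qed
qed

text \<open>The inequalities in \<open>wedge_eq\<close> say that both coordinates with respect to
  the frame are positive, and \<open>frame_map\<close> keeps the coordinates while exchanging the
  frame.\<close>

lemma frame_map_wedge:
  fixes R1 R2 r1 r2 :: real
  assumes d: "d1 = R1 * cis \<beta>" "d2 = R2 * cis (\<beta> + \<alpha>)" "0 < R1" "0 < R2" "0 < \<alpha>" "\<alpha> < pi" "Im (cnj d1 * d2) = 1"
    and e: "e1 = r1 * cis \<theta>" "e2 = r2 * cis (\<theta> + A)" "0 < r1" "0 < r2" "0 < A" "A < pi" "Im (cnj e1 * e2) = 1"
    and "z \<in> wedge \<theta> A"
  shows "frame_map e1 e2 d1 d2 z \<in> wedge \<beta> \<alpha>"
proof -
  have z: "0 < Im (cnj z * e2)" "0 < Im (cnj e1 * z)"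
    using assms(15) unfolding wedge_eq[OF e(1-6)] by auto
  have *: "Im (cnj (a *\<^sub>R d1 + b *\<^sub>R d2) * d2) = a * Im (cnj d1 * d2)"
     "Im (cnj d1 * (a *\<^sub>R d1 + b *\<^sub>R d2)) = b * Im (cnj d1 * d2)" for a b
    by (simp_all add: algebra_simps)
  show ?thesis unfolding wedge_eq[OF d(1-6)] frame_map_def mem_Collect_eq * using z d(7) by simp
qed

lemma open_wedge:
  assumes "0 < A" "A < pi" shows "open (wedge \<theta> A)"
  unfolding wedge_eq[of "1 * cis \<theta>" 1 \<theta> "1 * cis (\<theta> + A)" 1 A, simplified, OF assms]
  by (intro open_Collect_conj open_Collect_less continuous_intros)

text \<open>For use on a strip of angles narrower than a full turn, where it makes polar coordinates
  injective.\<close>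

lemma cis_inj:
  fixes r r' :: real
  assumes "r * cis t = r' * cis t'" "0 < r" "0 < r'" "\<bar>t - t'\<bar> < 2 * pi"
  shows "r = r' \<and> t = t'"
proof -
  have "norm (complex_of_real r * cis t) = norm (complex_of_real r' * cis t')" using assms(1) by simp
  then have r: "r = r'" using assms(2,3) by (simp add: norm_mult)
  then have "cis t = cis t'" using assms by auto
  then have "cis (t - t') = 1" by (simp flip: cis_divide)
  then have "cos (t - t') = 1" by (auto simp: complex_eq_iff)
  then obtain n :: int where "t - t' = of_int n * (2 * pi)"
    unfolding cos_one_2pi_int by (auto simp: mult.assoc)
  moreover then have "\<bar>of_int n\<bar> * (2 * pi) < 1 * (2 * pi)" using assms(4) by (simp add: abs_mult)
  then have "\<bar>of_int n :: real\<bar> < 1" by (simp only: mult_less_cancel_right) auto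
  then have "n = 0" by linarith
  ultimately show ?thesis using r by simp
qed

section \<open>Integrals over sectors in polar coordinates\<close>

definition polar_integral :: "real \<Rightarrow> real \<Rightarrow> real \<Rightarrow> (complex \<Rightarrow> real) \<Rightarrow> real" where
  "polar_integral R \<theta> A f = integral {0..R} (\<lambda>r. integral {\<theta>..\<theta> + A} (\<lambda>t. r * f (r * cis t)))"

text \<open>Because \<open>f\<close> vanishes beyond radius \<open>R\<close>, the infinite strip
  \<open>S\<close> can be cut to a rectangle, where continuity allows iterated integration. The
  result is stated over \<open>real^2\<close>, the domain of the change of variables that
  follows.\<close>

lemma polar_rectangle:
  fixes \<theta> A R :: real
  assumes f: "continuous_on UNIV f" and f0: "\<And>z. R \<le> norm z \<Longrightarrow> f z = 0" and "0 \<le> R" "0 \<le> A"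
  defines "D \<equiv> \<lambda>p::real^2. p $ 1 * f (complex_of_real (p $ 1) * cis (p $ 2))" and "S \<equiv> {p::real^2. 0 < p $ 1 \<and> \<theta> < p $ 2 \<and> p $ 2 < \<theta> + A}"
  shows "D absolutely_integrable_on S" "integral S D = polar_integral R \<theta> A f"
proof -
  define G where "G = (\<lambda>z::complex. indicator {z. 0 < Re z \<and> \<theta> < Im z \<and> Im z < \<theta> + A} z * (Re z * f (Re z * cis (Im z))))"
  define H where "H = (\<lambda>p::real\<times>real. fst p * f (complex_of_real (fst p) * cis (snd p)))"
  have cf: "continuous_on UNIV (\<lambda>z. Re z * f (Re z * cis (Im z)))"
    unfolding cis_conv_exp by (intro continuous_intros continuous_on_compose2[OF f]) auto
  have "{z. 0 < Re z \<and> \<theta> < Im z \<and> Im z < \<theta> + A} \<in> sets borel"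
    by (intro borel_open open_Collect_conj open_Collect_less continuous_intros)
  then have Gm [measurable]: "G \<in> borel_measurable borel"
    unfolding G_def by (intro borel_measurable_times borel_measurable_indicator borel_measurable_continuous_onI[OF cf])
  have cH: "continuous_on A H" for A
    unfolding H_def cis_conv_exp by (intro continuous_intros continuous_on_compose2[OF f]) auto
  have GH: "G (Complex (fst p) (snd p)) = indicator (box (0,\<theta>) (R,\<theta>+A)) p *\<^sub>R H p" for p
    using f0[of "complex_of_real (fst p) * cis (snd p)"] assms(3)
    by (cases p) (auto simp: G_def H_def indicator_def norm_mult mem_box Basis_prod_def)
  have i0: "set_integrable lborel (cbox (0,\<theta>) (R,\<theta>+A)) H"
    unfolding set_integrable_def by (rule borel_integrable_compact[OF compact_cbox cH])
  then have i1: "set_integrable lborel (box (0,\<theta>) (R,\<theta>+A)) H"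
    by (rule set_integrable_subset) (auto simp: box_subset_cbox)
  have Cm: "(\<lambda>p. Complex (fst p) (snd p)) \<in> lborel \<rightarrow>\<^sub>M borel"
    unfolding Complex_eq by (simp, intro borel_measurable_continuous_onI continuous_intros)
  have iG: "integrable lborel G"
    using i1 unfolding distr_Complex[symmetric] set_integrable_def
    by (subst integrable_distr_eq[OF Cm]) (auto simp: GH)
  have LG: "integral\<^sup>L lborel G = polar_integral R \<theta> A f"
  proof -
    have "integral\<^sup>L lborel G = (LINT p|lborel. indicator (box (0,\<theta>) (R,\<theta>+A)) p *\<^sub>R H p)"
      unfolding distr_Complex[symmetric] by (subst integral_distr[OF Cm]) (auto simp: GH)
    also have "\<dots> = integral (cbox (0,\<theta>) (R,\<theta>+A)) H"
      using set_borel_integral_eq_integral(2)[OF i1] integral_open_interval[of "(0,\<theta>)" "(R,\<theta>+A)" H]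
      by (simp add: set_lebesgue_integral_def)
    also have "\<dots> = polar_integral R \<theta> A f"
      unfolding polar_integral_def integral_prod_continuous[OF cH] by (simp add: H_def)
    finally show ?thesis .
  qed
  have Dm: "(\<lambda>p. G (cx p)) \<in> borel_measurable borel" by measurable
  have GD: "G (cx p) = indicator S p *\<^sub>R D p" for p
    by (auto simp: G_def D_def S_def indicator_def)
  have "integrable lborel (\<lambda>p. G (cx p))"
    using iG unfolding distr_cx[symmetric] by (subst (asm) integrable_distr_eq) auto
  then have 1: "set_integrable lborel S D"
    unfolding GD set_integrable_def .
  then show "D absolutely_integrable_on S"
    using Dm unfolding set_integrable_def GD by (subst integrable_completion) auto
  have "integral\<^sup>L lborel G = (LINT p:S|lborel. D p)"
    unfolding distr_cx[symmetric] set_lebesgue_integral_def by (subst integral_distr) (auto simp: GD)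
  then show "integral S D = polar_integral R \<theta> A f"
    using set_borel_integral_eq_integral(2)[OF 1] LG by simp
qed

text \<open>The substitution composes polar coordinates with scaling by \<open>1 / b\<close> and the
  linear map taking 1 and the imaginary unit to \<open>u\<close> and \<open>v\<close>. Its Jacobian
  is \<open>r / b^2\<close>, since \<open>u\<close>, \<open>v\<close> span unit area; the factor
  \<open>r\<close> is already part of \<open>polar_integral\<close>.\<close>

lemma polar_change_of_variables:
  fixes \<theta> A R b :: real and u v :: complex
  assumes f: "continuous_on UNIV f" and f0: "\<And>z. R \<le> norm z \<Longrightarrow> f z = 0" and R: "0 \<le> R" and A: "0 < A" "A < pi"
    and b: "0 < b" and det: "Im (cnj u * v) = 1"
    and inv: "\<And>r t. h ((r * cos t / b) *\<^sub>R u + (r * sin t / b) *\<^sub>R v) = of_real r * cis t"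
    and img: "(\<lambda>p::real^2. ((p $ 1 * cos (p $ 2)) / b) *\<^sub>R u + ((p $ 1 * sin (p $ 2)) / b) *\<^sub>R v) ` {p. 0 < p $ 1 \<and> \<theta> < p $ 2 \<and> p $ 2 < \<theta> + A} = W"
  shows "(\<lambda>x. f (h (cx x))) absolutely_integrable_on (vc ` W)"
    and "integral (vc ` W) (\<lambda>x. f (h (cx x))) = polar_integral R \<theta> A f / b\<^sup>2"
proof -
  define S where "S = {p::real^2. 0 < p $ 1 \<and> \<theta> < p $ 2 \<and> p $ 2 < \<theta> + A}"
  define gc where "gc p = ((p $ 1 * cos (p $ 2)) / b) *\<^sub>R u + ((p $ 1 * sin (p $ 2)) / b) *\<^sub>R v" for p :: "real^2"
  define g where "g p = vc (gc p)" for p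
  define g' where "g' p k = vc (((k $ 1 * cos (p $ 2) - p $ 1 * sin (p $ 2) * k $ 2) / b) *\<^sub>R u
     + ((k $ 1 * sin (p $ 2) + p $ 1 * cos (p $ 2) * k $ 2) / b) *\<^sub>R v)" for p k :: "real^2"
  \<comment> \<open>The integrand is viewed with values in \<open>real^1\<close>, the codomain in
    which the change of variables is carried out.\<close>
  define F where "F x = (vec (f (h (cx x))) :: real^1)" for x
  have n: "((\<lambda>p::real^2. p $ i) has_derivative (\<lambda>k. k $ i)) (at p within S)" for i p
    by (rule bounded_linear_imp_has_derivative[OF bounded_linear_vec_nth])
  have dg: "(g has_derivative g' p) (at p within S)" for p
    unfolding g_def gc_def g'_def
    by (rule bounded_linear.has_derivative[OF bounded_linear_vc])
       (rule derivative_eq_intros n refl | use b in \<open>simp add: fun_eq_iff algebra_simps add_divide_distrib diff_divide_distrib\<close>)+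
  have "open S" unfolding S_def
    by (intro open_Collect_conj open_Collect_less continuous_intros)
  then have Sl: "S \<in> sets lebesgue" by auto
  have hg: "h (cx (g p)) = of_real (p $ 1) * cis (p $ 2)" for p
    unfolding g_def gc_def using inv by simp
  have inj: "inj_on g S"
  proof (rule inj_onI)
    fix p q assume pq: "p \<in> S" "q \<in> S" "g p = g q"
    then have "complex_of_real (p $ 1) * cis (p $ 2) = of_real (q $ 1) * cis (q $ 2)"
      using hg by metis
    then have "p $ 1 = q $ 1 \<and> p $ 2 = q $ 2"
      using pq A by (intro cis_inj) (auto simp: S_def)
    then show "p = q" by (simp add: vec_eq_iff forall_2)
  qed
  have detg: "det (matrix (g' p)) = p $ 1 / b\<^sup>2" for p
  proof -
    have "(cos (p $ 2))\<^sup>2 + (sin (p $ 2))\<^sup>2 = 1" by simp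
    moreover have "det (matrix (g' p)) = p $ 1 / b\<^sup>2 * ((cos (p $ 2))\<^sup>2 + (sin (p $ 2))\<^sup>2) * Im (cnj u * v)"
    proof -
      obtain C S where CS: "cos (p $ 2) = C" "sin (p $ 2) = S" by blast
      show ?thesis
        using b unfolding det_2 matrix_def g'_def CS
        by (simp add: axis_def power2_eq_square field_simps)
    qed
    ultimately show ?thesis using det by simp
  qed
  have D: "\<bar>det (matrix (g' p))\<bar> *\<^sub>R F (g p) = vec ((1 / b\<^sup>2) * (p $ 1 * f (of_real (p $ 1) * cis (p $ 2))))"
    if "p \<in> S" for p
    using that by (simp add: detg F_def hg vec_eq_iff S_def)
  note PR = polar_rectangle[OF f f0 R less_imp_le[OF A(1)], of \<theta>, folded S_def]
  have "(\<lambda>p. \<bar>det (matrix (g' p))\<bar> *\<^sub>R F (g p)) absolutely_integrable_on S"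
    using set_integrable_mult_right[of "1 / b\<^sup>2", OF PR(1)]
    by (subst set_integrable_cong[OF refl refl D]) (simp_all add: absolutely_integrable_on_1_iff)
  moreover have "integral S (\<lambda>p. \<bar>det (matrix (g' p))\<bar> *\<^sub>R F (g p)) = vec (polar_integral R \<theta> A f / b\<^sup>2)"
    using PR(2) by (subst integral_cong[OF D]) (simp_all add: integral_on_1_eq)
  ultimately have "F absolutely_integrable_on g ` S \<and> integral (g ` S) F = vec (polar_integral R \<theta> A f / b\<^sup>2)"
    using has_absolute_integral_change_of_variables[OF Sl dg inj, of F] by blast
  moreover have "g ` S = vc ` W"
    unfolding img[symmetric] S_def[symmetric] g_def gc_def by (simp add: image_image)
  ultimately show "(\<lambda>x. f (h (cx x))) absolutely_integrable_on (vc ` W)"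
    and "integral (vc ` W) (\<lambda>x. f (h (cx x))) = polar_integral R \<theta> A f / b\<^sup>2"
    by (auto simp: F_def absolutely_integrable_on_1_iff integral_on_1_eq vec_eq_iff)
qed

text \<open>The frame map preserves area and carries the wedge at \<beta> with opening \<alpha> onto
  the wedge at \<theta> with opening \<open>A\<close>. Integrating a pulled-back test function over
  the initial sector therefore amounts to integrating it over the deformed sector.\<close>

lemma wedge_integral:
  fixes \<theta> A R b \<beta> \<alpha> R1 R2 r1 r2 :: real
  assumes f: "continuous_on UNIV f" and f0: "\<And>z. R \<le> norm z \<Longrightarrow> f z = 0" and R: "0 \<le> R" and b: "0 < b"
    and d: "d1 = R1 * cis \<beta>" "d2 = R2 * cis (\<beta> + \<alpha>)" "0 < R1" "0 < R2" "0 < \<alpha>" "\<alpha> < pi" "Im (cnj d1 * d2) = 1"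
    and e: "e1 = r1 * cis \<theta>" "e2 = r2 * cis (\<theta> + A)" "0 < r1" "0 < r2" "0 < A" "A < pi" "Im (cnj e1 * e2) = 1"
  shows "set_integrable lborel (wedge \<beta> \<alpha>) (\<lambda>z. f (b *\<^sub>R frame_map d1 d2 e1 e2 z))"
    and "(LINT z:wedge \<beta> \<alpha>|lborel. f (b *\<^sub>R frame_map d1 d2 e1 e2 z)) = polar_integral R \<theta> A f / b\<^sup>2"
proof -
  define h where "h z = b *\<^sub>R frame_map d1 d2 e1 e2 z" for z
  \<comment> \<open>The substitution runs backwards: \<open>u\<close> and \<open>v\<close> are the
    images of 1 and the imaginary unit under the inverse frame map.\<close>
  define u v where "u = frame_map e1 e2 d1 d2 1" and "v = frame_map e1 e2 d1 d2 \<i>"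
  interpret T: bounded_linear "frame_map d1 d2 e1 e2" by (rule bounded_linear_frame_map)
  interpret T': bounded_linear "frame_map e1 e2 d1 d2" by (rule bounded_linear_frame_map)
  have uv: "(r * cos t / b) *\<^sub>R u + (r * sin t / b) *\<^sub>R v = (1 / b) *\<^sub>R frame_map e1 e2 d1 d2 (r * cis t)" for r t
    unfolding frame_map_polar u_def v_def by (simp add: scaleR_add_right)
  have inv: "h ((r * cos t / b) *\<^sub>R u + (r * sin t / b) *\<^sub>R v) = of_real r * cis t" for r t
    unfolding uv h_def T.scaleR using b frame_map_inverse[OF e(7) d(7)] by simp
  have img: "(\<lambda>p::real^2. ((p $ 1 * cos (p $ 2)) / b) *\<^sub>R u + ((p $ 1 * sin (p $ 2)) / b) *\<^sub>R v) ` {p. 0 < p $ 1 \<and> \<theta> < p $ 2 \<and> p $ 2 < \<theta> + A} = wedge \<beta> \<alpha>"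
    (is "?g ` ?S = _")
  proof (intro set_eqI iffI)
    fix z assume "z \<in> ?g ` ?S"
    then obtain p where p: "p \<in> ?S" "z = (1 / b) *\<^sub>R frame_map e1 e2 d1 d2 (p $ 1 * cis (p $ 2))"
      unfolding uv by auto
    then have "(p $ 1 / b) * cis (p $ 2) \<in> wedge \<theta> A" using b unfolding wedge_def
      by (intro CollectI exI[of _ "p $ 1 / b"] exI[of _ "p $ 2"]) auto
    moreover have "z = frame_map e1 e2 d1 d2 ((p $ 1 / b) * cis (p $ 2))"
      unfolding p(2) T'.scaleR[symmetric] by (simp add: scaleR_conv_of_real)
    ultimately show "z \<in> wedge \<beta> \<alpha>" using frame_map_wedge[OF d e] by simp
  next
    fix z assume "z \<in> wedge \<beta> \<alpha>"
    then have "frame_map d1 d2 e1 e2 z \<in> wedge \<theta> A" by (rule frame_map_wedge[OF e d])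
    then obtain r t :: real where rt: "frame_map d1 d2 e1 e2 z = r * cis t" "0 < r" "\<theta> < t" "t < \<theta> + A"
      by (auto simp: wedge_def)
    have "z = frame_map e1 e2 d1 d2 (r * cis t)" using frame_map_inverse[OF d(7) e(7), of z] rt(1) by simp
    also have "\<dots> = (1 / b) *\<^sub>R frame_map e1 e2 d1 d2 ((b * r) * cis t)"
      unfolding T'.scaleR[symmetric] using b by (simp add: scaleR_conv_of_real)
    also have "\<dots> = ?g (vector [b * r, t])" unfolding uv by simp
    finally show "z \<in> ?g ` ?S" using rt b by (intro image_eqI[of _ _ "vector [b * r, t]"]) auto
  qed
  have det: "Im (cnj u * v) = 1" unfolding u_def v_def by (rule frame_map_det[OF e(7) d(7)])
  have P: "(\<lambda>x. f (h (cx x))) absolutely_integrable_on (vc ` wedge \<beta> \<alpha>)"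
    "integral (vc ` wedge \<beta> \<alpha>) (\<lambda>x. f (h (cx x))) = polar_integral R \<theta> A f / b\<^sup>2"
    by (rule polar_change_of_variables[of f R A b u v h]; (fact f R e(5,6) b det inv img | erule f0))+
  have W: "wedge \<beta> \<alpha> \<in> sets borel" using open_wedge[OF d(5,6)] by simp
  have ch: "continuous_on UNIV (\<lambda>z. f (h z))"
    unfolding h_def
    by (rule continuous_on_compose2[OF f _ subset_UNIV])
       (intro continuous_on_scaleR continuous_on_const linear_continuous_on bounded_linear_frame_map)
  have ind: "indicator (vc ` wedge \<beta> \<alpha>) x = (indicator (wedge \<beta> \<alpha>) (cx x) :: real)" for x
  proof -
    have "x \<in> vc ` wedge \<beta> \<alpha> \<longleftrightarrow> cx x \<in> wedge \<beta> \<alpha>"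
      using imageI[of "cx x" "wedge \<beta> \<alpha>" vc] by auto
    then show ?thesis by (simp add: indicator_def)
  qed
  have m: "(\<lambda>z. indicator (wedge \<beta> \<alpha>) z *\<^sub>R f (h z)) \<in> borel_measurable borel"
    by (rule borel_measurable_scaleR[OF borel_measurable_indicator[OF W] borel_measurable_continuous_onI[OF ch]])
  have m': "(\<lambda>x. indicator (wedge \<beta> \<alpha>) (cx x) *\<^sub>R f (h (cx x))) \<in> borel_measurable lborel"
    using measurable_compose[OF cx_borel m] by simp
  have "integrable lebesgue (\<lambda>x. indicator (wedge \<beta> \<alpha>) (cx x) *\<^sub>R f (h (cx x)))"
    using P(1) unfolding set_integrable_def ind .
  then have i: "integrable lborel (\<lambda>x. indicator (wedge \<beta> \<alpha>) (cx x) *\<^sub>R f (h (cx x)))"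
    using integrable_completion[OF m'] by simp
  then show "set_integrable lborel (wedge \<beta> \<alpha>) (\<lambda>z. f (b *\<^sub>R frame_map d1 d2 e1 e2 z))"
    unfolding set_integrable_def h_def[symmetric] distr_cx[symmetric]
    using m by (subst integrable_distr_eq) auto
  have "(LINT z:wedge \<beta> \<alpha>|lborel. f (h z)) = (LINT x|lborel. indicator (wedge \<beta> \<alpha>) (cx x) *\<^sub>R f (h (cx x)))"
  proof -
    have "cx \<in> lborel \<rightarrow>\<^sub>M borel" by simp
    from integral_distr[OF this m] show ?thesis
      unfolding distr_cx set_lebesgue_integral_def .
  qed
  also have "\<dots> = (LINT x:vc ` wedge \<beta> \<alpha>|lborel. f (h (cx x)))"
    unfolding set_lebesgue_integral_def ind by (rule refl)
  also have "\<dots> = integral (vc ` wedge \<beta> \<alpha>) (\<lambda>x. f (h (cx x)))"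
    by (rule set_borel_integral_eq_integral(2)) (unfold set_integrable_def ind, rule i)
  also note P(2)
  finally show "(LINT z:wedge \<beta> \<alpha>|lborel. f (b *\<^sub>R frame_map d1 d2 e1 e2 z)) = polar_integral R \<theta> A f / b\<^sup>2"
    unfolding h_def .
qed

lemma abs_polar_integral_le:
  fixes R \<theta> A :: real
  assumes f: "continuous_on UNIV f" and b: "\<And>z. \<bar>f z\<bar> \<le> 1" and R: "0 \<le> R" and A: "0 \<le> A"
  shows "\<bar>polar_integral R \<theta> A f\<bar> \<le> A * R\<^sup>2"
proof -
  have c: "continuous_on (UNIV \<times> UNIV) (\<lambda>(r,t). r * f (complex_of_real r * cis t))"
    unfolding split_beta cis_conv_exp
    by (intro continuous_on_mult continuous_on_fst continuous_on_id continuous_on_compose2[OF f _ subset_UNIV] continuous_intros)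
  have c1: "continuous_on S (\<lambda>t. r * f (complex_of_real r * cis t))" for r S
    unfolding cis_conv_exp
    by (intro continuous_on_mult continuous_on_const continuous_on_compose2[OF f _ subset_UNIV] continuous_intros)
  have i: "\<bar>integral {\<theta>..\<theta> + A} (\<lambda>t. r * f (complex_of_real r * cis t))\<bar> \<le> R * A" if "r \<in> {0..R}" for r
  proof -
    have "\<bar>r * f (complex_of_real r * cis t)\<bar> \<le> R" for t
      using that b[of "complex_of_real r * cis t"] mult_mono[of r R "\<bar>f (complex_of_real r * cis t)\<bar>" 1]
      by (simp add: abs_mult)
    then show ?thesis
      using integral_bound[of \<theta> "\<theta> + A" "\<lambda>t. r * f (complex_of_real r * cis t)" R] A c1 by simp
  qed
  have "continuous_on {0..R} (\<lambda>r. integral (cbox \<theta> (\<theta> + A)) (\<lambda>t. r * f (complex_of_real r * cis t)))"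
    by (rule integral_continuous_on_param[OF continuous_on_subset[OF c]]) auto
  then have "norm (polar_integral R \<theta> A f) \<le> R * A * (R - 0)"
    unfolding polar_integral_def using i R by (intro integral_bound) auto
  then show ?thesis by (simp add: power2_eq_square mult_ac)
qed

section \<open>The contribution of one dyadic shell of a sector\<close>

text \<open>Radial part of \<open>shell_strain\<close> including the polar Jacobian. For
  \<open>r > 0\<close> it equals \<open>(ramp (4 * r^2) - ramp (r^2)) / r\<close>, which is
  nonnegative because \<open>ramp\<close> is monotone. Its integral is of Frullani type with value
  \<open>ln 2\<close>, the logarithmic width of a dyadic shell.\<close>

definition shell_profile :: "real \<Rightarrow> real" where
  "shell_profile r = r ^ 3 * (16 * ramp_over_square (4 * r\<^sup>2) - ramp_over_square (r\<^sup>2))"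

definition shell_mass :: real where
  "shell_mass = integral {0..2} shell_profile"

lemma shell_mass_pos: "0 < shell_mass"
proof -
  have c: "continuous_on {0..2} shell_profile"
    unfolding shell_profile_def
    by (intro continuous_intros continuous_on_compose2[OF C1_continuous[OF C1_ramp_over_square, of UNIV] _ subset_UNIV])
  have nn: "0 \<le> shell_profile r" if "0 \<le> r" for r
  proof (cases "r = 0")
    case False
    then have "shell_profile r = (ramp (4 * r\<^sup>2) - ramp (r\<^sup>2)) / r"
      using that by (simp add: shell_profile_def ramp_over_square_eq field_simps power2_eq_square power3_eq_cube)
    then show ?thesis using that ramp_mono[of "r\<^sup>2" "4 * r\<^sup>2"] by simp
  qed (simp add: shell_profile_def)
  have "shell_profile 1 = 1"
    by (simp add: shell_profile_def ramp_over_square_eq ramp_0 ramp_1)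
  then have "integral {0..2} shell_profile \<noteq> 0"
    using integral_eq_0_iff[OF c, of] nn by force
  moreover have "0 \<le> integral {0..2} shell_profile"
    using nn c by (intro Henstock_Kurzweil_Integration.integral_nonneg integrable_continuous_real) auto
  ultimately show ?thesis by (simp add: shell_mass_def)
qed

lemma shell_strain_polar:
  "shell_strain (complex_of_real r * cis t) * r = shell_profile r * (- \<i> / (2 * pi) * cis (2 * t))"
proof -
  have f: "far_strain (complex_of_real s * cis t) = s\<^sup>2 * ramp_over_square (s\<^sup>2) * (- \<i> / (2 * pi) * cis (2 * t))" for s
    unfolding far_strain_def by (simp add: norm_mult power_mult_distrib cis_mult power2_eq_square[of "cis t"])
  have "2 * (complex_of_real r * cis t) = complex_of_real (2 * r) * cis t" by simp
  then have s: "shell_strain (complex_of_real r * cis t) =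
    (4 * ((2 * r)\<^sup>2 * ramp_over_square ((2 * r)\<^sup>2)) - r\<^sup>2 * ramp_over_square (r\<^sup>2)) * (- \<i> / (2 * pi) * cis (2 * t))"
    unfolding shell_strain_def f by (simp only: f) (simp add: algebra_simps)
  show ?thesis unfolding s shell_profile_def
    by (simp add: power_mult_distrib power2_eq_square power3_eq_cube algebra_simps)
qed

text \<open>Radius and angle separate by \<open>shell_strain_polar\<close>, and the angular factor
  integrates explicitly. The result is \<open>shell_mass\<close> times the coefficient
  \<open>a\<close> of the model, split into real and imaginary part because test functions are real
  valued.\<close>

lemma polar_integral_shell_strain:
  assumes A: "0 \<le> A"
  shows "polar_integral 2 \<theta> A (\<lambda>z. Re (shell_strain z)) = shell_mass * Re ((cis (2 * \<theta>) - cis (2 * (\<theta> + A))) / (4 * pi))"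
    and "polar_integral 2 \<theta> A (\<lambda>z. Im (shell_strain z)) = shell_mass * Im ((cis (2 * \<theta>) - cis (2 * (\<theta> + A))) / (4 * pi))"
proof -
  have re: "r * Re (shell_strain (complex_of_real r * cis t)) = shell_profile r * (sin (2 * t) / (2 * pi))"
    and im: "r * Im (shell_strain (complex_of_real r * cis t)) = shell_profile r * (- cos (2 * t) / (2 * pi))" for r t
    using arg_cong[OF shell_strain_polar[of r t], of Re] arg_cong[OF shell_strain_polar[of r t], of Im]
    by (auto simp: mult.commute)
  have "((\<lambda>t. sin (2 * t) / (2 * pi)) has_integral (- cos (2 * (\<theta> + A)) / (4 * pi) - (- cos (2 * \<theta>) / (4 * pi)))) {\<theta>..\<theta> + A}"
    by (rule fundamental_theorem_of_calculus)
       (use A in \<open>auto intro!: derivative_eq_intros simp: has_real_derivative_iff_has_vector_derivative[symmetric]\<close>)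
  from integral_unique[OF this]
  have i1: "integral {\<theta>..\<theta> + A} (\<lambda>t. sin (2 * t) / (2 * pi)) = Re ((cis (2 * \<theta>) - cis (2 * (\<theta> + A))) / (4 * pi))"
    by (simp only:) (simp add: diff_divide_distrib)
  have "((\<lambda>t. - cos (2 * t) / (2 * pi)) has_integral (- sin (2 * (\<theta> + A)) / (4 * pi) - (- sin (2 * \<theta>) / (4 * pi)))) {\<theta>..\<theta> + A}"
    by (rule fundamental_theorem_of_calculus)
       (use A in \<open>auto intro!: derivative_eq_intros simp: has_real_derivative_iff_has_vector_derivative[symmetric]\<close>)
  from integral_unique[OF this]
  have i2: "integral {\<theta>..\<theta> + A} (\<lambda>t. - cos (2 * t) / (2 * pi)) = Im ((cis (2 * \<theta>) - cis (2 * (\<theta> + A))) / (4 * pi))"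
    by (simp only:) (simp add: diff_divide_distrib)
  show "polar_integral 2 \<theta> A (\<lambda>z. Re (shell_strain z)) = shell_mass * Re ((cis (2 * \<theta>) - cis (2 * (\<theta> + A))) / (4 * pi))"
    unfolding polar_integral_def re shell_mass_def i1[symmetric] by simp
  show "polar_integral 2 \<theta> A (\<lambda>z. Im (shell_strain z)) = shell_mass * Im ((cis (2 * \<theta>) - cis (2 * (\<theta> + A))) / (4 * pi))"
    unfolding polar_integral_def im shell_mass_def i2[symmetric] by simp
qed

lemma frechet_derivative_outside:
  fixes f :: "'a::euclidean_space \<Rightarrow> 'b::real_normed_vector"
  assumes f0: "\<And>z. R \<le> norm z \<Longrightarrow> f z = 0" and "R < norm z"
  shows "frechet_derivative f (at z) v = 0"
proof -
  have "(f has_derivative (\<lambda>v. 0)) (at z)"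
  proof (rule has_derivative_transform_within_open[OF has_derivative_const])
    show "open {x. R < norm x}" by (intro open_Collect_less continuous_intros)
  qed (use assms in auto)
  then show ?thesis using frechet_derivative_at by metis
qed

text \<open>Outside the ball the derivative vanishes as well, so compactness of the ball bounds
  everything; a single constant for both bounds keeps later estimates short.\<close>

lemma C1_compact_support_bound:
  fixes f :: "'a::euclidean_space \<Rightarrow> 'b::real_normed_vector"
  assumes f: "C1 f" and f0: "\<And>z. R \<le> norm z \<Longrightarrow> f z = 0"
  obtains B where "1 \<le> B" "\<And>z. norm (f z) \<le> B" "\<And>z v. norm (frechet_derivative f (at z) v) \<le> B * norm v"
proof -
  have out: "frechet_derivative f (at z) v = 0" if "R < norm z" for z v
    using f0 that by (rule frechet_derivative_outside[where R=R])
  have bd: "\<exists>B. \<forall>z. norm (g z) \<le> B" if "continuous_on UNIV g" "\<And>z. R < norm z \<Longrightarrow> g z = 0" for g :: "'a \<Rightarrow> 'b"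
  proof -
    have "bounded (g ` cball 0 R)"
      by (intro compact_imp_bounded compact_continuous_image continuous_on_subset[OF that(1)]) auto
    then obtain B where "\<forall>x\<in>g ` cball 0 R. norm x \<le> B" unfolding bounded_iff by blast
    then have B: "\<And>z. z \<in> cball 0 R \<Longrightarrow> norm (g z) \<le> B" by blast
    have "norm (g z) \<le> max B 0" for z using B[of z] that(2)[of z] by (cases "norm z \<le> R") auto
    then show ?thesis by blast
  qed
  obtain B0 where B0: "\<And>z. norm (f z) \<le> B0" using bd[OF C1_continuous[OF f]] f0 by auto
  have "\<forall>b. \<exists>B. \<forall>z. norm (frechet_derivative f (at z) b) \<le> B"
    using bd out f by (auto simp: C1_def)
  then obtain Bb where Bb: "\<And>b z. norm (frechet_derivative f (at z) b) \<le> Bb b" by metis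
  define B where "B = 1 + max B0 (DIM('a) * (\<Sum>b\<in>Basis. Bb b))"
  have Bb0: "0 \<le> Bb b" for b using Bb[where b=b and z=0] norm_ge_zero order_trans by blast
  have "norm (frechet_derivative f (at z) v) \<le> DIM('a) * (\<Sum>b\<in>Basis. Bb b) * norm v" for z v
  proof (rule frechet_bound[OF f])
    fix b :: 'a assume "b \<in> Basis"
    then have "Bb b \<le> (\<Sum>b\<in>Basis. Bb b)" by (intro member_le_sum) (auto simp: Bb0)
    then show "norm (frechet_derivative f (at z) b) \<le> (\<Sum>b\<in>Basis. Bb b)" using Bb order_trans by blast
  qed
  also have "DIM('a) * (\<Sum>b\<in>Basis. Bb b) * norm v \<le> B * norm v" for v :: 'a
    by (intro mult_right_mono) (auto simp: B_def)
  finally have 1: "norm (frechet_derivative f (at z) v) \<le> B * norm v" for z v .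
  have "0 \<le> DIM('a) * (\<Sum>b\<in>Basis. Bb b)" by (intro mult_nonneg_nonneg sum_nonneg Bb0) simp
  then have "1 \<le> B" unfolding B_def by linarith
  moreover have "norm (f z) \<le> B" for z using B0[of z] unfolding B_def by linarith
  ultimately show thesis using that 1 by blast
qed

lemma C1_Pair: "C1 f \<Longrightarrow> C1 g \<Longrightarrow> C1 (\<lambda>x. (f x, g x))"
  by (rule C1I[OF has_derivative_Pair[OF C1D C1D]]) (auto intro!: continuous_on_Pair simp: C1_def)

lemma frechet_chain:
  "C1 f \<Longrightarrow> C1 g \<Longrightarrow> frechet_derivative (\<lambda>x. f (g x)) (at x) v = frechet_derivative f (at (g x)) (frechet_derivative g (at x) v)"
  using frechet_derivative_at[OF has_derivative_compose[OF C1D[of g x] C1D[of f "g x"]]] by metis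

text \<open>Joint continuity in base point and direction matters here, since the direction will be a
  merely measurable velocity.\<close>

lemma borel_measurable_frechet:
  fixes \<psi> :: "'a::euclidean_space \<Rightarrow> real"
  assumes "C1 \<psi>" and [measurable]: "f \<in> borel_measurable M" "g \<in> borel_measurable M"
  shows "(\<lambda>x. frechet_derivative \<psi> (at (f x)) (g x)) \<in> borel_measurable M"
proof -
  have "continuous_on UNIV (\<lambda>q::'a \<times> 'a. frechet_derivative \<psi> (at (fst q)) (snd q))"
    by (intro C1_continuous_derivative[OF assms(1)] continuous_intros)
  then have m: "(\<lambda>q::'a \<times> 'a. frechet_derivative \<psi> (at (fst q)) (snd q)) \<in> borel_measurable borel"
    by (rule borel_measurable_continuous_onI)
  have "(\<lambda>x. (f x, g x)) \<in> M \<rightarrow>\<^sub>M borel" by (intro borel_measurable_Pair assms)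
  from measurable_compose[OF this m] show ?thesis by simp
qed

section \<open>The limiting dynamics of a corner\<close>

text \<open>With an acute opening \<open>A\<close> given by \<open>cos A = tanh v\<close> and
  \<open>sin A = 1 / cosh v\<close>, this is \<open>cos A * sin A ^ 2 / pi^2\<close>. The absolute
  value makes it nonnegative before the sign of \<open>v\<close> is known.\<close>

definition sech_tanh :: "real \<Rightarrow> real" where
  "sech_tanh v = \<bar>tanh v\<bar> / (cosh v)\<^sup>2 / pi\<^sup>2"

lemma sech_tanh_bounds: "0 \<le> sech_tanh v" "sech_tanh v \<le> 1"
proof -
  show "0 \<le> sech_tanh v" by (simp add: sech_tanh_def)
  have "\<bar>tanh v\<bar> \<le> 1" using tanh_real_bounds[of v] by (auto simp: abs_le_iff)
  moreover have "1 \<le> (cosh v)\<^sup>2" using cosh_real_ge_1[of v] by (simp add: one_le_power)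
  moreover have "1 \<le> pi\<^sup>2" using pi_gt3 by (simp add: one_le_power)
  ultimately have "\<bar>tanh v\<bar> / (cosh v)\<^sup>2 \<le> 1" by (smt (verit) divide_le_eq_1)
  then show "sech_tanh v \<le> 1" unfolding sech_tanh_def using \<open>1 \<le> pi\<^sup>2\<close>
    by (smt (verit) divide_le_eq_1)
qed

lemma sech_tanh_lipschitz: "\<bar>sech_tanh v - sech_tanh w\<bar> \<le> 3 * \<bar>v - w\<bar>"
proof -
  let ?g = "\<lambda>v::real. tanh v / (cosh v)\<^sup>2"
  have D: "(?g has_real_derivative ((1 - tanh x ^ 2) - 2 * tanh x ^ 2) / (cosh x)\<^sup>2) (at x)" for x
    by (rule derivative_eq_intros refl | simp)+
       (auto simp: tanh_def field_simps power2_eq_square power4_eq_xxxx)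
  have B: "\<bar>((1 - tanh x ^ 2) - 2 * tanh x ^ 2) / (cosh x)\<^sup>2\<bar> \<le> 3" for x :: real
  proof -
    have "\<bar>tanh x\<bar> \<le> 1" using tanh_real_bounds[of x] by (auto simp: abs_le_iff)
    then have "(tanh x)\<^sup>2 \<le> 1" by (simp add: abs_square_le_1)
    moreover have "0 \<le> (tanh x)\<^sup>2" by simp
    ultimately have "\<bar>(1 - tanh x ^ 2) - 2 * tanh x ^ 2\<bar> \<le> 3" by linarith
    moreover have "1 \<le> (cosh x)\<^sup>2" using cosh_real_ge_1[of x] by (simp add: one_le_power)
    ultimately show ?thesis
      using frac_le[of 3 "\<bar>(1 - tanh x ^ 2) - 2 * tanh x ^ 2\<bar>" 1 "(cosh x)\<^sup>2"] by (simp add: abs_divide)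
  qed
  have L: "\<bar>?g v - ?g w\<bar> \<le> 3 * \<bar>v - w\<bar>"
    using field_differentiable_bound[of UNIV ?g "\<lambda>x. ((1 - tanh x ^ 2) - 2 * tanh x ^ 2) / (cosh x)\<^sup>2" 3 v w] D B
    by simp
  have "sech_tanh v - sech_tanh w = (\<bar>?g v\<bar> - \<bar>?g w\<bar>) / pi\<^sup>2"
    by (simp add: sech_tanh_def diff_divide_distrib abs_divide)
  then have "\<bar>sech_tanh v - sech_tanh w\<bar> \<le> \<bar>?g v - ?g w\<bar> / pi\<^sup>2"
    by (metis abs_divide abs_power2 abs_triangle_ineq3 divide_right_mono zero_le_power2)
  also have "\<dots> \<le> \<bar>?g v - ?g w\<bar>"
    using one_le_power[of pi 2] pi_gt3 by (simp add: divide_le_eq mult_le_cancel_left1)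
  finally show ?thesis using L by linarith
qed

lemma continuous_sech_tanh: "continuous_on A sech_tanh"
  unfolding sech_tanh_def by (intro continuous_intros) auto

lemma ex_antiderivative:
  fixes f :: "real \<Rightarrow> 'a::euclidean_space"
  assumes "continuous_on UNIV f"
  obtains F where "\<And>x. (F has_vector_derivative f x) (at x)" "F 0 = 0"
proof -
  have "\<exists>F. \<forall>x::real. (-\<infinity>::ereal) < x \<longrightarrow> x < (\<infinity>::ereal) \<longrightarrow> (F has_vector_derivative f x) (at x)"
    by (rule einterval_antiderivative) (use assms continuous_on_eq_continuous_at in auto)
  then obtain F where F: "\<And>x. (F has_vector_derivative f x) (at x)" by auto
  have "((\<lambda>x. F x - F 0) has_vector_derivative f x) (at x)" for x
    using has_vector_derivative_diff[OF F[of x] has_vector_derivative_const] by simp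
  then show thesis using that[of "\<lambda>x. F x - F 0"] by simp
qed

text \<open>For nonzero \<open>s\<close> this is the integral of \<open>x * sech_tanh (v x)\<close>
  from 0 to \<open>s\<close>, divided by \<open>s\<close>; scaling to the unit interval removes the
  singularity at 0. The equation \<open>v' = shrink v\<close> then means
  \<open>(s * v')' = s * sech_tanh v\<close>, the radial form of a semilinear Poisson equation in
  the plane.\<close>

definition shrink :: "(real \<Rightarrow> real) \<Rightarrow> real \<Rightarrow> real" where
  "shrink v s = s * integral {0..1} (\<lambda>u. u * sech_tanh (v (s * u)))"

lemma integrable_shrink:
  assumes "continuous_on UNIV v"
  shows "(\<lambda>u. u * sech_tanh (v (s * u))) integrable_on {0..1}"
  by (intro integrable_continuous_real continuous_intros
        continuous_on_compose2[OF continuous_sech_tanh[of UNIV]] continuous_on_compose2[OF assms]) auto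

lemma continuous_shrink:
  assumes "continuous_on UNIV v"
  shows "continuous_on A (shrink v)"
proof -
  have "continuous_on (UNIV \<times> {0..1}) (\<lambda>(s,u). u * sech_tanh (v (s * u)))"
    unfolding split_beta
    by (intro continuous_intros
        continuous_on_compose2[OF continuous_sech_tanh[of UNIV]] continuous_on_compose2[OF assms]) auto
  then have "continuous_on (UNIV::real set) (\<lambda>s. integral {0..1} (\<lambda>u. u * sech_tanh (v (s * u))))"
    using integral_continuous_on_param[of UNIV 0 1 "\<lambda>s u. u * sech_tanh (v (s * u))"] by simp
  then have "continuous_on UNIV (shrink v)"
    unfolding shrink_def by (intro continuous_intros)
  then show ?thesis by (rule continuous_on_subset) auto
qed

lemma abs_shrink_le:
  assumes "continuous_on UNIV v"
  shows "\<bar>shrink v s\<bar> \<le> \<bar>s\<bar>"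
proof -
  have "\<bar>integral {0..1} (\<lambda>u. u * sech_tanh (v (s * u)))\<bar> \<le> integral {0..1} (\<lambda>u::real. 1)"
    using integral_norm_bound_integral[OF integrable_shrink[OF assms], of "\<lambda>u. 1" s]
      sech_tanh_bounds
    by (auto simp: abs_mult mult_le_one)
  then show ?thesis unfolding shrink_def by (simp add: abs_mult mult_left_le)
qed

text \<open>The factor 3 is the Lipschitz constant of \<open>sech_tanh\<close>, and integrating the
  exponential weight gains \<open>1 / l\<close>. A further integration gains a second
  \<open>1 / l\<close>, so that \<open>l = 2\<close> yields the contraction factor 3/4.\<close>

lemma abs_shrink_diff_le:
  assumes v: "continuous_on UNIV v" and w: "continuous_on UNIV w" and "0 < l" "0 \<le> s"
    and d: "\<And>x. 0 \<le> x \<Longrightarrow> \<bar>v x - w x\<bar> \<le> D * exp (l * x)"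
  shows "\<bar>shrink v s - shrink w s\<bar> \<le> 3 * D / l * exp (l * s)"
proof -
  have D: "0 \<le> D" using d[of 0] by simp
  have b: "\<bar>u * sech_tanh (v (s * u)) - u * sech_tanh (w (s * u))\<bar> \<le> 3 * D * exp (l * (s * u))"
    if "u \<in> {0..1}" for u
  proof -
    have "\<bar>sech_tanh (v (s * u)) - sech_tanh (w (s * u))\<bar> \<le> 3 * (D * exp (l * (s * u)))"
      using sech_tanh_lipschitz[of "v (s*u)" "w (s*u)"] d[of "s * u"] that assms(4) by fastforce
    moreover have "\<bar>u * sech_tanh (v (s * u)) - u * sech_tanh (w (s * u))\<bar> \<le> \<bar>sech_tanh (v (s * u)) - sech_tanh (w (s * u))\<bar>"
      using that by (simp add: right_diff_distrib[symmetric] abs_mult mult_left_le_one_le)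
    ultimately show ?thesis by simp
  qed
  have eq: "shrink v s - shrink w s = s * integral {0..1} (\<lambda>u. u * sech_tanh (v (s * u)) - u * sech_tanh (w (s * u)))"
    unfolding shrink_def by (subst integral_diff) (auto simp: integrable_shrink[OF v] integrable_shrink[OF w] right_diff_distrib)
  show ?thesis
  proof (cases "s = 0")
    case True then show ?thesis using D \<open>0 < l\<close> by (simp add: shrink_def)
  next
    case False
    then have s: "0 < s" using assms by simp
    have I: "((\<lambda>u. 3 * D * exp (l * (s * u))) has_integral (3 * D / (l * s) * exp (l * s) - 3 * D / (l * s))) {0..1}"
    proof -
      have "((\<lambda>u. 3 * D * exp (l * (s * u))) has_integral (3 * D / (l * s) * exp (l * (s * 1)) - 3 * D / (l * s) * exp (l * (s * 0)))) {0..1}"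
        by (rule fundamental_theorem_of_calculus)
           (use s \<open>0 < l\<close> in \<open>auto intro!: derivative_eq_intros simp: has_real_derivative_iff_has_vector_derivative[symmetric]\<close>)
      then show ?thesis by simp
    qed
    have "\<bar>integral {0..1} (\<lambda>u. u * sech_tanh (v (s * u)) - u * sech_tanh (w (s * u)))\<bar>
       \<le> integral {0..1} (\<lambda>u. 3 * D * exp (l * (s * u)))"
      using integral_norm_bound_integral[OF integrable_diff[OF integrable_shrink[OF v] integrable_shrink[OF w]] has_integral_integrable[OF I], of s s] b
      by simp
    also have "\<dots> \<le> 3 * D / (l * s) * exp (l * s)"
      using integral_unique[OF I] D \<open>0 < l\<close> s by simp
    finally show ?thesis using s \<open>0 < l\<close> unfolding eq abs_mult by (simp add: field_simps)
  qed
qed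

lemma integral_eq_antiderivative:
  fixes f :: "real \<Rightarrow> 'a::euclidean_space"
  assumes "\<And>x. (F has_vector_derivative f x) (at x)" "a \<le> b"
  shows "integral {a..b} f = F b - F a"
  by (rule integral_unique, rule fundamental_theorem_of_calculus)
     (simp_all add: assms has_vector_derivative_at_within)

text \<open>Even functions \<open>v\<close> are represented by bounded functions \<open>g\<close> through
  \<open>v s = c + exp (2 * \<bar>s\<bar>) * g s\<close>; the weight makes the integral operator a contraction.\<close>

lemma ex_radial_profile:
  fixes c :: real
  shows "\<exists>v. continuous_on UNIV v \<and> (\<forall>s. v s = c + integral {0..\<bar>s\<bar>} (shrink v))"
proof -
  define V where "V g s = c + exp (2 * \<bar>s\<bar>) * apply_bcontfun g s" for g :: "real \<Rightarrow>\<^sub>C real" and s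
  \<comment> \<open>The integral equation solved for the weighted deviation \<open>g\<close> of
    \<open>v\<close> from \<open>c\<close>. The values are bounded by 1 because
    \<open>\<bar>s\<bar>^2 \<le> exp (2 * \<bar>s\<bar>)\<close>.\<close>
  define G where "G g s = exp (- (2 * \<bar>s\<bar>)) * integral {0..\<bar>s\<bar>} (shrink (V g))" for g s
  have cV: "continuous_on UNIV (V g)" for g
    unfolding V_def by (intro continuous_intros) auto
  have ci: "continuous_on UNIV (\<lambda>s. integral {0..\<bar>s\<bar>} (shrink (V g)))" for g
  proof -
    obtain F where F: "\<And>x. (F has_vector_derivative shrink (V g) x) (at x)"
      using ex_antiderivative[OF continuous_shrink[OF cV]] by metis
    have "continuous_on UNIV F"
      by (meson F continuous_at_imp_continuous_on has_vector_derivative_continuous)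
    then have "continuous_on UNIV (\<lambda>s. F \<bar>s\<bar> - F 0)"
      by (intro continuous_intros continuous_on_compose2[OF \<open>continuous_on UNIV F\<close>]) auto
    then show ?thesis by (simp add: integral_eq_antiderivative[OF F])
  qed
  have bG: "\<bar>G g s\<bar> \<le> 1" for g s
  proof -
    have "\<bar>integral {0..\<bar>s\<bar>} (shrink (V g))\<bar> \<le> \<bar>s\<bar> * (\<bar>s\<bar> - 0)"
      using integral_bound[of 0 "\<bar>s\<bar>" "shrink (V g)" "\<bar>s\<bar>"]
        order_trans[OF abs_shrink_le[OF cV]] continuous_shrink[OF cV] by simp
    also have "\<dots> \<le> exp \<bar>s\<bar> * exp \<bar>s\<bar>"
      using exp_ge_add_one_self[of "\<bar>s\<bar>"] by (intro mult_mono) linarith+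
    also have "\<dots> = exp (2 * \<bar>s\<bar>)" by (simp add: exp_add[symmetric])
    finally show ?thesis unfolding G_def by (simp add: abs_mult exp_minus field_simps)
  qed
  have Gb: "G g \<in> bcontfun" for g
    by (rule bcontfun_normI[of _ 1]) (use bG in \<open>auto simp: G_def intro!: continuous_intros ci\<close>)
  define \<Gamma> where "\<Gamma> g = Bcontfun (G g)" for g
  have ap: "apply_bcontfun (\<Gamma> g) = G g" for g
    unfolding \<Gamma>_def using Gb by (simp add: Bcontfun_inverse)
  have "\<exists>!g. \<Gamma> g = g"
  proof (rule banach_fix_type[of "3/4"])
    show "\<forall>g h. dist (\<Gamma> g) (\<Gamma> h) \<le> 3 / 4 * dist g h"
    proof (intro allI dist_bound)
      fix g h :: "real \<Rightarrow>\<^sub>C real" and s :: real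
      let ?D = "dist g h"
      have d: "\<bar>V g x - V h x\<bar> \<le> ?D * exp (2 * x)" if "0 \<le> x" for x
      proof -
        have "V g x - V h x = exp (2 * x) * (apply_bcontfun g x - apply_bcontfun h x)"
          using that by (simp add: V_def right_diff_distrib)
        then have "\<bar>V g x - V h x\<bar> = exp (2 * x) * dist (apply_bcontfun g x) (apply_bcontfun h x)"
          by (simp add: abs_mult dist_real_def)
        then show ?thesis using dist_bounded[of g x h] by (simp add: mult.commute)
      qed
      have "\<bar>integral {0..\<bar>s\<bar>} (\<lambda>x. shrink (V g) x - shrink (V h) x)\<bar>
          \<le> integral {0..\<bar>s\<bar>} (\<lambda>x. 3 * ?D / 2 * exp (2 * x))"
        unfolding real_norm_def[symmetric]
        by (rule integral_norm_bound_integral)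
           (use abs_shrink_diff_le[OF cV cV _ _ d] in \<open>auto intro!: integrable_continuous_real
             continuous_intros continuous_shrink[OF cV]\<close>)
      also have "\<dots> = 3 * ?D / 4 * exp (2 * \<bar>s\<bar>) - 3 * ?D / 4"
        by (rule trans[OF integral_eq_antiderivative[where F="\<lambda>x. 3 * ?D / 4 * exp (2 * x)"]])
           (auto intro!: derivative_eq_intros simp: has_real_derivative_iff_has_vector_derivative[symmetric])
      also have "\<dots> \<le> 3 * ?D / 4 * exp (2 * \<bar>s\<bar>)" by simp
      finally have "\<bar>integral {0..\<bar>s\<bar>} (shrink (V g)) - integral {0..\<bar>s\<bar>} (shrink (V h))\<bar> \<le> 3 * ?D / 4 * exp (2 * \<bar>s\<bar>)"
        by (subst (asm) integral_diff) (auto intro!: integrable_continuous_real continuous_shrink[OF cV])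
      then have "\<bar>G g s - G h s\<bar> \<le> 3 / 4 * ?D"
        unfolding G_def right_diff_distrib[symmetric] by (simp add: abs_mult exp_minus field_simps)
      then show "dist (apply_bcontfun (\<Gamma> g) s) (apply_bcontfun (\<Gamma> h) s) \<le> 3 / 4 * ?D"
        by (simp add: ap dist_real_def)
    qed
  qed auto
  then obtain g where "\<Gamma> g = g" by auto
  then have "apply_bcontfun g s = G g s" for s using ap by metis
  then have "V g s = c + integral {0..\<bar>s\<bar>} (shrink (V g))" for s
    unfolding V_def[of g s] by (simp add: G_def exp_minus field_simps)
  then show ?thesis using cV by blast
qed

text \<open>The bound \<open>v \<ge> c > 0\<close> removes the absolute value in
  \<open>sech_tanh\<close>. Unboundedness is by contradiction: on a bounded range of
  \<open>v\<close> the function \<open>sech_tanh\<close> has a positive lower bound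
  \<open>d\<close>, hence the derivative of \<open>v\<close> is at least \<open>d * s / 2\<close>
  and \<open>v\<close> grows at least quadratically.\<close>

lemma ex_radial_solution:
  fixes c :: real
  assumes "0 < c"
  obtains v I where "v 0 = c" "\<And>s. c \<le> v s" "\<And>s. (v has_real_derivative I s) (at s)"
    "continuous_on UNIV I"
    "\<And>s. ((\<lambda>s. s * I s) has_real_derivative s * (tanh (v s) / (cosh (v s))\<^sup>2 / pi\<^sup>2)) (at s)"
    "\<And>B. \<exists>s>0. B < v s"
proof -
  obtain v where cv: "continuous_on UNIV v" and v: "\<And>s. v s = c + integral {0..\<bar>s\<bar>} (shrink v)"
    using ex_radial_profile by blast
  let ?I = "shrink v"
  have cI: "continuous_on UNIV ?I" by (rule continuous_shrink[OF cv])
  \<comment> \<open>As \<open>v\<close> is even, \<open>shrink v\<close> is odd and its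
    antiderivative even; this removes \<open>\<bar>s\<bar>\<close> from the integral and gives
    differentiability across 0.\<close>
  have even: "v (-s) = v s" for s by (subst (1 2) v) simp
  have odd: "?I (-s) = - ?I s" for s unfolding shrink_def by (simp add: even)
  obtain J where J: "\<And>x. (J has_vector_derivative ?I x) (at x)" and J0: "J 0 = 0"
    by (rule ex_antiderivative[OF cI]) blast
  have Jd: "(J has_real_derivative ?I x) (at x)" for x
    using J has_real_derivative_iff_has_vector_derivative by blast
  have "((\<lambda>x. J (-x) - J x) has_real_derivative 0) (at x)" for x
    using DERIV_diff[OF DERIV_chain2[OF Jd[of "-x"] DERIV_minus[OF DERIV_ident]] Jd[of x]] by (simp add: odd)
  then have "J (-x) - J x = J (-0) - J 0" for x
    using DERIV_isconst_all[of "\<lambda>x. J (-x) - J x" x 0] by auto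
  then have "J \<bar>s\<bar> = J s" for s by (simp add: abs_if)
  then have vJ: "v = (\<lambda>s. c + J s)"
    by (intro ext) (subst v, simp add: integral_eq_antiderivative[OF J] J0)
  have dv: "(v has_real_derivative ?I s) (at s)" for s
    unfolding vJ using DERIV_add[OF DERIV_const Jd, of c s] by (simp add: vJ[symmetric])
  have I0: "0 \<le> s \<Longrightarrow> 0 \<le> ?I s" for s
    unfolding shrink_def using sech_tanh_bounds
    by (intro mult_nonneg_nonneg integral_nonneg integrable_shrink[OF cv]) auto
  have ge: "c \<le> v s" for s
  proof -
    have "0 \<le> integral {0..\<bar>s\<bar>} ?I"
      by (intro integral_nonneg integrable_continuous_real continuous_on_subset[OF cI]) (auto simp: I0)
    then show ?thesis by (subst v) simp
  qed
  have st: "sech_tanh (v s) = tanh (v s) / (cosh (v s))\<^sup>2 / pi\<^sup>2" for s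
    using ge[of s] assms by (simp add: sech_tanh_def)
  have dsI: "((\<lambda>s. s * ?I s) has_real_derivative s * sech_tanh (v s)) (at s)" for s
  proof -
    have "continuous_on UNIV (\<lambda>s. s * sech_tanh (v s))"
      by (intro continuous_intros continuous_on_compose2[OF continuous_sech_tanh[of UNIV] cv]) auto
    then obtain K where K: "\<And>x. (K has_vector_derivative x * sech_tanh (v x)) (at x)" and "K 0 = 0"
      by (rule ex_antiderivative) blast
    \<comment> \<open>The substitution \<open>x = s * u\<close> undoes the scaling in
      \<open>shrink\<close>.\<close>
    have "s * ?I s = K s" for s
    proof -
      have Kd: "(K has_real_derivative x * sech_tanh (v x)) (at x)" for x
        using K has_real_derivative_iff_has_vector_derivative by blast
      have "((\<lambda>u. K (s * u)) has_vector_derivative s * s * (u * sech_tanh (v (s * u)))) (at u)" for u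
        unfolding has_real_derivative_iff_has_vector_derivative[symmetric]
        using DERIV_chain2[OF Kd[of "s*u"] DERIV_cmult[OF DERIV_ident, of s u]] by (simp add: mult_ac)
      from integral_eq_antiderivative[OF this, of 0 1]
      show ?thesis unfolding shrink_def by (simp add: \<open>K 0 = 0\<close>)
    qed
    then have "(\<lambda>s. s * ?I s) = K" by auto
    then show ?thesis using K has_real_derivative_iff_has_vector_derivative by metis
  qed
  have unb: "\<exists>s>0. B < v s" for B
  proof (rule ccontr)
    assume "\<not> (\<exists>s>0. B < v s)"
    then have B: "s > 0 \<Longrightarrow> v s \<le> B" for s by force
    have B': "0 \<le> s \<Longrightarrow> v s \<le> max B c" for s using B[of s] v[of 0] by (cases "s = 0") (auto simp: le_max_iff_disj)
    define d where "d = tanh c / (cosh (max B c))\<^sup>2 / pi\<^sup>2"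
    have d: "0 < d" unfolding d_def using assms by (simp add: divide_pos_pos)
    have F: "d \<le> sech_tanh (v s)" if "0 \<le> s" for s
      unfolding d_def st
      using ge[of s] B'[OF that] assms
      by (intro divide_right_mono frac_le power_mono) (auto simp: cosh_real_nonneg_le_iff less_imp_le)
    have I: "d * s / 2 \<le> ?I s" if "0 \<le> s" for s
    proof -
      have "integral {0..1} (\<lambda>u. u * d) \<le> integral {0..1} (\<lambda>u. u * sech_tanh (v (s * u)))"
        by (intro integral_le integrable_shrink[OF cv]) 
           (auto intro!: integrable_continuous_real continuous_intros mult_left_mono F simp: that)
      moreover have "integral {0..1} (\<lambda>u. u * d) = d / 2"
        using integral_eq_antiderivative[of "\<lambda>u. u\<^sup>2 * d / 2" "\<lambda>u. u * d" 0 1]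
        by (auto intro!: derivative_eq_intros simp: has_real_derivative_iff_has_vector_derivative[symmetric])
      ultimately show ?thesis unfolding shrink_def using mult_left_mono[of "d/2" "integral {0..1} (\<lambda>u. u * sech_tanh (v (s * u)))" s] that by (simp add: mult_ac)
    qed
    have lb: "c + d * s\<^sup>2 / 4 \<le> v s" if "0 \<le> s" for s
    proof -
      have "integral {0..s} (\<lambda>x. d * x / 2) \<le> integral {0..s} ?I"
        by (intro integral_le I) (auto intro!: integrable_continuous_real continuous_intros continuous_on_subset[OF cI])
      moreover have "integral {0..s} (\<lambda>x. d * x / 2) = d * s\<^sup>2 / 4"
        using integral_eq_antiderivative[of "\<lambda>x. d * x\<^sup>2 / 4" "\<lambda>x. d * x / 2" 0 s] that
        by (auto intro!: derivative_eq_intros simp: has_real_derivative_iff_has_vector_derivative[symmetric])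
      ultimately show ?thesis using that by (subst v) simp
    qed
    \<comment> \<open>Large enough that
      \<open>d * s^2 / 4 \<ge> d * s / 4 > \<bar>B\<bar>\<close>.\<close>
    define s where "s = 1 + 4 * \<bar>B\<bar> / d"
    have s1: "1 \<le> s" unfolding s_def using d by simp
    have "c + d * s\<^sup>2 / 4 \<le> B" using lb[of s] B[of s] s1 by linarith
    moreover have "d * s \<le> d * s\<^sup>2" using s1 d by (simp add: power2_eq_square)
    moreover have "d * s = d + 4 * \<bar>B\<bar>" unfolding s_def using d by (simp add: distrib_left)
    ultimately show False using d assms by linarith
  qed
  show thesis
    by (rule that[of v ?I]) (use ge dv cI dsI unb st v[of 0] in auto)
qed

text \<open>The product rule in a rotating frame; the edges and both coefficients of the model have
  this form.\<close>

lemma has_vector_derivative_Complex_cis: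
  assumes "(p has_real_derivative p') (at s)" "(q has_real_derivative q') (at s)"
    and "(\<theta> has_real_derivative \<theta>') (at s)"
  shows "((\<lambda>s. Complex (p s) (q s) * cis (\<theta> s)) has_vector_derivative
           Complex (p' - \<theta>' * q s) (q' + \<theta>' * p s) * cis (\<theta> s)) (at s)"
proof -
  have "((\<lambda>s. (of_real (p s) + \<i> * of_real (q s)) * exp (\<i> * of_real (\<theta> s))) has_vector_derivative
     (of_real p' + \<i> * of_real q') * exp (\<i> * of_real (\<theta> s))
      + (of_real (p s) + \<i> * of_real (q s)) * (\<i> * of_real \<theta>' * exp (\<i> * of_real (\<theta> s)))) (at s)"
  proof -
    note v = assms[THEN has_vector_derivative_of_real]
    have i: "((\<lambda>s. \<i> * complex_of_real (g s)) has_vector_derivative \<i> * complex_of_real g') (at s)"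
      if "(g has_real_derivative g') (at s)" for g g'
      using that[THEN has_vector_derivative_of_real, THEN has_vector_derivative_mult_right] .
    have e: "((\<lambda>s. exp (\<i> * complex_of_real (\<theta> s))) has_vector_derivative \<i> * of_real \<theta>' * exp (\<i> * of_real (\<theta> s))) (at s)"
      using field_vector_diff_chain_at[OF i[OF assms(3)] DERIV_exp] by (simp add: o_def)
    show ?thesis
      using has_vector_derivative_mult[OF has_vector_derivative_add[OF v(1) i[OF assms(2)]] e]
      by (simp add: add.commute)
  qed
  moreover have "(of_real p' + \<i> * of_real q') * exp (\<i> * of_real (\<theta> s))
      + (of_real (p s) + \<i> * of_real (q s)) * (\<i> * of_real \<theta>' * exp (\<i> * of_real (\<theta> s)))
     = Complex (p' - \<theta>' * q s) (q' + \<theta>' * p s) * cis (\<theta> s)"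
    by (simp add: complex_eq_iff cis_conv_exp algebra_simps Re_exp Im_exp)
  moreover have "(\<lambda>s. Complex (p s) (q s) * cis (\<theta> s)) = (\<lambda>s. (of_real (p s) + \<i> * of_real (q s)) * exp (\<i> * of_real (\<theta> s)))"
    by (simp add: cis_conv_exp Complex_eq)
  ultimately show ?thesis by simp
qed

lemma continuous_on_Complex [continuous_intros]:
  "continuous_on A f \<Longrightarrow> continuous_on A g \<Longrightarrow> continuous_on A (\<lambda>x. Complex (f x) (g x))"
  unfolding Complex_eq by (intro continuous_intros)

lemma DERIV_imp_continuous_on_UNIV:
  fixes f :: "real \<Rightarrow> real"
  assumes "\<And>s. (f has_real_derivative f' s) (at s)"
  shows "continuous_on UNIV f"
  by (intro continuous_at_imp_continuous_on ballI DERIV_isCont[OF assms])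

text \<open>Let \<phi> be the direction of the bisector and \<open>A\<close> the opening. A shell of
  the sector produces \<open>a = - i * sin A / (2 * pi) * cis (2 * \<phi>)\<close>, which suggests
  \<open>m = (I / 2 - i * sin A / (2 * pi)) * cis (2 * \<phi>)\<close> with a real function
  \<open>I\<close>. The edge equations then give \<open>A' = - I * sin A\<close> and
  \<open>\<phi>' = - sin A * cos A / (2 * pi)\<close>, and \<open>(s * m)' = a\<close> reduces to
  \<open>(s * I)' = s * cos A * sin A ^ 2 / pi^2\<close>. The substitution
  \<open>A = 2 * arctan (exp (- v))\<close> turns the first of these into \<open>v' = I\<close>, so
  everything follows from \<open>ex_radial_solution\<close>.\<close>

theorem ex_corner_model:
  fixes \<alpha> \<beta> :: real
  assumes "0 < \<alpha>" "\<alpha> < pi / 2"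
  obtains e1 e2 m a a' :: "real \<Rightarrow> complex" and r1 r2 \<theta> A :: "real \<Rightarrow> real" where
    "\<And>s. (e1 has_vector_derivative m s * cnj (e1 s)) (at s)"
    "\<And>s. (e2 has_vector_derivative m s * cnj (e2 s)) (at s)"
    "continuous_on UNIV m"
    "\<And>s. Im (cnj (e1 s) * e2 s) = 1"
    "\<And>s. e1 s = r1 s * cis (\<theta> s)" "\<And>s. e2 s = r2 s * cis (\<theta> s + A s)"
    "\<And>s. 0 < r1 s" "\<And>s. 0 < r2 s" "\<And>s. 0 < A s" "\<And>s. A s < pi"
    "\<theta> 0 = \<beta>" "A 0 = \<alpha>" "continuous_on UNIV A"
    "\<And>s. a s = (cis (2 * \<theta> s) - cis (2 * (\<theta> s + A s))) / (4 * pi)"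
    "\<And>s. ((\<lambda>s. s * m s) has_vector_derivative a s) (at s)"
    "\<And>s. (a has_vector_derivative a' s) (at s)" "continuous_on UNIV a'"
    "\<And>\<delta>. 0 < \<delta> \<Longrightarrow> \<exists>s>0. A s < \<delta>"
proof -
  \<comment> \<open>Chosen so that \<open>A 0 = \<alpha>\<close>. Positivity of \<open>c\<close>
    amounts to \<open>tan (\<alpha> / 2) < 1\<close>; this is where the corner has to be
    acute.\<close>
  define c where "c = - ln (tan (\<alpha> / 2))"
  have t: "0 < tan (\<alpha> / 2)" "tan (\<alpha> / 2) < 1"
    using assms tan_gt_zero[of "\<alpha> / 2"] tan_monotone[of "\<alpha> / 2" "pi / 4"] by (auto simp: tan_45)
  have c: "0 < c" unfolding c_def using t by simp
  obtain v I where v0: "v 0 = c" and vc: "\<And>s. c \<le> v s" and dv: "\<And>s. (v has_real_derivative I s) (at s)"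
    and cI: "continuous_on UNIV I"
    and dsI: "\<And>s. ((\<lambda>s. s * I s) has_real_derivative s * (tanh (v s) / (cosh (v s))\<^sup>2 / pi\<^sup>2)) (at s)"
    and unb: "\<And>B. \<exists>s>0. B < v s"
    apply (rule ex_radial_solution[OF c])
    subgoal premises p for v I by (rule p(1)[OF p(2-)])
    done
  have cv: "continuous_on UNIV v" by (rule DERIV_imp_continuous_on_UNIV[OF dv])
  have ch0: "cosh x \<noteq> 0" for x :: real using cosh_real_pos[of x] by linarith
  have "continuous_on UNIV (\<lambda>s. - (tanh (v s) / (2 * pi * cosh (v s))))"
    by (auto intro!: continuous_intros cv simp: ch0)
  then obtain \<phi>0 where d\<phi>0: "\<And>s. (\<phi>0 has_vector_derivative - (tanh (v s) / (2 * pi * cosh (v s)))) (at s)" and \<phi>00: "\<phi>0 0 = (0::real)"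
    by (rule ex_antiderivative) blast
  have "continuous_on UNIV (\<lambda>s. 1 / (2 * pi * (cosh (v s))\<^sup>2))"
    by (auto intro!: continuous_intros cv simp: ch0)
  then obtain \<nu> where d\<nu>0: "\<And>s. (\<nu> has_vector_derivative 1 / (2 * pi * (cosh (v s))\<^sup>2)) (at s)" and \<nu>0: "\<nu> 0 = (0::real)"
    by (rule ex_antiderivative) blast
  define \<phi> where "\<phi> s = \<beta> + \<alpha> / 2 + \<phi>0 s" for s
  define A where "A s = 2 * arctan (exp (- v s))" for s
  have d\<phi>: "(\<phi> has_real_derivative - (tanh (v s) / (2 * pi * cosh (v s)))) (at s)" for s
    unfolding \<phi>_def using DERIV_add[OF DERIV_const d\<phi>0[folded has_real_derivative_iff_has_vector_derivative]] by simp
  have d\<nu>: "(\<nu> has_real_derivative 1 / (2 * pi * (cosh (v s))\<^sup>2)) (at s)" for s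
    using d\<nu>0[folded has_real_derivative_iff_has_vector_derivative] .
  have dA: "(A has_real_derivative - I s / cosh (v s)) (at s)" for s
  proof -
    have "(A has_real_derivative 2 * (inverse (1 + (exp (- v s))\<^sup>2) * (exp (- v s) * - I s))) (at s)"
      unfolding A_def by (intro DERIV_cmult DERIV_chain2[OF DERIV_arctan] DERIV_chain2[OF DERIV_exp] DERIV_minus dv)
    moreover have "2 * (inverse (1 + (exp (- v s))\<^sup>2) * (exp (- v s) * - I s)) = - I s / cosh (v s)"
    proof -
      define E where "E = exp (- v s)"
      have E: "0 < E" "exp (v s) = 1 / E" unfolding E_def by (auto simp: exp_minus field_simps)
      have "1 + E * E \<noteq> 0" using E by (smt (verit) mult_pos_pos)
      then show ?thesis unfolding cosh_field_def E_def[symmetric] E(2)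
        using E(1) by (simp add: field_simps power2_eq_square)
    qed
    ultimately show ?thesis by simp
  qed
  have sA: "sin (A s) = 1 / cosh (v s)" and cA: "cos (A s) = tanh (v s)" for s
  proof -
    define E where "E = exp (- v s)"
    have E: "0 < E" "exp (v s) = 1 / E" unfolding E_def by (auto simp: exp_minus field_simps)
    have q: "(sqrt (1 + E\<^sup>2))\<^sup>2 = 1 + E\<^sup>2" "sqrt (1 + E\<^sup>2) * sqrt (1 + E\<^sup>2) = 1 + E\<^sup>2" "1 + E\<^sup>2 \<noteq> 0"
      by (auto simp: add_nonneg_eq_0_iff)
    show "sin (A s) = 1 / cosh (v s)"
      unfolding A_def sin_double cosh_field_def E_def[symmetric] E(2) sin_arctan cos_arctan
      using E(1) q by (simp add: field_simps power2_eq_square)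
    have "cos (A s) = (1 - E\<^sup>2) / (1 + E\<^sup>2)"
      unfolding A_def cos_double E_def[symmetric] sin_arctan cos_arctan power_divide q(1)
      by (simp add: diff_divide_distrib)
    moreover have "tanh (v s) = ((1 - E\<^sup>2) / (2 * E)) / ((1 + E\<^sup>2) / (2 * E))"
      unfolding tanh_def sinh_field_def cosh_field_def E_def[symmetric] E(2)
      by (rule arg_cong2[where f="(/)"]) (use E(1) in \<open>simp_all add: field_simps power2_eq_square\<close>)
    ultimately show "cos (A s) = tanh (v s)" using E(1) by simp
  qed
  have A: "0 < A s" "A s < pi" for s
    unfolding A_def using arctan_ubound[of "exp (- v s)"] by (auto simp: zero_less_arctan_iff)
  have A0: "A 0 = \<alpha>"
    unfolding A_def v0 c_def using t assms by (simp add: arctan_tan)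
  define \<theta> where "\<theta> s = \<phi> s - A s / 2" for s
  have d\<theta>: "(\<theta> has_real_derivative I s / (2 * cosh (v s)) - tanh (v s) / (2 * pi * cosh (v s))) (at s)" for s
    unfolding \<theta>_def by (rule DERIV_cong[OF DERIV_diff[OF d\<phi> DERIV_cdivide[OF dA]]]) (simp add: field_simps)
  have d\<theta>2: "((\<lambda>s. \<theta> s + A s) has_real_derivative - I s / (2 * cosh (v s)) - tanh (v s) / (2 * pi * cosh (v s))) (at s)" for s
    by (rule DERIV_cong[OF DERIV_add[OF d\<theta> dA]]) (simp add: field_simps)
  \<comment> \<open>The common factor makes \<open>r1 * r2 = cosh v = 1 / sin A\<close>, so that the
    frame has unit area. The function \<open>\<nu>\<close> records the unequal stretching of the two
    edges caused by the imaginary part of \<open>m\<close> in the frame of the bisector.\<close>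
  define r1 where "r1 s = exp (\<nu> s) * sqrt (cosh (v s))" for s
  define r2 where "r2 s = exp (- \<nu> s) * sqrt (cosh (v s))" for s
  have rpos: "0 < r1 s" "0 < r2 s" for s unfolding r1_def r2_def by (auto simp: cosh_real_pos)
  have dsq: "((\<lambda>s. sqrt (cosh (v s))) has_real_derivative sqrt (cosh (v s)) * (tanh (v s) * I s / 2)) (at s)" for s
  proof -
    have "sqrt (cosh (v s)) * sqrt (cosh (v s)) = cosh (v s)" "0 < sqrt (cosh (v s))"
      using cosh_real_pos[of "v s"] by auto
    then show ?thesis
      by (intro DERIV_cong[OF DERIV_chain2[OF DERIV_real_sqrt[OF cosh_real_pos] has_field_derivative_cosh[OF dv]]])
         (simp add: tanh_def field_simps)
  qed
  have dr1: "(r1 has_real_derivative r1 s * (tanh (v s) * I s / 2 + 1 / (2 * pi * (cosh (v s))\<^sup>2))) (at s)" for s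
    unfolding r1_def
    by (rule DERIV_cong[OF DERIV_mult[OF DERIV_chain2[OF DERIV_exp d\<nu>] dsq]]) (simp add: algebra_simps)
  have dr2: "(r2 has_real_derivative r2 s * (tanh (v s) * I s / 2 - 1 / (2 * pi * (cosh (v s))\<^sup>2))) (at s)" for s
    unfolding r2_def
    by (rule DERIV_cong[OF DERIV_mult[OF DERIV_chain2[OF DERIV_exp DERIV_minus[OF d\<nu>]] dsq]]) (simp add: algebra_simps)
  define e1 where "e1 s = complex_of_real (r1 s) * cis (\<theta> s)" for s
  define e2 where "e2 s = complex_of_real (r2 s) * cis (\<theta> s + A s)" for s
  define m where "m s = Complex (I s / 2) (- (1 / (2 * pi * cosh (v s)))) * cis (2 * \<phi> s)" for s
  define a where "a s = Complex 0 (- (1 / (2 * pi * cosh (v s)))) * cis (2 * \<phi> s)" for s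
  define a' where "a' s = Complex (0 - 2 * - (tanh (v s) / (2 * pi * cosh (v s))) * - (1 / (2 * pi * cosh (v s))))
     (tanh (v s) * I s / (2 * pi * cosh (v s)) + 2 * - (tanh (v s) / (2 * pi * cosh (v s))) * 0) * cis (2 * \<phi> s)" for s
  have csA: "cis (A s) = Complex (tanh (v s)) (1 / cosh (v s))" for s
    by (simp add: complex_eq_iff sA cA)
  have csA': "cis (- A s) = Complex (tanh (v s)) (- (1 / cosh (v s)))" for s
    by (simp add: complex_eq_iff sA cA)
  have ph1: "cis (2 * \<phi> s) * cis (- \<theta> s) = cis (A s) * cis (\<theta> s)" for s
    by (simp add: cis_mult \<theta>_def algebra_simps)
  have ph2: "cis (2 * \<phi> s) * cis (- (\<theta> s + A s)) = cis (- A s) * cis (\<theta> s + A s)" for s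
    by (simp add: cis_mult \<theta>_def algebra_simps)
  have de1: "(e1 has_vector_derivative m s * cnj (e1 s)) (at s)" for s
  proof -
    have "(e1 has_vector_derivative Complex (r1 s * (tanh (v s) * I s / 2 + 1 / (2 * pi * (cosh (v s))\<^sup>2)) - (I s / (2 * cosh (v s)) - tanh (v s) / (2 * pi * cosh (v s))) * 0)
       (0 + (I s / (2 * cosh (v s)) - tanh (v s) / (2 * pi * cosh (v s))) * r1 s) * cis (\<theta> s)) (at s)"
      unfolding e1_def complex_of_real_def
      by (rule has_vector_derivative_Complex_cis[OF dr1 DERIV_const d\<theta>])
    moreover have "m s * cnj (e1 s) = Complex (I s / 2) (- (1 / (2 * pi * cosh (v s)))) * of_real (r1 s) * (cis (2 * \<phi> s) * cis (- \<theta> s))"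
      unfolding m_def e1_def by (simp add: cis_cnj)
    moreover have "\<dots> = Complex (r1 s * (tanh (v s) * I s / 2 + 1 / (2 * pi * (cosh (v s))\<^sup>2)) - (I s / (2 * cosh (v s)) - tanh (v s) / (2 * pi * cosh (v s))) * 0)
       (0 + (I s / (2 * cosh (v s)) - tanh (v s) / (2 * pi * cosh (v s))) * r1 s) * cis (\<theta> s)"
      unfolding ph1 mult.assoc[symmetric] csA
      by (rule arg_cong2[where f="(*)"]) (auto simp: complex_eq_iff field_simps power2_eq_square)
    ultimately show ?thesis by simp
  qed
  have de2: "(e2 has_vector_derivative m s * cnj (e2 s)) (at s)" for s
  proof -
    have "(e2 has_vector_derivative Complex (r2 s * (tanh (v s) * I s / 2 - 1 / (2 * pi * (cosh (v s))\<^sup>2)) - (- I s / (2 * cosh (v s)) - tanh (v s) / (2 * pi * cosh (v s))) * 0)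
       (0 + (- I s / (2 * cosh (v s)) - tanh (v s) / (2 * pi * cosh (v s))) * r2 s) * cis (\<theta> s + A s)) (at s)"
      unfolding e2_def complex_of_real_def
      by (rule has_vector_derivative_Complex_cis[OF dr2 DERIV_const d\<theta>2])
    moreover have "m s * cnj (e2 s) = Complex (I s / 2) (- (1 / (2 * pi * cosh (v s)))) * of_real (r2 s) * (cis (2 * \<phi> s) * cis (- (\<theta> s + A s)))"
      unfolding m_def e2_def by (simp add: cis_cnj)
    moreover have "\<dots> = Complex (r2 s * (tanh (v s) * I s / 2 - 1 / (2 * pi * (cosh (v s))\<^sup>2)) - (- I s / (2 * cosh (v s)) - tanh (v s) / (2 * pi * cosh (v s))) * 0)
       (0 + (- I s / (2 * cosh (v s)) - tanh (v s) / (2 * pi * cosh (v s))) * r2 s) * cis (\<theta> s + A s)"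
      unfolding ph2 mult.assoc[symmetric] csA'
      by (rule arg_cong2[where f="(*)"]) (auto simp: complex_eq_iff field_simps power2_eq_square)
    ultimately show ?thesis by simp
  qed
  have c\<phi>: "continuous_on UNIV \<phi>" by (rule DERIV_imp_continuous_on_UNIV[OF d\<phi>])
  have ccis: "continuous_on UNIV (\<lambda>s. cis (2 * \<phi> s))"
    unfolding cis_conv_exp by (intro continuous_intros c\<phi>)
  have cm: "continuous_on UNIV m"
    unfolding m_def by (intro continuous_intros ccis cI cv) (auto simp: ch0)
  have ca': "continuous_on UNIV a'"
  proof -
    have t: "continuous_on UNIV (\<lambda>s. tanh (v s))"
      by (rule continuous_on_tanh[OF cv]) (simp add: ch0)
    have d: "continuous_on UNIV (\<lambda>s. 1 / (2 * pi * cosh (v s)))"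
      by (intro continuous_on_divide continuous_on_mult continuous_on_const continuous_on_cosh cv) (simp add: ch0)
    have eq: "a' s = Complex (- (2 * tanh (v s) * (1 / (2 * pi * cosh (v s))) * (1 / (2 * pi * cosh (v s)))))
        (tanh (v s) * I s * (1 / (2 * pi * cosh (v s)))) * cis (2 * \<phi> s)" for s
      unfolding a'_def by (simp add: field_simps)
    show ?thesis unfolding eq
      by (intro continuous_on_mult continuous_on_Complex continuous_on_minus continuous_on_const t d cI ccis)
  qed
  have det: "Im (cnj (e1 s) * e2 s) = 1" for s
  proof -
    have "cnj (e1 s) * e2 s = of_real (r1 s * r2 s) * (cis (- \<theta> s) * cis (\<theta> s + A s))"
      unfolding e1_def e2_def by (simp add: cis_cnj mult_ac)
    also have "r1 s * r2 s = cosh (v s)"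
      unfolding r1_def r2_def using cosh_real_pos[of "v s"] by (simp add: exp_minus field_simps)
    also have "cis (- \<theta> s) * cis (\<theta> s + A s) = cis (A s)" by (simp add: cis_mult)
    finally show ?thesis by (simp add: sA ch0)
  qed
  have aeq: "a s = (cis (2 * \<theta> s) - cis (2 * (\<theta> s + A s))) / (4 * pi)" for s
  proof -
    have "cis (2 * \<theta> s) = cis (2 * \<phi> s) * cis (- A s)" "cis (2 * (\<theta> s + A s)) = cis (2 * \<phi> s) * cis (A s)"
      by (auto simp: cis_mult \<theta>_def algebra_simps)
    then have "cis (2 * \<theta> s) - cis (2 * (\<theta> s + A s)) = cis (2 * \<phi> s) * Complex 0 (- (2 / cosh (v s)))"
      unfolding right_diff_distrib[symmetric] csA csA' by (simp add: complex_eq_iff)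
    then show ?thesis unfolding a_def by (simp add: complex_eq_iff field_simps)
  qed
  have dch: "((\<lambda>s. 1 / (2 * pi * cosh (v s))) has_real_derivative - (tanh (v s) * I s / (2 * pi * cosh (v s)))) (at s)" for s
    by (rule DERIV_cong[OF DERIV_divide[OF DERIV_const DERIV_cmult[OF has_field_derivative_cosh[OF dv]]]])
       (simp_all add: ch0 tanh_def field_simps)
  have da: "(a has_vector_derivative a' s) (at s)" for s
    unfolding a_def a'_def
    by (rule has_vector_derivative_Complex_cis[OF DERIV_const DERIV_cong[OF DERIV_minus[OF dch]] DERIV_cmult[OF d\<phi>]]) simp
  have dm: "((\<lambda>s. s * m s) has_vector_derivative a s) (at s)" for s
  proof -
    have 1: "((\<lambda>s. Complex (s * I s / 2) (- (s * (1 / (2 * pi * cosh (v s))))) * cis (2 * \<phi> s)) has_vector_derivative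
      Complex (s * (tanh (v s) / (cosh (v s))\<^sup>2 / pi\<^sup>2) / 2 - 2 * - (tanh (v s) / (2 * pi * cosh (v s))) * - (s * (1 / (2 * pi * cosh (v s)))))
        (- (1 * (1 / (2 * pi * cosh (v s))) + - (tanh (v s) * I s / (2 * pi * cosh (v s))) * s) + 2 * - (tanh (v s) / (2 * pi * cosh (v s))) * (s * I s / 2))
      * cis (2 * \<phi> s)) (at s)"
      by (rule has_vector_derivative_Complex_cis[OF DERIV_cdivide[OF dsI] DERIV_minus[OF DERIV_mult[OF DERIV_ident dch]] DERIV_cmult[OF d\<phi>]])
    \<comment> \<open>The real part vanishes by the equation for \<open>I\<close>; in the imaginary
      part the terms proportional to \<open>s\<close> cancel.\<close>
    have 2: "Complex (s * (tanh (v s) / (cosh (v s))\<^sup>2 / pi\<^sup>2) / 2 - 2 * - (tanh (v s) / (2 * pi * cosh (v s))) * - (s * (1 / (2 * pi * cosh (v s)))))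
        (- (1 * (1 / (2 * pi * cosh (v s))) + - (tanh (v s) * I s / (2 * pi * cosh (v s))) * s) + 2 * - (tanh (v s) / (2 * pi * cosh (v s))) * (s * I s / 2))
       = Complex 0 (- (1 / (2 * pi * cosh (v s))))"
      by (simp add: ch0 field_simps power2_eq_square)
    have 3: "(\<lambda>s. Complex (s * I s / 2) (- (s * (1 / (2 * pi * cosh (v s))))) * cis (2 * \<phi> s)) = (\<lambda>s. s * m s)"
      unfolding m_def by (auto simp: complex_eq_iff fun_eq_iff algebra_simps)
    show ?thesis using 1 unfolding 2 3 a_def .
  qed
  have small: "\<exists>s>0. A s < \<delta>" if "0 < \<delta>" for \<delta>
  proof -
    obtain s where s: "0 < s" "- ln (\<delta> / 2) < v s" using unb by blast
    then have "exp (- v s) < \<delta> / 2"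
      using exp_less_mono[of "- v s" "ln (\<delta> / 2)"] that by simp
    moreover have "arctan (exp (- v s)) \<le> exp (- v s)" by (rule arctan_le_self) simp
    ultimately show ?thesis using s(1) unfolding A_def by (intro exI[of _ s]) auto
  qed
  show thesis
    by (rule that[of e1 m e2 r1 \<theta> r2 A a a'])
       (rule de1 de2 cm det rpos A A0 DERIV_imp_continuous_on_UNIV[OF dA] aeq dm da ca' small e1_def e2_def | assumption
         | simp add: \<theta>_def \<phi>_def \<phi>00 A0)+
qed

section \<open>The weak formulation along a trajectory\<close>

text \<open>Lebesgue measurable indicators are limits of continuous functions, so nonnegative continuous
  weights detect the sign almost everywhere.\<close>

lemma AE_nonpos_if_weighted_integrals_nonpos:
  fixes h :: "real \<Rightarrow> real"
  assumes h [measurable]: "h \<in> borel_measurable borel" and bd: "\<And>t. \<bar>h t\<bar> \<le> B"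
    and le: "\<And>\<zeta>. continuous_on UNIV \<zeta> \<Longrightarrow> (\<And>t. 0 \<le> \<zeta> t) \<Longrightarrow> (\<And>t. t \<notin> {0..T} \<Longrightarrow> \<zeta> t = 0) \<Longrightarrow>
          (LINT t:{0..T}|lborel. \<zeta> t * h t) \<le> 0"
  shows "AE t in lborel. t \<in> {0..T} \<longrightarrow> h t \<le> 0"
proof -
  define A where "A = {t \<in> {0<..<T}. 0 < h t}"
  have A [measurable]: "A \<in> sets borel" unfolding A_def by measurable
  then have "(indicator A :: real \<Rightarrow> real) \<in> borel_measurable lebesgue"
    by (intro measurable_completion) simp
  then have "(indicator A :: real \<Rightarrow> real) measurable_on UNIV"
    by (simp add: measurable_on_iff_borel_measurable)
  then obtain N g where N: "negligible N" and g: "\<And>n. continuous_on UNIV (g n)"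
    and lim: "\<And>t. t \<notin> N \<Longrightarrow> (\<lambda>n. g n t) \<longlonglongrightarrow> (indicator A t :: real)"
    unfolding measurable_on_def by auto
  \<comment> \<open>The approximants are clipped to the unit interval and multiplied by a continuous
    cutoff that vanishes outside \<open>{0..T}\<close>; the factor \<open>n\<close> makes the cutoff
    tend to 1 in the open interval.\<close>
  define \<zeta> where "\<zeta> n t = max 0 (min 1 (g n t)) * min 1 (real n * max 0 (min t (T - t)))" for n t
  have c\<zeta>: "continuous_on UNIV (\<zeta> n)" for n
    unfolding \<zeta>_def by (intro continuous_intros g)
  have \<zeta>01: "0 \<le> \<zeta> n t" "\<zeta> n t \<le> 1" for n t
    unfolding \<zeta>_def by (auto intro!: mult_nonneg_nonneg mult_le_one)
  have \<zeta>0: "\<zeta> n t = 0" if "t \<notin> {0..T}" for n t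
    using that unfolding \<zeta>_def by (auto simp: max_def)
  have lim\<zeta>: "(\<lambda>n. \<zeta> n t) \<longlonglongrightarrow> indicator A t" if "t \<notin> N" for t
  proof (cases "t \<in> {0<..<T}")
    case True
    define d where "d = max 0 (min t (T - t))"
    have d: "0 < d" using True by (auto simp: d_def)
    obtain m :: nat where m: "1 / d < m" using reals_Archimedean2 by blast
    have "min 1 (real n * d) = 1" if "n \<ge> m" for n
    proof -
      have "1 < real m * d" using m d by (simp add: field_simps)
      also have "\<dots> \<le> real n * d" using that d by (intro mult_right_mono) auto
      finally show ?thesis by simp
    qed
    then have "(\<lambda>n. min 1 (real n * d)) \<longlonglongrightarrow> 1"
      by (intro tendsto_eventually eventually_sequentiallyI[of m])
    moreover have "(\<lambda>n. max 0 (min 1 (g n t))) \<longlonglongrightarrow> max 0 (min 1 (indicator A t))"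
      by (intro tendsto_intros lim that)
    ultimately have "(\<lambda>n. \<zeta> n t) \<longlonglongrightarrow> max 0 (min 1 (indicator A t)) * 1"
      unfolding \<zeta>_def d_def[symmetric] by (intro tendsto_mult)
    moreover have "max 0 (min 1 (indicator A t)) * 1 = (indicator A t :: real)" by (auto simp: indicator_def)
    ultimately show ?thesis by simp
  next
    case False
    then have "\<zeta> n t = 0" for n unfolding \<zeta>_def by (auto simp: max_def)
    moreover have "indicator A t = (0::real)" using False by (auto simp: A_def)
    ultimately show ?thesis by simp
  qed
  have AEN: "AE t in lborel. t \<notin> N"
    using AE_not_in[of N lebesgue] N by (simp add: negligible_iff_null_sets AE_completion_iff)
  have B: "0 \<le> B" using bd[of 0] by linarith
  have iB: "integrable lborel (\<lambda>t. indicator {0..T} t * B)"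
    by (intro integrable_mult_left integrable_real_indicator) (auto simp: emeasure_lborel_Icc_eq)
  have le0: "(LINT t:{0..T}|lborel. \<zeta> n t * h t) \<le> 0" for n
    by (rule le[OF c\<zeta> \<zeta>01(1) \<zeta>0])
  have [measurable]: "\<zeta> n \<in> borel_measurable borel" for n
    by (rule borel_measurable_continuous_onI[OF c\<zeta>])
  have "(\<lambda>n. LINT t:{0..T}|lborel. \<zeta> n t * h t) \<longlonglongrightarrow> (LINT t:{0..T}|lborel. indicator A t * h t)"
    unfolding set_lebesgue_integral_def
  proof (rule integral_dominated_convergence[where w="\<lambda>t. indicator {0..T} t * B"])
    show "integrable lborel (\<lambda>t. indicator {0..T} t * B)" by (rule iB)
    show "AE t in lborel. (\<lambda>n. indicator {0..T} t *\<^sub>R (\<zeta> n t * h t)) \<longlonglongrightarrow> indicator {0..T} t *\<^sub>R (indicator A t * h t)"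
      using AEN by eventually_elim (intro tendsto_intros lim\<zeta>)
    show "AE t in lborel. norm (indicator {0..T} t *\<^sub>R (\<zeta> n t * h t)) \<le> indicator {0..T} t * B" for n
      using \<zeta>01[of n] bd B by (auto simp: indicator_def abs_mult intro!: AE_I2 mult_mono[of _ 1 _ B, simplified])
  qed measurable
  then have 1: "(LINT t:{0..T}|lborel. indicator A t * h t) \<le> 0"
    using le0 by (intro LIMSEQ_le_const2[where X="\<lambda>n. LINT t:{0..T}|lborel. \<zeta> n t * h t"]) auto
  have int: "integrable lborel (\<lambda>t. indicator {0..T} t *\<^sub>R (indicator A t * h t))"
    by (rule Bochner_Integration.integrable_bound[OF iB])
       (use bd B in \<open>auto split: split_indicator intro!: AE_I2\<close>)
  have "AE t in lborel. indicator {0..T} t *\<^sub>R (indicator A t * h t) = 0"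
  proof (subst integral_nonneg_eq_0_iff_AE[symmetric, OF int])
    show "AE t in lborel. 0 \<le> indicator {0..T} t *\<^sub>R (indicator A t * h t)"
      by (rule AE_I2) (auto simp: indicator_def A_def)
    then have "0 \<le> (LINT t|lborel. indicator {0..T} t *\<^sub>R (indicator A t * h t))"
      by (rule integral_nonneg_AE)
    then show "(LINT t|lborel. indicator {0..T} t *\<^sub>R (indicator A t * h t)) = 0"
      using 1 unfolding set_lebesgue_integral_def by simp
  qed
  moreover have "AE t in lborel. t \<noteq> 0" "AE t in lborel. t \<noteq> T" by (rule AE_lborel_singleton)+
  ultimately show ?thesis
    by eventually_elim (auto simp: A_def indicator_def split: if_splits)
qed

text \<open>Here \<open>w\<close> stands for a jointly Borel version of the vorticity, which may be
  wrong on a null set of times. Hence \<open>Y\<close>, the velocity of the trajectory at every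
  time, is kept apart from \<open>vel (w t) (X t)\<close>, with which it agrees for almost every
  \<open>t\<close>.\<close>

locale transported_vorticity =
  fixes w :: "real \<Rightarrow> complex \<Rightarrow> real" and w0 :: "complex \<Rightarrow> real" and X Y :: "real \<Rightarrow> complex" and C0 :: real
  assumes w_meas: "(\<lambda>p. w (fst p) (snd p)) \<in> borel_measurable borel"
    and vortex: "\<And>t. vortex (w t) C0" and vortex0: "vortex w0 C0"
    and X_cont: "continuous_on UNIV X" and X_0: "X 0 = 0"
    and X_deriv: "\<And>t. 0 \<le> t \<Longrightarrow> (X has_vector_derivative Y t) (at t within {0..})"
    and Y_bound: "\<And>t. 0 \<le> t \<Longrightarrow> norm (Y t) \<le> 4 * pi + C0"
    and Y_vel: "AE t in lborel. 0 \<le> t \<longrightarrow> Y t = vel (w t) (X t)"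
    and weak: "\<And>\<psi>. C1 \<psi> \<Longrightarrow> bounded {p. \<psi> p \<noteq> 0} \<Longrightarrow>
      (LINT t:{0..}|lborel. (LINT z|lborel. w t z * frechet_derivative \<psi> (at (t, z)) (1, vel (w t) z)))
       + (LINT z|lborel. w0 z * \<psi> (0, z)) = 0"
begin

abbreviation "CV \<equiv> 4 * pi + C0"

lemma CV_nonneg: "0 \<le> CV"
  using vortex.C0_nonneg[OF vortex0] pi_gt_zero by (simp add: add_nonneg_nonneg)

lemma w_measurable [measurable (raw)]:
  assumes [measurable]: "f \<in> borel_measurable M" "g \<in> borel_measurable M"
  shows "(\<lambda>x. w (f x) (g x)) \<in> borel_measurable M"
proof -
  have "(\<lambda>x. (f x, g x)) \<in> M \<rightarrow>\<^sub>M borel" by (rule borel_measurable_Pair) measurable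
  from measurable_compose[OF this w_meas] show ?thesis by simp
qed

lemma vel_measurable [measurable (raw)]:
  assumes [measurable]: "f \<in> borel_measurable M" "g \<in> borel_measurable M"
  shows "(\<lambda>x. vel (w (f x)) (g x)) \<in> borel_measurable M"
  unfolding vel_def by measurable

lemma X_measurable [measurable]: "X \<in> borel_measurable borel"
  by (rule borel_measurable_continuous_onI[OF X_cont])

lemma X_lipschitz:
  assumes "0 \<le> s" "0 \<le> t" shows "norm (X s - X t) \<le> CV * \<bar>s - t\<bar>"
proof -
  have "norm (X s - X t) \<le> CV * norm (s - t)"
  proof (rule differentiable_bound[of "{0..}"])
    show "(X has_derivative (\<lambda>h. h *\<^sub>R Y x)) (at x within {0..})" if "x \<in> {0..}" for x
      using X_deriv[of x] that by (simp add: has_vector_derivative_def)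
    show "onorm (\<lambda>h. h *\<^sub>R Y x) \<le> CV" if "x \<in> {0..}" for x
    proof (rule onorm_bound[OF CV_nonneg])
      show "norm (h *\<^sub>R Y x) \<le> CV * norm h" for h
        using mult_right_mono[OF Y_bound[of x], of "\<bar>h\<bar>"] that by (simp add: mult.commute)
    qed
  qed (use assms in auto)
  then show ?thesis by simp
qed

text \<open>The test function \<open>\<psi> (t, z - X t)\<close> is not directly admissible, because
  continuity of \<open>Y\<close> is not among the assumptions. \<open>X\<close> is replaced by its
  forward averages \<open>Xn\<close> over intervals of length \<open>1 / (n + 1)\<close>. These are
  \<open>C1\<close>, their derivatives \<open>Yn\<close> are bounded difference quotients converging
  to \<open>Y\<close>, and dominated convergence gives the limit.\<close>

lemma moving_frame:
  assumes \<psi>: "C1 \<psi>" and supp: "bounded {p. \<psi> p \<noteq> 0}"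
  shows "(LINT t:{0..}|lborel. (LINT z|lborel. w t z * frechet_derivative \<psi> (at (t, z - X t)) (1, vel (w t) z - vel (w t) (X t))))
       + (LINT z|lborel. w0 z * \<psi> (0, z)) = 0"
proof -
  obtain PX where PX: "\<And>t. (PX has_vector_derivative X t) (at t)"
    by (rule ex_antiderivative[OF X_cont]) blast
  define Xn where "Xn n t = real (Suc n) *\<^sub>R (PX (t + 1 / real (Suc n)) - PX t)" for n t
  define Yn where "Yn n t = real (Suc n) *\<^sub>R (X (t + 1 / real (Suc n)) - X t)" for n t
  have shift: "((\<lambda>t. PX (t + c)) has_vector_derivative X (t + c)) (at t)" for t c
    using vector_diff_chain_at[OF has_vector_derivative_add[OF has_vector_derivative_id has_vector_derivative_const] PX, of c t]
    by (simp add: o_def)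
  have dXn: "(Xn n has_vector_derivative Yn n t) (at t)" for n t
    unfolding Xn_def Yn_def
    using bounded_linear.has_vector_derivative[OF bounded_linear_scaleR_right has_vector_derivative_diff[OF shift PX]] .
  have cYn: "continuous_on UNIV (Yn n)" for n
    unfolding Yn_def by (intro continuous_on_scaleR continuous_on_diff continuous_on_const X_cont
       continuous_on_compose2[OF X_cont _ subset_UNIV] continuous_on_add continuous_on_id)
  have C1Xn: "C1 (Xn n)" for n by (rule C1_real[OF dXn cYn])
  \<comment> \<open>The approach is from the right, since at \<open>t = 0\<close> the derivative of
    \<open>X\<close> is one-sided.\<close>
  have seq: "filterlim (\<lambda>n. t + 1 / real (Suc n)) (at t within {t..}) sequentially" for t :: real
  proof -
    have "(\<lambda>n. t + 1 / real (Suc n)) \<longlonglongrightarrow> t + 0"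
      by (intro tendsto_intros LIMSEQ_Suc lim_1_over_n)
    then show ?thesis by (simp add: filterlim_at)
  qed
  have quot: "(\<lambda>n. real (Suc n) *\<^sub>R (f (t + 1 / real (Suc n)) - f t)) \<longlonglongrightarrow> f'"
    if "(f has_vector_derivative f') (at t within {t..})" for f :: "real \<Rightarrow> complex" and f' t
  proof -
    have "((\<lambda>y. (1 / norm (y - t)) *\<^sub>R (f y - (f t + (y - t) *\<^sub>R f'))) \<longlongrightarrow> 0) (at t within {t..})"
      using that unfolding has_vector_derivative_def has_derivative_within by simp
    from filterlim_compose[OF this seq]
    have "(\<lambda>n. real (Suc n) *\<^sub>R (f (t + 1 / real (Suc n)) - f t) - f') \<longlonglongrightarrow> 0"
      by (simp add: scaleR_diff_right scaleR_add_right algebra_simps)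
    then show ?thesis by (simp add: LIM_zero_iff)
  qed
  have Xn_lim: "(\<lambda>n. Xn n t) \<longlonglongrightarrow> X t" for t
    unfolding Xn_def by (rule quot[OF has_vector_derivative_at_within[OF PX]])
  have Yn_lim: "(\<lambda>n. Yn n t) \<longlonglongrightarrow> Y t" if "0 \<le> t" for t
    unfolding Yn_def by (rule quot[OF has_vector_derivative_within_subset[OF X_deriv[OF that]]]) (use that in auto)
  have Yn_le: "norm (Yn n t) \<le> CV" if "0 \<le> t" for n t
  proof -
    have "norm (X (t + 1 / real (Suc n)) - X t) \<le> CV * (1 / real (Suc n))"
      using X_lipschitz[of "t + 1 / real (Suc n)" t] that by simp
    then have "real (Suc n) * norm (X (t + 1 / real (Suc n)) - X t) \<le> real (Suc n) * (CV * (1 / real (Suc n)))"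
      by (intro mult_left_mono) auto
    then show ?thesis unfolding Yn_def by simp
  qed
  define \<phi> where "\<phi> n p = \<psi> (fst p, snd p - Xn n (fst p))" for n and p :: "real \<times> complex"
  have C1g: "C1 (\<lambda>p::real\<times>complex. (fst p, snd p - Xn n (fst p)))" for n
    by (intro C1_Pair C1_diff C1_compose[OF C1Xn] C1_linear bounded_linear_fst bounded_linear_snd)
  have C1\<phi>: "C1 (\<phi> n)" for n
    unfolding \<phi>_def by (rule C1_compose[OF \<psi> C1g])
  have d\<phi>: "frechet_derivative (\<phi> n) (at (t, z)) (1, u) = frechet_derivative \<psi> (at (t, z - Xn n t)) (1, u - Yn n t)" for n t z u
  proof -
    have "((\<lambda>p::real\<times>complex. Xn n (fst p)) has_derivative (\<lambda>h. fst h *\<^sub>R Yn n t)) (at (t,z))"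
      using has_derivative_compose[OF bounded_linear_imp_has_derivative[OF bounded_linear_fst], of "Xn n" _ "(t,z)"] dXn[of n t]
      unfolding has_vector_derivative_def by simp
    then have "((\<lambda>p::real\<times>complex. (fst p, snd p - Xn n (fst p))) has_derivative (\<lambda>h. (fst h, snd h - fst h *\<^sub>R Yn n t))) (at (t,z))"
      by (intro has_derivative_Pair has_derivative_diff bounded_linear_imp_has_derivative bounded_linear_fst bounded_linear_snd)
    from has_derivative_compose[OF this C1D[OF \<psi>]]
    have "(\<phi> n has_derivative (\<lambda>h. frechet_derivative \<psi> (at (t, z - Xn n t)) (fst h, snd h - fst h *\<^sub>R Yn n t))) (at (t,z))"
      unfolding \<phi>_def by simp
    from fun_cong[OF frechet_derivative_at[OF this], of "(1,u)"] show ?thesis by simp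
  qed
  obtain R where R: "\<And>p. \<psi> p \<noteq> 0 \<Longrightarrow> norm p < R"
    using supp unfolding bounded_pos_less by auto
  then have R0: "\<And>p. R \<le> norm p \<Longrightarrow> \<psi> p = 0" by force
  obtain B where B: "1 \<le> B" "\<And>p. norm (\<psi> p) \<le> B" "\<And>p v. norm (frechet_derivative \<psi> (at p) v) \<le> B * norm v"
    using C1_compact_support_bound[OF \<psi> R0] by metis
  have time: "frechet_derivative \<psi> (at (t, z)) v = 0" if "R < t" for t z v
    using that norm_fst_le[of t z] by (intro frechet_derivative_outside[OF R0]) auto
  have supp\<phi>: "bounded {p. \<phi> n p \<noteq> 0}" for n
  proof -
    have "bounded (Xn n ` {- R..R})"
      by (intro compact_imp_bounded compact_continuous_image C1_continuous[OF C1Xn]) auto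
    then obtain M where M: "\<forall>x\<in>Xn n ` {- R..R}. norm x \<le> M" unfolding bounded_iff by blast
    have "norm p \<le> R + (R + M)" if "\<phi> n p \<noteq> 0" for p
    proof -
      obtain t z where p: "p = (t, z)" by (cases p)
      have "norm (t, z - Xn n t) < R" using R that unfolding \<phi>_def p by simp
      then have "\<bar>t\<bar> \<le> R" "norm (z - Xn n t) \<le> R"
        using norm_fst_le[of t "z - Xn n t"] norm_snd_le[of "z - Xn n t" t] by auto
      moreover have "t \<in> {- R..R}" using \<open>\<bar>t\<bar> \<le> R\<close> by auto
      then have "norm (Xn n t) \<le> M" using M by blast
      moreover have "norm z \<le> norm (z - Xn n t) + norm (Xn n t)" using norm_triangle_sub[of z "Xn n t"] by simp
      ultimately show ?thesis unfolding p using norm_Pair_le[of t z] by simp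
    qed
    then show ?thesis unfolding bounded_iff by auto
  qed
  define G where "G n t z = w t z * frechet_derivative \<psi> (at (t, z - Xn n t)) (1, vel (w t) z - Yn n t)" for n t z
  define G' where "G' t z = w t z * frechet_derivative \<psi> (at (t, z - X t)) (1, vel (w t) z - vel (w t) (X t))" for t z
  define K where "K = B * (1 + 2 * CV)"
  have K0: "0 \<le> K" using B(1) CV_nonneg by (simp add: K_def)
  have weak_n: "(LINT t:{0..}|lborel. (LINT z|lborel. G n t z)) + (LINT z|lborel. w0 z * \<phi> n (0, z)) = 0" for n
    using weak[OF C1\<phi> supp\<phi>, of n] unfolding d\<phi> G_def .
  have Gle: "norm (G n t z) \<le> w t z * K" if "0 \<le> t" for n t z
  proof -
    have "norm (1::real, vel (w t) z - Yn n t) \<le> 1 + (CV + CV)"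
      using norm_Pair_le[of "1::real" "vel (w t) z - Yn n t"] norm_triangle_ineq4[of "vel (w t) z" "Yn n t"]
        vortex.norm_vel_le[OF vortex, of t z] Yn_le[OF that, of n] by simp
    then have "norm (frechet_derivative \<psi> (at (t, z - Xn n t)) (1, vel (w t) z - Yn n t)) \<le> K"
      unfolding K_def using B(1) by (intro order_trans[OF B(3)] mult_left_mono) auto
    then show ?thesis unfolding G_def norm_mult
      using vortex.bounds[OF vortex, of t z] by (simp add: mult_left_mono)
  qed
  have wint: "integrable lborel (\<lambda>z. w t z * K)" for t
    using vortex.integrable[OF vortex] by simp
  have [measurable]: "Xn n \<in> borel_measurable borel" "Yn n \<in> borel_measurable borel" for n
    by (auto intro!: borel_measurable_continuous_onI cYn C1_continuous[OF C1Xn])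
  have Gm: "(\<lambda>q. G n (fst q) (snd q)) \<in> borel_measurable (borel \<Otimes>\<^sub>M borel)" for n
    unfolding G_def by (intro borel_measurable_times w_measurable borel_measurable_frechet[OF \<psi>]) measurable
  have Gm1: "G n t \<in> borel_measurable lborel" for n t
    unfolding G_def by (intro borel_measurable_times w_measurable borel_measurable_frechet[OF \<psi>]) measurable
  have G'm1: "G' t \<in> borel_measurable lborel" for t
    unfolding G'_def by (intro borel_measurable_times w_measurable borel_measurable_frechet[OF \<psi>]) measurable
  have inner: "(\<lambda>n. LINT z|lborel. G n t z) \<longlonglongrightarrow> (LINT z|lborel. G' t z)"
    if "0 \<le> t" "Y t = vel (w t) (X t)" for t
  proof (rule integral_dominated_convergence[where w="\<lambda>z. w t z * K", OF G'm1 Gm1 wint])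
    have "continuous_on UNIV (\<lambda>q::(real \<times> complex) \<times> (real \<times> complex). frechet_derivative \<psi> (at (fst q)) (snd q))"
      by (intro C1_continuous_derivative[OF \<psi>] continuous_intros)
    then have cont: "isCont (\<lambda>q::(real \<times> complex) \<times> (real \<times> complex). frechet_derivative \<psi> (at (fst q)) (snd q)) q" for q
      using continuous_on_eq_continuous_at[OF open_UNIV] by blast
    have "(\<lambda>n. (\<lambda>q. frechet_derivative \<psi> (at (fst q)) (snd q)) ((t, z - Xn n t), (1, vel (w t) z - Yn n t)))
       \<longlonglongrightarrow> (\<lambda>q. frechet_derivative \<psi> (at (fst q)) (snd q)) ((t, z - X t), (1, vel (w t) z - Y t))" for z
      by (rule isCont_tendsto_compose[OF cont]) (intro tendsto_intros Xn_lim Yn_lim that)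
    then show "AE z in lborel. (\<lambda>n. G n t z) \<longlonglongrightarrow> G' t z"
      unfolding G_def G'_def that(2)[symmetric] fst_conv snd_conv by (intro AE_I2 tendsto_mult tendsto_const)
    show "AE z in lborel. norm (G n t z) \<le> w t z * K" for n
      using Gle[OF that(1)] by auto
  qed
  have outer: "(\<lambda>n. LINT t:{0..}|lborel. (LINT z|lborel. G n t z)) \<longlonglongrightarrow> (LINT t:{0..}|lborel. (LINT z|lborel. G' t z))"
    unfolding set_lebesgue_integral_def
  proof (rule integral_dominated_convergence[where w="\<lambda>t. indicator {0..R} t * (K * C0)"])
    show "integrable lborel (\<lambda>t. indicator {0..R} t * (K * C0))"
      by (intro integrable_mult_left integrable_real_indicator) (auto simp: emeasure_lborel_Icc_eq)
    show "AE t in lborel. (\<lambda>n. indicator {0..} t *\<^sub>R (LINT z|lborel. G n t z)) \<longlonglongrightarrow> indicator {0..} t *\<^sub>R (LINT z|lborel. G' t z)"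
      using Y_vel by eventually_elim (auto split: split_indicator intro: inner)
    show "AE t in lborel. norm (indicator {0..} t *\<^sub>R (LINT z|lborel. G n t z)) \<le> indicator {0..R} t * (K * C0)" for n
    proof (rule AE_I2)
      fix t :: real
      show "norm (indicator {0..} t *\<^sub>R (LINT z|lborel. G n t z)) \<le> indicator {0..R} t * (K * C0)"
      proof (cases "0 \<le> t \<and> t \<le> R")
        case True
        have i: "integrable lborel (G n t)"
          by (rule Bochner_Integration.integrable_bound[OF wint[of t] Gm1])
             (use True in \<open>auto intro!: AE_I2 order_trans[OF Gle[unfolded real_norm_def] abs_ge_self]\<close>)
        have "norm (LINT z|lborel. G n t z) \<le> (LINT z|lborel. w t z * K)"
          by (rule order_trans[OF integral_norm_bound integral_mono[OF integrable_norm[OF i] wint]])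
             (use True Gle in auto)
        also have "\<dots> \<le> K * C0"
          using mult_left_mono[OF vortex.mass[OF vortex, of t] K0] by (simp add: mult.commute)
        finally show ?thesis using True by simp
      next
        case False
        then show ?thesis by (auto simp: G_def time indicator_def)
      qed
    qed
    have "(\<lambda>t. LINT z|lborel. G n t z) \<in> borel_measurable borel" for n
      using Gm[of n] by (intro lborel.borel_measurable_lebesgue_integral) (simp add: split_beta cong: measurable_cong_sets)
    then show "(\<lambda>t. indicator {0..} t *\<^sub>R (LINT z|lborel. G n t z)) \<in> borel_measurable lborel" for n
      by simp
    have "(\<lambda>q. G' (fst q) (snd q)) \<in> borel_measurable (borel \<Otimes>\<^sub>M borel)"
      unfolding G'_def by (intro borel_measurable_times w_measurable borel_measurable_frechet[OF \<psi>]) measurable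
    then have "(\<lambda>t. LINT z|lborel. G' t z) \<in> borel_measurable borel"
      by (intro lborel.borel_measurable_lebesgue_integral) (simp add: split_beta cong: measurable_cong_sets)
    then show "(\<lambda>t. indicator {0..} t *\<^sub>R (LINT z|lborel. G' t z)) \<in> borel_measurable lborel"
      by simp
  qed
  have init: "(\<lambda>n. LINT z|lborel. w0 z * \<phi> n (0, z)) \<longlonglongrightarrow> (LINT z|lborel. w0 z * \<psi> (0, z))"
  proof (rule integral_dominated_convergence[where w="\<lambda>z. w0 z * B"])
    have [measurable]: "w0 \<in> borel_measurable borel" by (rule vortex.meas[OF vortex0])
    have [measurable]: "\<psi> \<in> borel_measurable borel" "\<phi> n \<in> borel_measurable borel" for n
      by (auto intro!: borel_measurable_continuous_onI C1_continuous \<psi> C1\<phi>)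
    show "(\<lambda>z. w0 z * \<psi> (0, z)) \<in> borel_measurable lborel" "(\<lambda>z. w0 z * \<phi> n (0, z)) \<in> borel_measurable lborel" for n
      by measurable
    show "integrable lborel (\<lambda>z. w0 z * B)" using vortex.integrable[OF vortex0] by simp
    have cont: "isCont \<psi> p" for p
      using C1_continuous[OF \<psi>, of UNIV] continuous_on_eq_continuous_at[OF open_UNIV] by blast
    have "(\<lambda>n. \<psi> (0, z - Xn n 0)) \<longlonglongrightarrow> \<psi> (0, z - X 0)" for z
      by (rule isCont_tendsto_compose[OF cont]) (intro tendsto_intros Xn_lim)
    then show "AE z in lborel. (\<lambda>n. w0 z * \<phi> n (0, z)) \<longlonglongrightarrow> w0 z * \<psi> (0, z)"
      unfolding \<phi>_def fst_conv snd_conv X_0 diff_zero by (intro AE_I2 tendsto_mult tendsto_const)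
    show "AE z in lborel. norm (w0 z * \<phi> n (0, z)) \<le> w0 z * B" for n
      using B(2) vortex.bounds[OF vortex0] by (auto simp: \<phi>_def abs_mult intro!: AE_I2 mult_left_mono)
  qed
  have "(\<lambda>n. 0 :: real) \<longlonglongrightarrow> (LINT t:{0..}|lborel. (LINT z|lborel. G' t z)) + (LINT z|lborel. w0 z * \<psi> (0, z))"
    using tendsto_add[OF outer init] by (simp only: weak_n)
  then have "(LINT t:{0..}|lborel. (LINT z|lborel. G' t z)) + (LINT z|lborel. w0 z * \<psi> (0, z)) = 0"
    by (rule LIMSEQ_unique[OF _ tendsto_const])
  then show ?thesis unfolding G'_def .
qed

text \<open>A crude bound, uniform in time, that justifies splitting and dominating the integrals in
  the next lemma.\<close>

lemma moving_average_derivative_bound: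
  assumes \<psi>: "C1 \<psi>" and B: "\<And>p v. norm (frechet_derivative \<psi> (at p) v) \<le> B * norm v" "0 \<le> B"
  shows "integrable lborel (\<lambda>z. w t z * frechet_derivative \<psi> (at (t, z - X t)) (1, vel (w t) z - vel (w t) (X t)))"
    and "\<bar>LINT z|lborel. w t z * frechet_derivative \<psi> (at (t, z - X t)) (1, vel (w t) z - vel (w t) (X t))\<bar> \<le> B * (1 + 2 * CV) * C0"
proof -
  have 1: "norm (frechet_derivative \<psi> (at (t, z - X t)) (1, vel (w t) z - vel (w t) (X t))) \<le> B * (1 + 2 * CV)" for z
  proof -
    have "norm (1::real, vel (w t) z - vel (w t) (X t)) \<le> 1 + (CV + CV)"
      using norm_Pair_le[of "1::real" "vel (w t) z - vel (w t) (X t)"] norm_triangle_ineq4[of "vel (w t) z" "vel (w t) (X t)"]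
        vortex.norm_vel_le[OF vortex, of t z] vortex.norm_vel_le[OF vortex, of t "X t"] by simp
    then show ?thesis using B(2) by (intro order_trans[OF B(1)] mult_left_mono) auto
  qed
  have m: "(\<lambda>z. frechet_derivative \<psi> (at (t, z - X t)) (1, vel (w t) z - vel (w t) (X t))) \<in> borel_measurable borel"
    by (intro borel_measurable_frechet[OF \<psi>]) measurable
  from vortex.integrable_times_bounded[OF vortex m 1, of t]
  show "integrable lborel (\<lambda>z. w t z * frechet_derivative \<psi> (at (t, z - X t)) (1, vel (w t) z - vel (w t) (X t)))"
    and "\<bar>LINT z|lborel. w t z * frechet_derivative \<psi> (at (t, z - X t)) (1, vel (w t) z - vel (w t) (X t))\<bar> \<le> B * (1 + 2 * CV) * C0"
    by auto
qed

text \<open>The weak formulation is tested with \<open>\<eta> t * \<psi>\<close>, where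
  \<open>\<eta> t\<close> is the integral of a nonnegative weight \<open>\<zeta>\<close> from
  \<open>t\<close> to \<open>T\<close>. As \<open>\<eta>' = - \<zeta>\<close> and
  \<open>0 \<le> \<eta> \<le> Z T\<close> on \<open>{0..T}\<close>, the increment of the average,
  integrated against \<open>\<zeta>\<close>, is at most \<open>T * G\<close> times the total weight.
  Since \<open>\<zeta>\<close> is arbitrary, the bound holds for almost every time.\<close>

lemma moving_average_upper:
  assumes \<psi>: "C1 \<psi>" and supp: "bounded {p. \<psi> p \<noteq> 0}" and T: "0 < T"
    and G: "AE t in lborel. t \<in> {0..T} \<longrightarrow>
       (LINT z|lborel. w t z * frechet_derivative \<psi> (at (t, z - X t)) (1, vel (w t) z - vel (w t) (X t))) \<le> G"
    and G0: "0 \<le> G"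
  shows "AE t in lborel. t \<in> {0..T} \<longrightarrow>
       (LINT z|lborel. w t z * \<psi> (t, z - X t)) - (LINT z|lborel. w0 z * \<psi> (0, z)) \<le> T * G"
proof -
  define f where "f t = (LINT z|lborel. w t z * \<psi> (t, z - X t))" for t
  define f0 where "f0 = (LINT z|lborel. w0 z * \<psi> (0, z))"
  define g where "g t = (LINT z|lborel. w t z * frechet_derivative \<psi> (at (t, z - X t)) (1, vel (w t) z - vel (w t) (X t)))" for t
  obtain R where "\<And>p. \<psi> p \<noteq> 0 \<Longrightarrow> norm p < R"
    using supp unfolding bounded_pos_less by auto
  then have R0: "\<And>p. R \<le> norm p \<Longrightarrow> \<psi> p = 0" by force
  obtain B where B: "1 \<le> B" "\<And>p. norm (\<psi> p) \<le> B" "\<And>p v. norm (frechet_derivative \<psi> (at p) v) \<le> B * norm v"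
    using C1_compact_support_bound[OF \<psi> R0] by metis
  have B0: "0 \<le> B" using B(1) by simp
  have [measurable]: "\<psi> \<in> borel_measurable borel" by (intro borel_measurable_continuous_onI C1_continuous \<psi>)
  have \<psi>m: "(\<lambda>z. \<psi> (t, z - X t)) \<in> borel_measurable borel" for t by measurable
  note fi = vortex.integrable_times_bounded[OF vortex \<psi>m B(2), simplified]
  note gi = moving_average_derivative_bound[OF \<psi> B(3) B0]
  have [measurable]: "f \<in> borel_measurable borel" unfolding f_def by measurable
  have "(\<lambda>q. w (fst q) (snd q) * frechet_derivative \<psi> (at (fst q, snd q - X (fst q))) (1, vel (w (fst q)) (snd q) - vel (w (fst q)) (X (fst q)))) \<in> borel_measurable (borel \<Otimes>\<^sub>M borel)"
    by (intro borel_measurable_times w_measurable borel_measurable_frechet[OF \<psi>]) measurable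
  then have [measurable]: "g \<in> borel_measurable borel"
    unfolding g_def by (intro lborel.borel_measurable_lebesgue_integral) (simp add: split_beta cong: measurable_cong_sets)
  have fB: "\<bar>f t\<bar> \<le> B * C0" for t unfolding f_def using fi(2) by simp
  have gB: "\<bar>g t\<bar> \<le> B * (1 + 2 * CV) * C0" for t unfolding g_def using gi(2) by simp
  have "AE t in lborel. t \<in> {0..T} \<longrightarrow> f t - f0 - T * G \<le> 0"
  proof (rule AE_nonpos_if_weighted_integrals_nonpos)
    show "(\<lambda>t. f t - f0 - T * G) \<in> borel_measurable borel" by measurable
    show "\<bar>f t - f0 - T * G\<bar> \<le> B * C0 + \<bar>f0\<bar> + T * G" for t
      using fB[of t] G0 T mult_nonneg_nonneg[of T G] by linarith
    fix \<zeta> :: "real \<Rightarrow> real"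
    assume c\<zeta>: "continuous_on UNIV \<zeta>" and \<zeta>: "\<And>t. 0 \<le> \<zeta> t" "\<And>t. t \<notin> {0..T} \<Longrightarrow> \<zeta> t = 0"
    obtain Z where Z: "\<And>t. (Z has_vector_derivative \<zeta> t) (at t)" and Z0: "Z 0 = 0"
      by (rule ex_antiderivative[OF c\<zeta>]) blast
    have Zd: "(Z has_real_derivative \<zeta> t) (at t)" for t
      using Z by (simp add: has_real_derivative_iff_has_vector_derivative)
    have Zmono: "Z s \<le> Z t" if "s \<le> t" for s t
      by (rule DERIV_nonneg_imp_nondecreasing[OF that]) (use Zd \<zeta>(1) in blast)
    have ZT: "Z t = Z T" if "T \<le> t" for t
    proof -
      have "(\<zeta> has_integral Z t - Z T) {T..t}"
        by (rule fundamental_theorem_of_calculus[OF that has_vector_derivative_at_within[OF Z]])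
      moreover have "(\<zeta> has_integral 0) {T..t}"
        by (rule has_integral_spike_finite[of "{T}" _ _ "\<lambda>x. 0"]) (use \<zeta>(2) in auto)
      ultimately have "Z t - Z T = 0" by (rule has_integral_unique)
      then show ?thesis by simp
    qed
    \<comment> \<open>The \<open>ramp\<close> factor is 1 for \<open>t \<ge> 0\<close> and vanishes
      for \<open>t \<le> -1\<close>, which confines the weight to bounded times.\<close>
    define \<eta> where "\<eta> t = (Z T - Z t) * ramp (3 * t + 4)" for t
    have C1\<eta>: "C1 \<eta>"
      unfolding \<eta>_def
      by (intro C1_mult C1_diff C1_const C1_real[OF Z c\<zeta>] C1_compose[OF C1_ramp] C1_add C1_linear
          bounded_linear_mult_right bounded_linear_ident)
    have \<eta>eq: "\<eta> t = Z T - Z t" if "0 \<le> t" for t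
      using that by (simp add: \<eta>_def ramp_1)
    have \<eta>0: "\<eta> t = 0" if "t \<notin> {-1..T}" for t
      using that ZT[of t] by (auto simp: \<eta>_def ramp_0)
    have d\<eta>: "(\<eta> has_derivative (\<lambda>h. - \<zeta> t * h)) (at t)" if "0 < t" for t
    proof (rule has_derivative_transform_within_open)
      have "((\<lambda>t. Z T - Z t) has_real_derivative 0 - \<zeta> t) (at t)"
        by (intro DERIV_diff DERIV_const Zd)
      then show "((\<lambda>t. Z T - Z t) has_derivative (\<lambda>h. - \<zeta> t * h)) (at t)"
        unfolding has_field_derivative_def diff_0 .
      show "open {0::real<..}" "t \<in> {0<..}" using that by auto
      show "Z T - Z x = \<eta> x" if "x \<in> {0<..}" for x using that \<eta>eq[of x] by simp
    qed
    define \<psi>' where "\<psi>' p = \<eta> (fst p) * \<psi> p" for p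
    have C1\<psi>': "C1 \<psi>'"
      unfolding \<psi>'_def by (intro C1_mult \<psi> C1_compose[OF C1\<eta>] C1_linear bounded_linear_fst)
    have supp': "bounded {p. \<psi>' p \<noteq> 0}"
      by (rule bounded_subset[OF supp]) (auto simp: \<psi>'_def)
    have d\<psi>': "frechet_derivative \<psi>' (at (t, z)) (1, u) = - \<zeta> t * \<psi> (t, z) + (Z T - Z t) * frechet_derivative \<psi> (at (t, z)) (1, u)"
      if "0 < t" for t z u
    proof -
      have "((\<lambda>p::real\<times>complex. \<eta> (fst p)) has_derivative (\<lambda>h. - \<zeta> t * fst h)) (at (t,z))"
        using has_derivative_compose[OF bounded_linear_imp_has_derivative[OF bounded_linear_fst], of \<eta> _ "(t,z)"] d\<eta>[OF that] by simp
      from has_derivative_mult[OF this C1D[OF \<psi>]]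
      have "(\<psi>' has_derivative (\<lambda>h. \<eta> t * frechet_derivative \<psi> (at (t,z)) h + (- \<zeta> t * fst h) * \<psi> (t,z))) (at (t,z))"
        unfolding \<psi>'_def by simp
      from fun_cong[OF frechet_derivative_at[OF this], of "(1,u)"] show ?thesis
        using that by (simp add: \<eta>eq)
    qed
    have inner: "(LINT z|lborel. w t z * frechet_derivative \<psi>' (at (t, z - X t)) (1, vel (w t) z - vel (w t) (X t)))
       = - \<zeta> t * f t + (Z T - Z t) * g t" if "0 < t" for t
    proof -
      have "(LINT z|lborel. w t z * frechet_derivative \<psi>' (at (t, z - X t)) (1, vel (w t) z - vel (w t) (X t)))
        = (LINT z|lborel. - \<zeta> t * (w t z * \<psi> (t, z - X t)) + (Z T - Z t) * (w t z * frechet_derivative \<psi> (at (t, z - X t)) (1, vel (w t) z - vel (w t) (X t))))"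
        unfolding d\<psi>'[OF that] by (simp add: algebra_simps)
      also have "\<dots> = (LINT z|lborel. - \<zeta> t * (w t z * \<psi> (t, z - X t))) + (LINT z|lborel. (Z T - Z t) * (w t z * frechet_derivative \<psi> (at (t, z - X t)) (1, vel (w t) z - vel (w t) (X t))))"
        by (intro Bochner_Integration.integral_add integrable_mult_right fi gi)
      also have "\<dots> = - \<zeta> t * f t + (Z T - Z t) * g t"
        unfolding f_def g_def by simp
      finally show ?thesis .
    qed
    have [measurable]: "\<zeta> \<in> borel_measurable borel" "Z \<in> borel_measurable borel"
      by (intro borel_measurable_continuous_onI c\<zeta> C1_continuous C1_real[OF Z c\<zeta>])+
    have \<zeta>i: "set_integrable lborel {0..T} \<zeta>"
      by (rule borel_integrable_atLeastAtMost'[OF continuous_on_subset[OF c\<zeta>]]) auto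
    have \<zeta>Z: "(LINT t:{0..T}|lborel. \<zeta> t) = Z T"
      using set_borel_integral_eq_integral(2)[OF \<zeta>i] integral_eq_antiderivative[OF Z, of 0 T] T Z0 by simp
    have \<zeta>fi: "set_integrable lborel {0..T} (\<lambda>t. \<zeta> t * f t)"
      unfolding set_integrable_def
    proof (rule Bochner_Integration.integrable_bound[OF integrable_mult_left[OF \<zeta>i[unfolded set_integrable_def], of "B * C0"]])
      show "AE t in lborel. norm (indicator {0..T} t *\<^sub>R (\<zeta> t * f t)) \<le> norm (indicator {0..T} t *\<^sub>R \<zeta> t * (B * C0))"
        using fB \<zeta>(1) order_trans[OF fB abs_ge_self] by (auto intro!: AE_I2 mult_left_mono split: split_indicator simp: abs_mult)
    qed measurable
    have c1: "integrable lborel (\<lambda>t. indicator {0..T} t * c)" for c :: real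
      by (intro integrable_mult_left integrable_real_indicator) (auto simp: emeasure_lborel_Icc_eq)
    have Zb: "0 \<le> Z T - Z t \<and> Z T - Z t \<le> Z T" if "t \<in> {0..T}" for t
      using Zmono[of 0 t] Zmono[of t T] Z0 that by auto
    have gi2: "set_integrable lborel {0..T} (\<lambda>t. (Z T - Z t) * g t)"
      unfolding set_integrable_def
    proof (rule Bochner_Integration.integrable_bound[OF c1[of "Z T * (B * (1 + 2 * CV) * C0)"]])
      have "\<bar>(Z T - Z t) * g t\<bar> \<le> \<bar>Z T * (B * (1 + 2 * CV) * C0)\<bar>" if "t \<in> {0..T}" for t
      proof -
        have "\<bar>(Z T - Z t) * g t\<bar> \<le> Z T * (B * (1 + 2 * CV) * C0)"
          unfolding abs_mult using Zb[OF that] gB[of t] by (intro mult_mono) auto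
        then show ?thesis by linarith
      qed
      then show "AE t in lborel. norm (indicator {0..T} t *\<^sub>R ((Z T - Z t) * g t)) \<le> norm (indicator {0..T} t * (Z T * (B * (1 + 2 * CV) * C0)))"
        by (auto intro!: AE_I2 split: split_indicator)
    qed measurable
    \<comment> \<open>Time 0 is excluded because the derivative of \<open>\<eta>\<close> is computed
      for positive times; beyond \<open>T\<close> both \<open>\<zeta> t\<close> and
      \<open>Z T - Z t\<close> vanish.\<close>
    have "AE t in lborel. t \<noteq> (0::real)" by (rule AE_lborel_singleton)
    then have eq: "(LINT t:{0..}|lborel. (LINT z|lborel. w t z * frechet_derivative \<psi>' (at (t, z - X t)) (1, vel (w t) z - vel (w t) (X t))))
      = (LINT t:{0..T}|lborel. - (\<zeta> t * f t) + (Z T - Z t) * g t)"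
      unfolding set_lebesgue_integral_def
    proof (intro integral_cong_AE)
      have "(\<lambda>q. w (fst q) (snd q) * frechet_derivative \<psi>' (at (fst q, snd q - X (fst q))) (1, vel (w (fst q)) (snd q) - vel (w (fst q)) (X (fst q)))) \<in> borel_measurable (borel \<Otimes>\<^sub>M borel)"
        by (intro borel_measurable_times w_measurable borel_measurable_frechet[OF C1\<psi>']) measurable
      then have "(\<lambda>t. LINT z|lborel. w t z * frechet_derivative \<psi>' (at (t, z - X t)) (1, vel (w t) z - vel (w t) (X t))) \<in> borel_measurable borel"
        by (intro lborel.borel_measurable_lebesgue_integral) (simp add: split_beta cong: measurable_cong_sets)
      then show "(\<lambda>t. indicator {0..} t *\<^sub>R (LINT z|lborel. w t z * frechet_derivative \<psi>' (at (t, z - X t)) (1, vel (w t) z - vel (w t) (X t)))) \<in> borel_measurable lborel"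
        by simp
      show "(\<lambda>t. indicator {0..T} t *\<^sub>R (- (\<zeta> t * f t) + (Z T - Z t) * g t)) \<in> borel_measurable lborel"
        by measurable
      assume "AE t in lborel. t \<noteq> (0::real)"
      then show "AE t in lborel. indicator {0..} t *\<^sub>R (LINT z|lborel. w t z * frechet_derivative \<psi>' (at (t, z - X t)) (1, vel (w t) z - vel (w t) (X t)))
        = indicator {0..T} t *\<^sub>R (- (\<zeta> t * f t) + (Z T - Z t) * g t)"
      proof eventually_elim
        fix t :: real assume "t \<noteq> 0"
        then consider "t < 0" | "0 < t" "t \<le> T" | "T < t" "0 < t" using T by linarith
        then show "indicator {0..} t *\<^sub>R (LINT z|lborel. w t z * frechet_derivative \<psi>' (at (t, z - X t)) (1, vel (w t) z - vel (w t) (X t)))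
        = indicator {0..T} t *\<^sub>R (- (\<zeta> t * f t) + (Z T - Z t) * g t)"
          using inner[of t] ZT[of t] \<zeta>(2)[of t] by cases auto
      qed
    qed
    have "(LINT t:{0..T}|lborel. - (\<zeta> t * f t) + (Z T - Z t) * g t) + Z T * f0 = 0"
      using moving_frame[OF C1\<psi>' supp'] unfolding eq
      by (simp add: \<psi>'_def \<eta>eq Z0 f0_def mult.left_commute)
    moreover have "(LINT t:{0..T}|lborel. - (\<zeta> t * f t) + (Z T - Z t) * g t)
       = - (LINT t:{0..T}|lborel. \<zeta> t * f t) + (LINT t:{0..T}|lborel. (Z T - Z t) * g t)"
      using set_integral_diff(2)[OF gi2 \<zeta>fi] by simp
    moreover have "(LINT t:{0..T}|lborel. (Z T - Z t) * g t) \<le> (LINT t:{0..T}|lborel. Z T * G)"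
      unfolding set_lebesgue_integral_def
    proof (rule integral_mono_AE[OF gi2[unfolded set_integrable_def]])
      show "integrable lborel (\<lambda>t. indicator {0..T} t *\<^sub>R (Z T * G))" using c1[of "Z T * G"] by simp
      show "AE t in lborel. indicator {0..T} t *\<^sub>R ((Z T - Z t) * g t) \<le> indicator {0..T} t *\<^sub>R (Z T * G)"
        using G unfolding g_def[symmetric]
      proof eventually_elim
        fix t assume *: "t \<in> {0..T} \<longrightarrow> g t \<le> G"
        show "indicator {0..T} t *\<^sub>R ((Z T - Z t) * g t) \<le> indicator {0..T} t *\<^sub>R (Z T * G)"
        proof (cases "t \<in> {0..T}")
          case True
          have "(Z T - Z t) * g t \<le> (Z T - Z t) * G"
            using * True Zb[OF True] by (intro mult_left_mono) auto
          also have "\<dots> \<le> Z T * G" using Zb[OF True] G0 by (intro mult_right_mono) auto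
          finally show ?thesis using True by simp
        qed simp
      qed
    qed
    moreover have "(LINT t:{0..T}|lborel. Z T * G) = T * (Z T * G)"
      using T by (simp add: set_lebesgue_integral_def)
    moreover have "(LINT t:{0..T}|lborel. \<zeta> t * (f t - f0 - T * G)) = (LINT t:{0..T}|lborel. \<zeta> t * f t) - (f0 + T * G) * Z T"
    proof -
      have "(LINT t:{0..T}|lborel. \<zeta> t * (f t - f0 - T * G)) = (LINT t:{0..T}|lborel. \<zeta> t * f t - (f0 + T * G) * \<zeta> t)"
        by (simp add: algebra_simps)
      also have "\<dots> = (LINT t:{0..T}|lborel. \<zeta> t * f t) - (LINT t:{0..T}|lborel. (f0 + T * G) * \<zeta> t)"
        by (rule set_integral_diff(2)[OF \<zeta>fi set_integrable_mult_right[OF \<zeta>i]])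
      also have "(LINT t:{0..T}|lborel. (f0 + T * G) * \<zeta> t) = (f0 + T * G) * Z T"
        unfolding set_integral_mult_right \<zeta>Z ..
      finally show ?thesis .
    qed
    moreover have "(f0 + T * G) * Z T = Z T * f0 + T * (Z T * G)" by (simp add: algebra_simps)
    ultimately show "(LINT t:{0..T}|lborel. \<zeta> t * (f t - f0 - T * G)) \<le> 0"
      by linarith
  qed
  then show ?thesis unfolding f_def f0_def by eventually_elim auto
qed

text \<open>The one-sided estimate is applied to \<open>\<psi>\<close> and to
  \<open>- \<psi>\<close>.\<close>

theorem moving_average_evolution:
  assumes \<psi>: "C1 \<psi>" and supp: "bounded {p. \<psi> p \<noteq> 0}" and T: "0 < T"
    and G: "AE t in lborel. t \<in> {0..T} \<longrightarrow>
       \<bar>LINT z|lborel. w t z * frechet_derivative \<psi> (at (t, z - X t)) (1, vel (w t) z - vel (w t) (X t))\<bar> \<le> G"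
    and G0: "0 \<le> G"
  shows "AE t in lborel. t \<in> {0..T} \<longrightarrow>
       \<bar>(LINT z|lborel. w t z * \<psi> (t, z - X t)) - (LINT z|lborel. w0 z * \<psi> (0, z))\<bar> \<le> T * G"
proof -
  have C1m: "C1 (\<lambda>p. - \<psi> p)" using C1_diff[OF C1_const[of 0] \<psi>] by simp
  have dm: "frechet_derivative (\<lambda>p. - \<psi> p) (at p) v = - frechet_derivative \<psi> (at p) v" for p v
    using frechet_derivative_at[OF has_derivative_minus[OF C1D[OF \<psi>, of p]]] by (rule fun_cong[symmetric])
  have suppm: "bounded {p. - \<psi> p \<noteq> 0}" using supp by simp
  have "AE t in lborel. t \<in> {0..T} \<longrightarrow>
       (LINT z|lborel. w t z * frechet_derivative \<psi> (at (t, z - X t)) (1, vel (w t) z - vel (w t) (X t))) \<le> G"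
    using G by (rule AE_mp) (intro AE_I2, simp add: abs_le_iff)
  note 1 = moving_average_upper[OF \<psi> supp T this G0]
  have "AE t in lborel. t \<in> {0..T} \<longrightarrow>
       (LINT z|lborel. w t z * frechet_derivative (\<lambda>p. - \<psi> p) (at (t, z - X t)) (1, vel (w t) z - vel (w t) (X t))) \<le> G"
    using G unfolding dm by (rule AE_mp) (intro AE_I2, simp add: abs_le_iff)
  note 2 = moving_average_upper[OF C1m suppm T this G0]
  show ?thesis
    using 1 2 by eventually_elim (simp add: abs_le_iff)
qed

end

section \<open>Recursion over the dyadic scales\<close>

text \<open>The solution together with the model: the assumptions on the frame and its coefficients
  are those provided by \<open>ex_corner_model\<close>, and \<open>corner\<close> is the corner
  condition in integral form, normalised by \<open>r^2\<close> instead of the area of the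
  disc.\<close>

locale corner_evolution = transported_vorticity w w0 X Y C0
  for w :: "real \<Rightarrow> complex \<Rightarrow> real" and w0 X Y C0 +
  fixes \<alpha> \<beta> :: real and e1 e2 m a a' :: "real \<Rightarrow> complex" and r1 r2 \<theta> A :: "real \<Rightarrow> real"
  assumes e1: "\<And>s. (e1 has_vector_derivative m s * cnj (e1 s)) (at s)"
    and e2: "\<And>s. (e2 has_vector_derivative m s * cnj (e2 s)) (at s)"
    and m_cont: "continuous_on UNIV m"
    and e_det: "\<And>s. Im (cnj (e1 s) * e2 s) = 1"
    and e1_polar: "\<And>s. e1 s = r1 s * cis (\<theta> s)" and e2_polar: "\<And>s. e2 s = r2 s * cis (\<theta> s + A s)"
    and r_pos: "\<And>s. 0 < r1 s" "\<And>s. 0 < r2 s" and A_bounds: "\<And>s. 0 < A s" "\<And>s. A s < pi"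
    and init: "\<theta> 0 = \<beta>" "A 0 = \<alpha>" and A_cont: "continuous_on UNIV A"
    and a_eq: "\<And>s. a s = (cis (2 * \<theta> s) - cis (2 * (\<theta> s + A s))) / (4 * pi)"
    and m_mean: "\<And>s. ((\<lambda>s. s * m s) has_vector_derivative a s) (at s)"
    and a_deriv: "\<And>s. (a has_vector_derivative a' s) (at s)" and a'_cont: "continuous_on UNIV a'"
    and A_small: "\<And>\<delta>. 0 < \<delta> \<Longrightarrow> \<exists>s>0. A s < \<delta>"
    and corner: "((\<lambda>r. (LINT z|lborel. indicator (ball 0 r) z * \<bar>w0 z - indicator (wedge \<beta> \<alpha>) z\<bar>) / r\<^sup>2) \<longlongrightarrow> 0) (at_right 0)"
begin

text \<open>The source time is the second argument: points at model time \<open>s\<close> are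
  carried to model time \<open>s'\<close>.\<close>

definition flow :: "real \<Rightarrow> real \<Rightarrow> complex \<Rightarrow> complex" where
  "flow s' s = frame_map (e1 s) (e2 s) (e1 s') (e2 s')"

text \<open>\<open>coeff i t\<close> is the coefficient of \<open>cnj h\<close> in the expansion of the velocity at distance \<open>2\<^sup>-\<^sup>i\<close> from \<open>X t\<close>.
  Under the limiting dynamics, \<open>i\<close> shells act during time \<open>t\<close>, which is the model time \<open>shell_mass * i * t\<close>.\<close>

definition coeff :: "nat \<Rightarrow> real \<Rightarrow> complex" where
  "coeff i t = vortex.far_coeff (w t) (2 ^ i) (X t)"

definition model_coeff :: "nat \<Rightarrow> real \<Rightarrow> complex" where
  "model_coeff i t = (shell_mass * i) * m (shell_mass * i * t)"

lemma e_cont: "continuous_on S e1" "continuous_on S e2"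
  by (intro continuous_at_imp_continuous_on ballI has_vector_derivative_continuous[OF e1]
      has_vector_derivative_continuous[OF e2])+

lemma C1_e: "C1 e1" "C1 e2"
  by (rule C1_real[OF e1], intro continuous_on_mult m_cont continuous_on_cnj e_cont)
     (rule C1_real[OF e2], intro continuous_on_mult m_cont continuous_on_cnj e_cont)

lemma flow_inverse: "flow s s' (flow s' s z) = z"
  unfolding flow_def by (rule frame_map_inverse[OF e_det e_det])

lemma flow_same: "flow s s z = z"
  unfolding flow_def by (rule frame_map_id[OF e_det])

lemma bounded_linear_flow: "bounded_linear (flow s' s)"
  unfolding flow_def by (rule bounded_linear_frame_map)

lemma C1_flow: "C1 (\<lambda>p. flow s' (c * fst p) (snd p))"
proof -
  have t: "C1 (\<lambda>p::real \<times> complex. c * fst p)"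
    by (rule C1_linear[OF bounded_linear_compose[OF bounded_linear_mult_right bounded_linear_fst]])
  have z: "C1 (\<lambda>p::real \<times> complex. snd p)" by (rule C1_linear[OF bounded_linear_snd])
  have "C1 (\<lambda>p. complex_of_real (Im (cnj (snd p) * e2 (c * fst p))) * e1 s' + complex_of_real (Im (cnj (e1 (c * fst p)) * snd p)) * e2 s')"
    by (intro C1_add C1_mult C1_const C1_bounded_linear_compose[OF bounded_linear_of_real]
        C1_bounded_linear_compose[OF bounded_linear_Im] C1_bounded_linear_compose[OF bounded_linear_cnj]
        C1_compose[OF C1_e(1) t] C1_compose[OF C1_e(2) t] z)
  then show ?thesis unfolding flow_def frame_map_def scaleR_conv_of_real .
qed

text \<open>In direction \<open>(1, u)\<close> only the excess of \<open>u\<close> over the model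
  velocity remains. The reason is that \<open>cnj z * m * cnj e\<close> and
  \<open>cnj (m * cnj z) * e\<close> are complex conjugates, so their imaginary parts are
  opposite.\<close>

lemma flow_derivative:
  "((\<lambda>p. flow s' (c * fst p) (snd p)) has_derivative
     (\<lambda>h. flow s' (c * t) (snd h - (c * fst h) *\<^sub>R (m (c * t) * cnj z)))) (at (t, z))"
proof -
  have ed: "((\<lambda>p::real \<times> complex. e (c * fst p)) has_derivative (\<lambda>h. (c * fst h) *\<^sub>R (m (c * t) * cnj (e (c * t))))) (at (t, z))"
    if "(e has_vector_derivative m (c * t) * cnj (e (c * t))) (at (c * t))" for e
  proof -
    have "((\<lambda>p::real \<times> complex. c * fst p) has_derivative (\<lambda>h. c * fst h)) (at (t, z))"
      by (rule bounded_linear_imp_has_derivative[OF bounded_linear_compose[OF bounded_linear_mult_right bounded_linear_fst]])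
    from has_derivative_compose[OF this, of e] that show ?thesis
      unfolding has_vector_derivative_def by simp
  qed
  note d = ed[OF e1] ed[OF e2]
  have s: "((\<lambda>p::real \<times> complex. snd p) has_derivative (\<lambda>h. snd h)) (at (t, z))"
    by (rule bounded_linear_imp_has_derivative[OF bounded_linear_snd])
  let ?E1 = "e1 (c * t)" and ?E2 = "e2 (c * t)" and ?m = "m (c * t)"
  have H: "((\<lambda>p. Im (cnj (snd p) * e2 (c * fst p)) *\<^sub>R e1 s' + Im (cnj (e1 (c * fst p)) * snd p) *\<^sub>R e2 s') has_derivative
    (\<lambda>h. Im (cnj z * ((c * fst h) *\<^sub>R (?m * cnj ?E2)) + cnj (snd h) * ?E2) *\<^sub>R e1 s'
       + Im (cnj ?E1 * snd h + cnj ((c * fst h) *\<^sub>R (?m * cnj ?E1)) * z) *\<^sub>R e2 s')) (at (t, z))"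
    using has_derivative_add[OF
        has_derivative_scaleR_left[OF bounded_linear.has_derivative[OF bounded_linear_Im has_derivative_mult[OF bounded_linear.has_derivative[OF bounded_linear_cnj s] d(2)]]]
        has_derivative_scaleR_left[OF bounded_linear.has_derivative[OF bounded_linear_Im has_derivative_mult[OF bounded_linear.has_derivative[OF bounded_linear_cnj d(1)] s]]],
        of "e1 s'" "e2 s'"]
    by simp
  have eqs: "Im (cnj z * (k *\<^sub>R (M * cnj E2)) + cnj u * E2) = Im (cnj (u - k *\<^sub>R (M * cnj z)) * E2)"
    "Im (cnj E1 * u + cnj (k *\<^sub>R (M * cnj E1)) * z) = Im (cnj E1 * (u - k *\<^sub>R (M * cnj z)))" for k M E1 E2 u
    by (simp_all add: algebra_simps)
  show ?thesis using H unfolding eqs flow_def frame_map_def .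
qed

text \<open>Doubling the resolution adds exactly one shell. Real and imaginary part are written as
  separate integrals because the transport estimates concern real test functions.\<close>

lemma coeff_Suc:
  "coeff (Suc i) t = coeff i t + Complex (4 ^ i * (LINT z|lborel. w t z * Re (shell_strain (2 ^ i *\<^sub>R (z - X t)))))
     (4 ^ i * (LINT z|lborel. w t z * Im (shell_strain (2 ^ i *\<^sub>R (z - X t)))))"
proof -
  interpret v: vortex "w t" C0 by (rule vortex)
  have i: "integrable lborel (\<lambda>y. complex_of_real (w t y) * ((2 ^ k)\<^sup>2 * far_strain (2 ^ k *\<^sub>R (y - X t))))" for k
    using norm_far_strain_le
    by (intro v.integrable_times_bounded(1)[where B="(2 ^ k)\<^sup>2"] v.far_strain_borel[of "2^k", simplified])
     (simp add: norm_mult norm_power mult_left_le)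
  have eq: "complex_of_real (w t y) * ((2 ^ Suc i)\<^sup>2 * far_strain (2 ^ Suc i *\<^sub>R (y - X t))) - complex_of_real (w t y) * ((2 ^ i)\<^sup>2 * far_strain (2 ^ i *\<^sub>R (y - X t)))
     = 4 ^ i * (complex_of_real (w t y) * shell_strain (2 ^ i *\<^sub>R (y - X t)))" for y
  proof -
    have "2 ^ Suc i *\<^sub>R (y - X t) = 2 * (2 ^ i *\<^sub>R (y - X t))" by (simp add: scaleR_conv_of_real)
    moreover have "k * ((2 ^ Suc i)\<^sup>2 * F) - k * ((2 ^ i)\<^sup>2 * G) = 4 ^ i * (k * (4 * F - G))" for k F G :: complex
    proof -
      have "(2::complex) ^ i * 2 ^ i = 4 ^ i" by (simp flip: power_mult_distrib)
      then show ?thesis by (simp add: algebra_simps power2_eq_square)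
    qed
    ultimately show ?thesis by (simp only: shell_strain_def)
  qed
  have si: "integrable lborel (\<lambda>y. complex_of_real (w t y) * shell_strain (2 ^ i *\<^sub>R (y - X t)))"
    using integrable_mult_right[OF Bochner_Integration.integrable_diff[OF i[of "Suc i"] i[of i]], of "1 / 4 ^ i"] unfolding eq by simp
  have "coeff (Suc i) t - coeff i t = 4 ^ i * (LINT y|lborel. complex_of_real (w t y) * shell_strain (2 ^ i *\<^sub>R (y - X t)))"
    unfolding coeff_def v.far_coeff_def of_real_power of_real_numeral
    by (subst Bochner_Integration.integral_diff[symmetric, OF i i]) (simp only: eq, simp)
  also have "\<dots> = Complex (4 ^ i * (LINT z|lborel. w t z * Re (shell_strain (2 ^ i *\<^sub>R (z - X t)))))
     (4 ^ i * (LINT z|lborel. w t z * Im (shell_strain (2 ^ i *\<^sub>R (z - X t)))))"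
  proof -
    define I where "I = (LINT y|lborel. complex_of_real (w t y) * shell_strain (2 ^ i *\<^sub>R (y - X t)))"
    have r: "Re I = (LINT z|lborel. w t z * Re (shell_strain (2 ^ i *\<^sub>R (z - X t))))"
      "Im I = (LINT z|lborel. w t z * Im (shell_strain (2 ^ i *\<^sub>R (z - X t))))"
      unfolding I_def integral_Re[OF si, symmetric] integral_Im[OF si, symmetric]
      by (simp_all only: complex.sel times_complex.sel Re_complex_of_real Im_complex_of_real mult_zero_left diff_zero add_0_right)
    have "4 ^ i * I = complex_of_real (4 ^ i) * I" by simp
    then have "Re (4 ^ i * I) = 4 ^ i * Re I" "Im (4 ^ i * I) = 4 ^ i * Im I"
      by (simp_all only: times_complex.sel Re_complex_of_real Im_complex_of_real mult_zero_left diff_zero add_0_right)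
    then show ?thesis unfolding I_def[symmetric] r[symmetric] by (rule complex_eqI[of _ "Complex _ _", unfolded complex.sel])
  qed
  finally show ?thesis by (simp add: algebra_simps)
qed

lemma norm_coeff_0: "norm (coeff 0 t) \<le> C0"
  using vortex.norm_far_coeff_le[OF vortex, of t 1 "X t"] by (simp add: coeff_def)

end

section \<open>Transport at one scale, up to a bounded model time\<close>

text \<open>The bound also covers a nonintegrable \<open>f\<close>, whose integral is 0 by
  default.\<close>

lemma abs_integral_le:
  fixes f g :: "'a \<Rightarrow> real"
  assumes g: "integrable M g" and le: "\<And>x. \<bar>f x\<bar> \<le> g x"
  shows "\<bar>integral\<^sup>L M f\<bar> \<le> integral\<^sup>L M g"
proof (cases "integrable M f")
  case True
  have "\<bar>integral\<^sup>L M f\<bar> \<le> (\<integral>x. \<bar>f x\<bar> \<partial>M)" by (rule integral_abs_bound)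
  also have "\<dots> \<le> integral\<^sup>L M g"
    by (rule integral_mono[OF integrable_abs[OF True] g le])
  finally show ?thesis .
next
  case False
  have "0 \<le> integral\<^sup>L M g"
    by (rule Bochner_Integration.integral_nonneg) (use le abs_ge_zero order_trans in blast)
  then show ?thesis using not_integrable_integral_eq[OF False] by simp
qed

lemma integrable_indicator_ball: "integrable lborel (indicator (ball (c::complex) r) :: complex \<Rightarrow> real)"
  using emeasure_lborel_ball_finite[of c r] by (intro integrable_real_indicator) simp_all

lemma integral_indicator_ball: "0 \<le> r \<Longrightarrow> (LINT z|lborel. indicator (ball (c::complex) r) z) = pi * r\<^sup>2"
  by (simp add: measure_def emeasure_ball_complex)

text \<open>Fixes a horizon \<open>S\<close> of model time and a bound \<open>K\<close> for the
  frame vectors up to it. The constants of the following estimates may depend on these but not on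
  the scale.\<close>

locale corner_evolution_bounded = corner_evolution +
  fixes S K :: real
  assumes S_pos: "0 < S" and K_ge: "1 \<le> K"
    and K_bound: "\<And>s. 0 \<le> s \<Longrightarrow> s \<le> S \<Longrightarrow> norm (e1 s) \<le> K" "\<And>s. 0 \<le> s \<Longrightarrow> s \<le> S \<Longrightarrow> norm (e2 s) \<le> K"
begin

text \<open>A model flow between times in \<open>{0..S}\<close> expands lengths by at most
  \<open>2 * K^2\<close>, and the test functions vanish beyond radius 2. Their pullbacks therefore
  live within radius \<open>4 * K^2 < R\<close>, in units of \<open>2^-i\<close>.\<close>

definition R :: real where "R = 1 + 4 * K\<^sup>2"

definition CR :: real where "CR = 24 * pi * R + 4 * pi * R ^ 3"

text \<open>Deviation of the initial patch from its tangent sector on the disc that matters at scale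
  \<open>i\<close>, in units of the squared length \<open>4^-i\<close>.\<close>

definition eps :: "nat \<Rightarrow> real" where
  "eps i = 4 ^ i * (LINT z|lborel. indicator (ball 0 (R / 2 ^ i)) z * \<bar>w0 z - indicator (wedge \<beta> \<alpha>) z\<bar>)"

lemma R_ge: "1 \<le> R" by (simp add: R_def)

lemma CR_nonneg: "0 \<le> CR" unfolding CR_def using R_ge by simp

lemma norm_flow_le:
  assumes "0 \<le> s" "s \<le> S" "0 \<le> s'" "s' \<le> S"
  shows "norm (flow s' s z) \<le> 2 * K\<^sup>2 * norm z"
  unfolding flow_def by (intro norm_frame_map_le K_bound assms)

lemma flow_support:
  assumes s: "0 \<le> s" "s \<le> S" "0 \<le> s'" "s' \<le> S" and le: "norm (2 ^ i *\<^sub>R flow s' s x) \<le> 2"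
  shows "norm x < R / 2 ^ i"
proof -
  have "norm x = norm (flow s s' (flow s' s x))" by (simp add: flow_inverse)
  also have "\<dots> \<le> 2 * K\<^sup>2 * norm (flow s' s x)" by (rule norm_flow_le[OF s(3,4,1,2)])
  also have "norm (flow s' s x) \<le> 2 / 2 ^ i" using le by (simp add: field_simps)
  also have "2 * K\<^sup>2 * (2 / 2 ^ i) < R / 2 ^ i" by (simp add: R_def divide_strict_right_mono)
  finally show ?thesis by (simp add: mult_left_mono)
qed

text \<open>On the support the excess velocity is at most \<open>(CR + R * M) / 2^i\<close>:
  \<open>CR\<close> comes from the expansion of the velocity, \<open>R * M\<close> from the error of
  the coefficient. The derivative of the rescaled test function contributes \<open>2^i\<close>, so
  the bound does not deteriorate with the scale.\<close>

lemma derivative_estimate: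
  assumes B: "\<And>z v. norm (frechet_derivative \<xi> (at z) v) \<le> B * norm v" "0 \<le> B"
    and \<xi>0: "\<And>z. 2 \<le> norm z \<Longrightarrow> \<xi> z = (0::real)"
    and t: "0 \<le> t" "shell_mass * i * t \<le> S" and s': "0 \<le> s'" "s' \<le> S"
    and M: "norm (coeff i t - model_coeff i t) \<le> M"
  shows "\<bar>frechet_derivative \<xi> (at (2 ^ i *\<^sub>R flow s' (shell_mass * i * t) x))
     (2 ^ i *\<^sub>R flow s' (shell_mass * i * t) (vel (w t) (X t + x) - vel (w t) (X t) - model_coeff i t * cnj x))\<bar>
    \<le> (B * (2 * K\<^sup>2) * (CR + R * M)) * indicator (ball 0 (R / 2 ^ i)) x"
proof -
  let ?s = "shell_mass * i * t"
  have s: "0 \<le> ?s" using t shell_mass_pos by simp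
  have M0: "0 \<le> M" using M norm_ge_zero order_trans by blast
  show ?thesis
  proof (cases "norm (2 ^ i *\<^sub>R flow s' ?s x) \<le> 2")
    case False
    then have "frechet_derivative \<xi> (at (2 ^ i *\<^sub>R flow s' ?s x)) v = 0" for v
      by (intro frechet_derivative_outside[OF \<xi>0]) auto
    then show ?thesis using B(2) CR_nonneg R_ge M0 by simp
  next
    case True
    have x: "norm x < R / 2 ^ i" by (rule flow_support[OF s t(2) s' True])
    define u where "u = vel (w t) (X t + x) - vel (w t) (X t) - model_coeff i t * cnj x"
    have "u = (vel (w t) (X t + x) - vel (w t) (X t) - coeff i t * cnj x) + (coeff i t - model_coeff i t) * cnj x"
      by (simp add: u_def algebra_simps)
    then have "norm u \<le> norm (vel (w t) (X t + x) - vel (w t) (X t) - coeff i t * cnj x) + norm ((coeff i t - model_coeff i t) * cnj x)"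
      by (metis norm_triangle_ineq)
    also have "\<dots> \<le> CR / 2 ^ i + M * (R / 2 ^ i)"
    proof (rule add_mono)
      show "norm (vel (w t) (X t + x) - vel (w t) (X t) - coeff i t * cnj x) \<le> CR / 2 ^ i"
        unfolding coeff_def CR_def by (rule vortex.vel_expansion[OF vortex]) (use x R_ge in auto)
      show "norm ((coeff i t - model_coeff i t) * cnj x) \<le> M * (R / 2 ^ i)"
        unfolding norm_mult using M x M0 by (intro mult_mono) auto
    qed
    finally have u: "norm u \<le> (CR + R * M) / 2 ^ i" by (simp add: add_divide_distrib mult.commute)
    have "\<bar>frechet_derivative \<xi> (at (2 ^ i *\<^sub>R flow s' ?s x)) (2 ^ i *\<^sub>R flow s' ?s u)\<bar> \<le> B * norm (2 ^ i *\<^sub>R flow s' ?s u)"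
      by (rule B(1)[unfolded real_norm_def])
    also have "\<dots> \<le> B * (2 ^ i * (2 * K\<^sup>2 * ((CR + R * M) / 2 ^ i)))"
    proof (rule mult_left_mono[OF _ B(2)])
      have "norm (flow s' ?s u) \<le> 2 * K\<^sup>2 * ((CR + R * M) / 2 ^ i)"
        by (rule order_trans[OF norm_flow_le[OF s t(2) s'] mult_left_mono[OF u]]) simp
      from mult_left_mono[OF this, of "2 ^ i"]
      show "norm (2 ^ i *\<^sub>R flow s' ?s u) \<le> 2 ^ i * (2 * K\<^sup>2 * ((CR + R * M) / 2 ^ i))" by simp
    qed
    also have "\<dots> = B * (2 * K\<^sup>2) * (CR + R * M)" by simp
    finally show ?thesis using x unfolding u_def by simp
  qed
qed

text \<open>At time \<open>t\<close> the test function is \<open>\<xi>\<close> composed with the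
  model flow from the current model time to the fixed time \<open>s'\<close>. Its average along the
  solution changes only through the excess velocity. At \<open>t = 0\<close> it becomes an average
  of the initial patch deformed up to time \<open>s'\<close>.\<close>

lemma transport_estimate:
  assumes \<xi>: "C1 \<xi>" and B: "\<And>z v. norm (frechet_derivative \<xi> (at z) v) \<le> B * norm v" "0 \<le> B"
    and \<xi>0: "\<And>z. 2 \<le> norm z \<Longrightarrow> \<xi> z = (0::real)"
    and T: "0 < T" "shell_mass * i * T \<le> S" and s': "0 \<le> s'" "s' \<le> S" and M0: "0 \<le> M"
    and M: "AE t in lborel. t \<in> {0..T} \<longrightarrow> norm (coeff i t - model_coeff i t) \<le> M"
  shows "AE t in lborel. t \<in> {0..T} \<longrightarrow>
    \<bar>(LINT z|lborel. w t z * \<xi> (2 ^ i *\<^sub>R flow s' (shell_mass * i * t) (z - X t)))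
      - (LINT z|lborel. w0 z * \<xi> (2 ^ i *\<^sub>R flow s' 0 z))\<bar>
    \<le> T * ((B * (2 * K\<^sup>2) * (CR + R * M)) * (pi * (R / 2 ^ i)\<^sup>2))"
proof -
  define c where "c = shell_mass * i"
  have c0: "0 \<le> c" using shell_mass_pos by (simp add: c_def)
  \<comment> \<open>Time cutoff equal to 1 on \<open>{0..T}\<close> and to 0 before
    \<open>-1\<close> and after \<open>T + 1\<close>; it gives compact support in
    space-time.\<close>
  define \<sigma> where "\<sigma> t = ramp (3 * t + 4) * ramp (4 + 3 * (T - t))" for t
  have C1\<sigma>: "C1 \<sigma>"
    unfolding \<sigma>_def
    by (intro C1_mult C1_compose[OF C1_ramp] C1_add C1_diff C1_const C1_linear bounded_linear_mult_right bounded_linear_ident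
        C1_compose[OF C1_linear[OF bounded_linear_mult_right]])
  have \<sigma>1: "\<sigma> t = 1" if "0 \<le> t" "t \<le> T" for t using that by (simp add: \<sigma>_def ramp_1)
  have \<sigma>0: "\<sigma> t = 0" if "\<bar>t\<bar> > T + 1" for t
    using that T(1) by (cases "0 \<le> t") (auto simp: \<sigma>_def ramp_0)
  define h where "h p = 2 ^ i *\<^sub>R flow s' (c * fst p) (snd p)" for p :: "real \<times> complex"
  define \<psi> where "\<psi> p = \<sigma> (fst p) * \<xi> (h p)" for p
  have C1h: "C1 h" unfolding h_def by (rule C1_bounded_linear_compose[OF bounded_linear_scaleR_right C1_flow])
  have C1\<psi>: "C1 \<psi>"
    unfolding \<psi>_def by (intro C1_mult C1_compose[OF C1\<sigma>] C1_linear bounded_linear_fst C1_compose[OF \<xi> C1h])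
  have dh: "(h has_derivative (\<lambda>k. 2 ^ i *\<^sub>R flow s' (c * t) (snd k - (c * fst k) *\<^sub>R (m (c * t) * cnj z)))) (at (t, z))" for t z
    unfolding h_def by (rule bounded_linear.has_derivative[OF bounded_linear_scaleR_right flow_derivative])
  have d\<psi>: "frechet_derivative \<psi> (at (t, z)) (1, u) =
      frechet_derivative \<xi> (at (2 ^ i *\<^sub>R flow s' (c * t) z)) (2 ^ i *\<^sub>R flow s' (c * t) (u - model_coeff i t * cnj z))"
    if t: "0 < t" "t < T" for t z u
  proof -
    have "(\<psi> has_derivative (\<lambda>k. frechet_derivative \<xi> (at (h (t, z))) (2 ^ i *\<^sub>R flow s' (c * t) (snd k - (c * fst k) *\<^sub>R (m (c * t) * cnj z))))) (at (t, z))"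
    proof (rule has_derivative_transform_within_open[OF has_derivative_compose[OF dh C1D[OF \<xi>]]])
      show "open ({0<..<T} \<times> (UNIV :: complex set))" by (intro open_Times) auto
      show "(t, z) \<in> {0<..<T} \<times> UNIV" using t by simp
      show "\<xi> (h p) = \<psi> p" if "p \<in> {0<..<T} \<times> UNIV" for p
        using that by (auto simp: \<psi>_def \<sigma>1)
    qed
    from fun_cong[OF frechet_derivative_at[OF this], of "(1, u)"] show ?thesis
      by (simp add: h_def model_coeff_def c_def scaleR_conv_of_real mult.assoc)
  qed
  have supp: "bounded {p. \<psi> p \<noteq> 0}"
  proof -
    \<comment> \<open>The support of \<open>\<sigma>\<close> exceeds the times for which
      \<open>K\<close> bounds the frame, so a new bound is taken from compactness.\<close>
    have cc: "compact ((\<lambda>t. norm (e1 (c * t)) + norm (e2 (c * t))) ` {- (T + 1)..T + 1})"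
      by (intro compact_continuous_image continuous_on_add continuous_on_norm compact_Icc
          continuous_on_compose2[OF e_cont(1) _ subset_UNIV] continuous_on_compose2[OF e_cont(2) _ subset_UNIV]
          continuous_on_mult_left continuous_on_id)
    from compact_imp_bounded[OF cc]
    obtain k where k: "\<forall>x\<in>(\<lambda>t. norm (e1 (c * t)) + norm (e2 (c * t))) ` {- (T + 1)..T + 1}. norm x \<le> k"
      unfolding bounded_iff by blast
    define Q where "Q = max k K"
    have p: "norm p \<le> (T + 1) + 2 * Q\<^sup>2 * 2" if "\<psi> p \<noteq> 0" for p
    proof -
      obtain t z where p: "p = (t, z)" by (cases p)
      have nz: "\<sigma> t \<noteq> 0" "\<xi> (h p) \<noteq> 0" using that by (auto simp: \<psi>_def p)
      then have t: "\<bar>t\<bar> \<le> T + 1" using \<sigma>0[of t] by linarith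
      then have "t \<in> {- (T + 1)..T + 1}" by auto
      then have "norm (norm (e1 (c * t)) + norm (e2 (c * t))) \<le> k" using k by blast
      then have "norm (e1 (c * t)) + norm (e2 (c * t)) \<le> k" by simp
      then have "norm (e1 (c * t)) \<le> k" "norm (e2 (c * t)) \<le> k"
        using norm_ge_zero[of "e1 (c * t)"] norm_ge_zero[of "e2 (c * t)"] by linarith+
      then have q: "norm (e1 (c * t)) \<le> Q" "norm (e2 (c * t)) \<le> Q" unfolding Q_def by linarith+
      have q': "norm (e1 s') \<le> Q" "norm (e2 s') \<le> Q" using K_bound[OF s'] by (auto simp: Q_def)
      have "norm (h p) < 2" using nz(2) \<xi>0[of "h p"] by linarith
      moreover have "norm (flow s' (c * t) z) \<le> norm (h p)"
        unfolding h_def p by (simp add: mult_le_cancel_right1)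
      ultimately have f: "norm (flow s' (c * t) z) \<le> 2" by linarith
      have "norm z = norm (flow (c * t) s' (flow s' (c * t) z))" by (simp add: flow_inverse)
      also have "\<dots> \<le> 2 * Q\<^sup>2 * norm (flow s' (c * t) z)"
        unfolding flow_def[of "c * t"] by (rule norm_frame_map_le[OF q' q])
      also have "\<dots> \<le> 2 * Q\<^sup>2 * 2" using f by (intro mult_left_mono) auto
      finally show ?thesis unfolding p using norm_Pair_le[of t z] t by simp
    qed
    then show ?thesis unfolding bounded_iff by blast
  qed
  define G where "G = (B * (2 * K\<^sup>2) * (CR + R * M)) * (pi * (R / 2 ^ i)\<^sup>2)"
  have P0: "0 \<le> B * (2 * K\<^sup>2) * (CR + R * M)" using B(2) CR_nonneg R_ge M0 by simp
  have G0: "0 \<le> G" unfolding G_def using P0 by simp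
  \<comment> \<open>The endpoints are removed because the derivative of \<open>\<psi>\<close> is
    computed on the open interval.\<close>
  have "AE t in lborel. t \<noteq> (0::real)" "AE t in lborel. t \<noteq> T" by (rule AE_lborel_singleton)+
  with M have "AE t in lborel. t \<in> {0..T} \<longrightarrow>
       \<bar>LINT z|lborel. w t z * frechet_derivative \<psi> (at (t, z - X t)) (1, vel (w t) z - vel (w t) (X t))\<bar> \<le> G"
  proof eventually_elim
    fix t assume t: "t \<in> {0..T} \<longrightarrow> norm (coeff i t - model_coeff i t) \<le> M" "t \<noteq> 0" "t \<noteq> T"
    show "t \<in> {0..T} \<longrightarrow> \<bar>LINT z|lborel. w t z * frechet_derivative \<psi> (at (t, z - X t)) (1, vel (w t) z - vel (w t) (X t))\<bar> \<le> G"
    proof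
      assume "t \<in> {0..T}"
      then have t': "0 < t" "t < T" "norm (coeff i t - model_coeff i t) \<le> M" using t by auto
      have "shell_mass * i * t \<le> shell_mass * i * T"
        using t' shell_mass_pos by (intro mult_left_mono) auto
      then have ts: "shell_mass * i * t \<le> S" using T(2) by linarith
      have "\<bar>LINT z|lborel. w t z * frechet_derivative \<psi> (at (t, z - X t)) (1, vel (w t) z - vel (w t) (X t))\<bar>
        \<le> (LINT z|lborel. (B * (2 * K\<^sup>2) * (CR + R * M)) * indicator (ball (X t) (R / 2 ^ i)) z)"
      proof (rule abs_integral_le)
        show "integrable lborel (\<lambda>z. (B * (2 * K\<^sup>2) * (CR + R * M)) * indicator (ball (X t) (R / 2 ^ i)) z)"
          by (intro integrable_mult_right integrable_indicator_ball)
        fix z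
        have "\<bar>frechet_derivative \<psi> (at (t, z - X t)) (1, vel (w t) z - vel (w t) (X t))\<bar>
          \<le> (B * (2 * K\<^sup>2) * (CR + R * M)) * indicator (ball 0 (R / 2 ^ i)) (z - X t)"
          using derivative_estimate[OF B \<xi>0 less_imp_le[OF t'(1)] ts s' t'(3), of "z - X t"]
          unfolding d\<psi>[OF t'(1,2)] c_def by simp
        then have "\<bar>w t z\<bar> * \<bar>frechet_derivative \<psi> (at (t, z - X t)) (1, vel (w t) z - vel (w t) (X t))\<bar>
          \<le> 1 * ((B * (2 * K\<^sup>2) * (CR + R * M)) * indicator (ball 0 (R / 2 ^ i)) (z - X t))"
          by (intro mult_mono vortex.abs_w[OF vortex]) auto
        moreover have "indicator (ball 0 (R / 2 ^ i)) (z - X t) = (indicator (ball (X t) (R / 2 ^ i)) z :: real)"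
          by (auto simp: indicator_def dist_norm norm_minus_commute)
        ultimately show "\<bar>w t z * frechet_derivative \<psi> (at (t, z - X t)) (1, vel (w t) z - vel (w t) (X t))\<bar>
          \<le> (B * (2 * K\<^sup>2) * (CR + R * M)) * indicator (ball (X t) (R / 2 ^ i)) z"
          by (simp add: abs_mult)
      qed
      also have "\<dots> = (B * (2 * K\<^sup>2) * (CR + R * M)) * (LINT z|lborel. indicator (ball (X t) (R / 2 ^ i)) z)"
        by (rule integral_mult_right_zero)
      also have "0 \<le> R / 2 ^ i" using R_ge by simp
      from integral_indicator_ball[OF this, of "X t"]
      have "(B * (2 * K\<^sup>2) * (CR + R * M)) * (LINT z|lborel. indicator (ball (X t) (R / 2 ^ i)) z) = G"
        unfolding G_def by (rule arg_cong)
      finally show "\<bar>LINT z|lborel. w t z * frechet_derivative \<psi> (at (t, z - X t)) (1, vel (w t) z - vel (w t) (X t))\<bar> \<le> G" .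
    qed
  qed
  from moving_average_evolution[OF C1\<psi> supp T(1) this G0]
  show ?thesis
  proof eventually_elim
    fix t assume *: "t \<in> {0..T} \<longrightarrow> \<bar>(LINT z|lborel. w t z * \<psi> (t, z - X t)) - (LINT z|lborel. w0 z * \<psi> (0, z))\<bar> \<le> T * G"
    have "\<psi> (0, z) = \<xi> (2 ^ i *\<^sub>R flow s' 0 z)" for z using T by (simp add: \<psi>_def h_def \<sigma>1)
    moreover have "\<psi> (t, z) = \<xi> (2 ^ i *\<^sub>R flow s' (shell_mass * i * t) z)" if "t \<in> {0..T}" for z
      using that by (simp add: \<psi>_def h_def \<sigma>1 c_def)
    ultimately show "t \<in> {0..T} \<longrightarrow>
      \<bar>(LINT z|lborel. w t z * \<xi> (2 ^ i *\<^sub>R flow s' (shell_mass * i * t) (z - X t)))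
        - (LINT z|lborel. w0 z * \<xi> (2 ^ i *\<^sub>R flow s' 0 z))\<bar>
      \<le> T * ((B * (2 * K\<^sup>2) * (CR + R * M)) * (pi * (R / 2 ^ i)\<^sup>2))"
      using * unfolding G_def by simp
  qed
qed

end

section \<open>The recursion for the error of the coefficient\<close>

lemma has_vector_derivative_bound:
  fixes f :: "real \<Rightarrow> 'a::real_normed_vector"
  assumes d: "\<And>x. (f has_vector_derivative f' x) (at x)" and le: "\<And>x. p \<le> x \<Longrightarrow> x \<le> q \<Longrightarrow> norm (f' x) \<le> B" and pq: "p \<le> q"
  shows "norm (f q - f p) \<le> B * (q - p)"
proof -
  have B: "0 \<le> B" using le[of p] pq norm_ge_zero order_trans by blast
  have "norm (f q - f p) \<le> B * norm (q - p)"
  proof (rule differentiable_bound[of "{p..q}"])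
    show "(f has_derivative (\<lambda>h. h *\<^sub>R f' x)) (at x within {p..q})" for x
      using has_vector_derivative_at_within[OF d] by (simp add: has_vector_derivative_def)
    show "onorm (\<lambda>h. h *\<^sub>R f' x) \<le> B" if "x \<in> {p..q}" for x
    proof (rule onorm_bound[OF B])
      show "norm (h *\<^sub>R f' x) \<le> B * norm h" for h
        using mult_right_mono[OF le[of x], of "\<bar>h\<bar>"] that by (simp add: mult.commute)
    qed
  qed (use pq in auto)
  then show ?thesis using pq by simp
qed

lemma AE_obtain_in_interval:
  fixes a b :: real
  assumes "AE t in lborel. P t" "a < b"
  obtains t where "a < t" "t < b" "P t"
proof -
  have "\<exists>t. a < t \<and> t < b \<and> P t"
  proof (rule ccontr)
    assume n: "\<not> ?thesis"
    have "AE t in lborel. t \<notin> {a<..<b}" using assms(1) by eventually_elim (use n in auto)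
    then have "emeasure lborel {a<..<b} = 0"
      using AE_iff_measurable[of "{a<..<b}" lborel "\<lambda>t. t \<notin> {a<..<b}"]
      by (simp add: greaterThanLessThan_def greaterThan_def lessThan_def Collect_conj_eq)
    then show False using assms(2) by simp
  qed
  then show thesis using that by blast
qed

text \<open>For use with \<open>eps\<close>: the corner errors of all scales below \<open>J\<close>
  add up, while the time span is of order \<open>1 / J\<close>.\<close>

lemma cesaro_mean_zero:
  fixes f :: "nat \<Rightarrow> real"
  assumes f: "f \<longlonglongrightarrow> 0"
  shows "(\<lambda>n. (\<Sum>l<n. f l) / n) \<longlonglongrightarrow> 0"
proof (rule LIMSEQ_I)
  fix e :: real assume e: "0 < e"
  obtain N where N: "\<And>n. N \<le> n \<Longrightarrow> \<bar>f n\<bar> < e / 2"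
    using LIMSEQ_D[OF f, of "e / 2"] e by auto
  define c where "c = (\<Sum>l<N. \<bar>f l\<bar>)"
  have c: "0 \<le> c" by (simp add: c_def sum_nonneg)
  obtain N' :: nat where N': "2 * c / e < N'" using reals_Archimedean2 by blast
  show "\<exists>no. \<forall>n\<ge>no. norm ((\<Sum>l<n. f l) / n - 0) < e"
  proof (intro exI[of _ "max N (Suc N')"] allI impI)
    fix n assume n: "max N (Suc N') \<le> n"
    then have n0: "0 < real n" "real N' \<le> real n" by auto
    have "\<bar>\<Sum>l<n. f l\<bar> \<le> (\<Sum>l<n. \<bar>f l\<bar>)" by (rule sum_abs)
    also have "\<dots> = c + (\<Sum>l=N..<n. \<bar>f l\<bar>)"
      unfolding c_def using n by (metis atLeast0LessThan max.cobounded1 order_trans sum.atLeastLessThan_concat zero_le)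
    also have "(\<Sum>l=N..<n. \<bar>f l\<bar>) \<le> (\<Sum>l=N..<n. e / 2)"
    proof (rule sum_mono)
      fix l assume "l \<in> {N..<n}"
      then show "\<bar>f l\<bar> \<le> e / 2" using N[of l] by simp
    qed
    also have "\<dots> \<le> n * (e / 2)" using e by (simp add: mult_right_mono)
    finally have "\<bar>\<Sum>l<n. f l\<bar> \<le> c + n * (e / 2)" by simp
    moreover have "c < n * (e / 2)"
    proof -
      have "c < N' * (e / 2)" using N' e by (simp add: field_simps)
      also have "\<dots> \<le> n * (e / 2)" using n0 e by (intro mult_right_mono) auto
      finally show ?thesis .
    qed
    ultimately have "\<bar>\<Sum>l<n. f l\<bar> < n * e" by simp
    then show "norm ((\<Sum>l<n. f l) / n - 0) < e" using n0 by (simp add: divide_less_eq mult.commute)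
  qed
qed

context corner_evolution_bounded
begin

lemma w0_diff_measurable: "(\<lambda>z. \<bar>w0 z - indicator (wedge \<beta> \<alpha>) z\<bar>) \<in> borel_measurable borel"
proof -
  have "wedge \<beta> \<alpha> \<in> sets borel" using open_wedge[of \<alpha>] A_bounds[of 0] init by simp
  then show ?thesis using vortex.meas[OF vortex0] by (intro borel_measurable_abs borel_measurable_diff borel_measurable_indicator)
qed

lemma eps_integrable: "integrable lborel (\<lambda>z. indicator (ball 0 r) z * \<bar>w0 z - indicator (wedge \<beta> \<alpha>) z\<bar>)"
proof (rule Bochner_Integration.integrable_bound[OF integrable_indicator_ball[of 0 r]])
  show "(\<lambda>z. indicator (ball 0 r) z * \<bar>w0 z - indicator (wedge \<beta> \<alpha>) z\<bar>) \<in> borel_measurable lborel"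
    using w0_diff_measurable by (intro borel_measurable_times borel_measurable_indicator) simp_all
  have "\<bar>w0 z - indicator (wedge \<beta> \<alpha>) z\<bar> \<le> 1" for z
    using vortex.bounds[OF vortex0, of z] by (auto simp: indicator_def)
  then show "AE z in lborel. norm (indicator (ball 0 r) z * \<bar>w0 z - indicator (wedge \<beta> \<alpha>) z\<bar>) \<le> norm (indicator (ball 0 r) z :: real)"
    by (intro AE_I2) (simp add: indicator_def)
qed

lemma eps_nonneg: "0 \<le> eps i"
  unfolding eps_def by (intro mult_nonneg_nonneg Bochner_Integration.integral_nonneg) auto

lemma eps_lim: "eps \<longlonglongrightarrow> 0"
proof -
  have "filterlim (\<lambda>i. R / 2 ^ i) (at_right 0) sequentially"
  proof -
    have "(\<lambda>i. R * (1 / 2) ^ i) \<longlonglongrightarrow> R * 0"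
      by (intro tendsto_mult tendsto_const LIMSEQ_realpow_zero) auto
    then have "(\<lambda>i. R / 2 ^ i) \<longlonglongrightarrow> 0" by (simp add: power_divide)
    moreover have "\<forall>\<^sub>F i in sequentially. R / 2 ^ i \<in> {0<..} \<and> R / 2 ^ i \<noteq> 0"
      using R_ge by (intro always_eventually) auto
    ultimately show ?thesis unfolding filterlim_at by auto
  qed
  from filterlim_compose[OF corner this]
  have "(\<lambda>i. R\<^sup>2 * ((LINT z|lborel. indicator (ball 0 (R / 2 ^ i)) z * \<bar>w0 z - indicator (wedge \<beta> \<alpha>) z\<bar>) / (R / 2 ^ i)\<^sup>2)) \<longlonglongrightarrow> R\<^sup>2 * 0"
    by (intro tendsto_mult tendsto_const)
  moreover have "R\<^sup>2 * (x / (R / 2 ^ i)\<^sup>2) = 4 ^ i * x" for x i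
  proof -
    have "(2::real) ^ i * 2 ^ i = 4 ^ i" by (simp flip: power_mult_distrib)
    then show ?thesis using R_ge by (simp add: field_simps power2_eq_square)
  qed
  ultimately show ?thesis unfolding eps_def by simp
qed

text \<open>Replacing the patch by its tangent sector costs \<open>B * eps i\<close>. The sector
  integral is then exact by \<open>wedge_integral\<close>, as the model flow turns the initial
  sector into the one at model time \<open>s'\<close>.\<close>

lemma initial_estimate:
  assumes \<xi>: "continuous_on UNIV \<xi>" and B: "\<And>z. \<bar>\<xi> z\<bar> \<le> B" and \<xi>0: "\<And>z. 2 \<le> norm z \<Longrightarrow> \<xi> z = (0::real)"
    and s': "0 \<le> s'" "s' \<le> S"
  shows "\<bar>4 ^ i * (LINT z|lborel. w0 z * \<xi> (2 ^ i *\<^sub>R flow s' 0 z)) - polar_integral 2 (\<theta> s') (A s') \<xi>\<bar> \<le> B * eps i"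
proof -
  let ?W = "wedge \<beta> \<alpha>" and ?f = "\<lambda>z. \<xi> (2 ^ i *\<^sub>R flow s' 0 z)"
  have B0: "0 \<le> B" using B[of 0] by linarith
  have e10: "e1 0 = complex_of_real (r1 0) * cis \<beta>" "e2 0 = complex_of_real (r2 0) * cis (\<beta> + \<alpha>)"
    using e1_polar[of 0] e2_polar[of 0] init by auto
  have al: "0 < \<alpha>" "\<alpha> < pi" using A_bounds[of 0] init by auto
  have b: "(0::real) < 2 ^ i" by simp
  note W = wedge_integral[where f=\<xi> and R=2, OF \<xi> \<xi>0 _ b e10 r_pos(1)[of 0] r_pos(2)[of 0] al e_det[of 0]
      e1_polar[of s'] e2_polar[of s'] r_pos(1)[of s'] r_pos(2)[of s'] A_bounds[of s'] e_det[of s'], folded flow_def, simplified]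
  have cf: "continuous_on UNIV ?f"
    by (rule continuous_on_compose2[OF \<xi> _ subset_UNIV])
       (intro continuous_on_scaleR continuous_on_const linear_continuous_on bounded_linear_flow)
  have i0: "integrable lborel (\<lambda>z. w0 z * ?f z)"
    using vortex.integrable_times_bounded(1)[OF vortex0 borel_measurable_continuous_onI[OF cf], of B] B by simp
  have i1: "integrable lborel (\<lambda>z. indicator ?W z * ?f z)"
    using W(1) by (simp add: set_integrable_def)
  have v1: "(LINT z|lborel. indicator ?W z * ?f z) = polar_integral 2 (\<theta> s') (A s') \<xi> / 4 ^ i"
  proof -
    have "((2::real) ^ i)\<^sup>2 = 4 ^ i" by (simp add: power2_eq_square flip: power_mult_distrib)
    then show ?thesis using W(2) by (simp add: set_lebesgue_integral_def)
  qed
  have "(LINT z|lborel. w0 z * ?f z) - polar_integral 2 (\<theta> s') (A s') \<xi> / 4 ^ i = (LINT z|lborel. (w0 z - indicator ?W z) * ?f z)"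
    unfolding v1[symmetric] by (subst Bochner_Integration.integral_diff[symmetric, OF i0 i1]) (simp add: left_diff_distrib)
  moreover have "\<bar>LINT z|lborel. (w0 z - indicator ?W z) * ?f z\<bar> \<le> (LINT z|lborel. B * (indicator (ball 0 (R / 2 ^ i)) z * \<bar>w0 z - indicator ?W z\<bar>))"
  proof (rule abs_integral_le[OF integrable_mult_right[OF eps_integrable]])
    fix z
    show "\<bar>(w0 z - indicator ?W z) * ?f z\<bar> \<le> B * (indicator (ball 0 (R / 2 ^ i)) z * \<bar>w0 z - indicator ?W z\<bar>)"
    proof (cases "norm (2 ^ i *\<^sub>R flow s' 0 z) \<le> 2")
      case True
      then have "norm z < R / 2 ^ i" using flow_support[of 0 s' i z] s' S_pos by simp
      then show ?thesis using mult_left_mono[OF B[of "2 ^ i *\<^sub>R flow s' 0 z"], of "\<bar>w0 z - indicator ?W z\<bar>"]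
        by (simp add: abs_mult mult.commute)
    next
      case False
      then have "?f z = 0" by (intro \<xi>0) simp
      then show ?thesis using B0 by simp
    qed
  qed
  moreover have "(LINT z|lborel. B * (indicator (ball 0 (R / 2 ^ i)) z * \<bar>w0 z - indicator ?W z\<bar>)) = B * (eps i / 4 ^ i)"
    unfolding eps_def by simp
  ultimately have "\<bar>(LINT z|lborel. w0 z * ?f z) - polar_integral 2 (\<theta> s') (A s') \<xi> / 4 ^ i\<bar> \<le> B * (eps i / 4 ^ i)" by simp
  then have "4 ^ i * \<bar>(LINT z|lborel. w0 z * ?f z) - polar_integral 2 (\<theta> s') (A s') \<xi> / 4 ^ i\<bar> \<le> 4 ^ i * (B * (eps i / 4 ^ i))"
    by (intro mult_left_mono) auto
  moreover have "4 ^ i * \<bar>(LINT z|lborel. w0 z * ?f z) - polar_integral 2 (\<theta> s') (A s') \<xi> / 4 ^ i\<bar>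
     = \<bar>4 ^ i * ((LINT z|lborel. w0 z * ?f z) - polar_integral 2 (\<theta> s') (A s') \<xi> / 4 ^ i)\<bar>"
    by (simp add: abs_mult)
  ultimately show ?thesis by (simp add: right_diff_distrib)
qed

text \<open>The flow in \<open>transport_estimate\<close> is the identity if \<open>s'\<close> is
  the current model time; but that varies with \<open>t\<close>, while the exceptional null set
  depends on \<open>s'\<close>. Hence the estimate is used for all rational \<open>s'\<close> at
  once, and continuity gives the limit. The pair \<open>P\<close>, \<open>D\<close> admits either
  the exact value of the sector integral or a mere bound for it.\<close>

lemma scale_estimate:
  assumes \<xi>: "C1 \<xi>" and B: "\<And>z v. norm (frechet_derivative \<xi> (at z) v) \<le> B * norm v" "\<And>z. \<bar>\<xi> z\<bar> \<le> B"
    and \<xi>0: "\<And>z. 2 \<le> norm z \<Longrightarrow> \<xi> z = (0::real)"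
    and P: "continuous_on UNIV P" and D: "continuous_on UNIV D" and PD: "\<And>s. \<bar>polar_integral 2 (\<theta> s) (A s) \<xi> - P s\<bar> \<le> D s"
    and T: "0 < T" "shell_mass * i * T \<le> S" and M0: "0 \<le> M"
    and M: "AE t in lborel. t \<in> {0..T} \<longrightarrow> norm (coeff i t - model_coeff i t) \<le> M"
  shows "AE t in lborel. t \<in> {0..T} \<longrightarrow>
    \<bar>4 ^ i * (LINT z|lborel. w t z * \<xi> (2 ^ i *\<^sub>R (z - X t))) - P (shell_mass * i * t)\<bar>
     \<le> D (shell_mass * i * t) + (B * eps i + T * ((B * (2 * K\<^sup>2) * (CR + R * M)) * (pi * R\<^sup>2)))"
proof -
  define E where "E = B * eps i + T * ((B * (2 * K\<^sup>2) * (CR + R * M)) * (pi * R\<^sup>2))"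
  have B0: "0 \<le> B" using B(2)[of 0] by linarith
  have c\<xi>: "continuous_on UNIV \<xi>" by (rule C1_continuous[OF \<xi>])
  have one: "AE t in lborel. t \<in> {0..T} \<longrightarrow>
    \<bar>4 ^ i * (LINT z|lborel. w t z * \<xi> (2 ^ i *\<^sub>R flow s' (shell_mass * i * t) (z - X t))) - P s'\<bar> \<le> D s' + E"
    if s': "0 \<le> s'" "s' \<le> S" for s'
  proof -
    have "AE t in lborel. t \<in> {0..T} \<longrightarrow>
    \<bar>(LINT z|lborel. w t z * \<xi> (2 ^ i *\<^sub>R flow s' (shell_mass * i * t) (z - X t)))
      - (LINT z|lborel. w0 z * \<xi> (2 ^ i *\<^sub>R flow s' 0 z))\<bar>
    \<le> T * ((B * (2 * K\<^sup>2) * (CR + R * M)) * (pi * (R / 2 ^ i)\<^sup>2))"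
      by (rule transport_estimate[OF \<xi> B(1) B0 \<xi>0 T s' M0 M])
    then show ?thesis
  proof eventually_elim
    fix t
    let ?a = "LINT z|lborel. w t z * \<xi> (2 ^ i *\<^sub>R flow s' (shell_mass * i * t) (z - X t))"
      and ?b = "LINT z|lborel. w0 z * \<xi> (2 ^ i *\<^sub>R flow s' 0 z)"
      and ?e = "T * ((B * (2 * K\<^sup>2) * (CR + R * M)) * (pi * (R / 2 ^ i)\<^sup>2))"
    assume *: "t \<in> {0..T} \<longrightarrow> \<bar>?a - ?b\<bar> \<le> ?e"
    show "t \<in> {0..T} \<longrightarrow> \<bar>4 ^ i * ?a - P s'\<bar> \<le> D s' + E"
    proof
      assume "t \<in> {0..T}"
      have init: "\<bar>4 ^ i * ?b - polar_integral 2 (\<theta> s') (A s') \<xi>\<bar> \<le> B * eps i"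
        by (rule initial_estimate[OF c\<xi> B(2) \<xi>0 s'])
      from \<open>t \<in> {0..T}\<close> have "4 ^ i * \<bar>?a - ?b\<bar> \<le> 4 ^ i * ?e" using * by (intro mult_left_mono) auto
      moreover have "4 ^ i * \<bar>?a - ?b\<bar> = \<bar>4 ^ i * ?a - 4 ^ i * ?b\<bar>" by (simp add: abs_mult flip: right_diff_distrib)
      moreover have "4 ^ i * ?e = T * ((B * (2 * K\<^sup>2) * (CR + R * M)) * (pi * R\<^sup>2))"
      proof -
        have "4 ^ i * (R / 2 ^ i)\<^sup>2 = R\<^sup>2"
        proof -
          have "(2::real) ^ i * 2 ^ i = 4 ^ i" by (simp flip: power_mult_distrib)
          then show ?thesis by (simp add: power_divide power2_eq_square)
        qed
        moreover have "4 ^ i * ?e = T * ((B * (2 * K\<^sup>2) * (CR + R * M)) * (pi * (4 ^ i * (R / 2 ^ i)\<^sup>2)))" by (simp only: mult_ac)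
        ultimately show ?thesis by simp
      qed
      ultimately have "\<bar>4 ^ i * ?a - 4 ^ i * ?b\<bar> \<le> T * ((B * (2 * K\<^sup>2) * (CR + R * M)) * (pi * R\<^sup>2))" by linarith
      then show "\<bar>4 ^ i * ?a - P s'\<bar> \<le> D s' + E"
        using init PD[of s'] unfolding E_def by linarith
    qed
  qed
  qed
  have "AE t in lborel. \<forall>k::nat. \<forall>n::nat. k / Suc n \<le> S \<longrightarrow> t \<in> {0..T} \<longrightarrow>
    \<bar>4 ^ i * (LINT z|lborel. w t z * \<xi> (2 ^ i *\<^sub>R flow (k / Suc n) (shell_mass * i * t) (z - X t))) - P (k / Suc n)\<bar> \<le> D (k / Suc n) + E"
    unfolding AE_all_countable
  proof (intro allI)
    fix k n :: nat
    show "AE t in lborel. k / Suc n \<le> S \<longrightarrow> t \<in> {0..T} \<longrightarrow>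
    \<bar>4 ^ i * (LINT z|lborel. w t z * \<xi> (2 ^ i *\<^sub>R flow (k / Suc n) (shell_mass * i * t) (z - X t))) - P (k / Suc n)\<bar> \<le> D (k / Suc n) + E"
    proof (cases "k / Suc n \<le> S")
      case True
      have "0 \<le> k / Suc n" by simp
      from one[OF this True] show ?thesis by eventually_elim simp
    next
      case False
      then show ?thesis by simp
    qed
  qed
  then show ?thesis unfolding E_def[symmetric]
  proof eventually_elim
    fix t
    assume *: "\<forall>k::nat. \<forall>n::nat. k / Suc n \<le> S \<longrightarrow> t \<in> {0..T} \<longrightarrow>
      \<bar>4 ^ i * (LINT z|lborel. w t z * \<xi> (2 ^ i *\<^sub>R flow (k / Suc n) (shell_mass * i * t) (z - X t))) - P (k / Suc n)\<bar> \<le> D (k / Suc n) + E"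
    show "t \<in> {0..T} \<longrightarrow> \<bar>4 ^ i * (LINT z|lborel. w t z * \<xi> (2 ^ i *\<^sub>R (z - X t))) - P (shell_mass * i * t)\<bar> \<le> D (shell_mass * i * t) + E"
    proof
      assume t: "t \<in> {0..T}"
      define s where "s = shell_mass * i * t"
      have s0: "0 \<le> s" using t shell_mass_pos by (simp add: s_def)
      have "s \<le> shell_mass * i * T" unfolding s_def using t shell_mass_pos by (intro mult_left_mono) auto
      then have sS: "s \<le> S" using T(2) by linarith
      \<comment> \<open>Rational approximation from below, so that the times stay in
        \<open>{0..S}\<close>.\<close>
      define q where "q n = real (nat \<lfloor>s * Suc n\<rfloor>) / Suc n" for n
      have q: "s - 1 / Suc n \<le> q n" "q n \<le> s" for n
      proof -
        have "0 \<le> s * Suc n" using s0 by simp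
        then have "real (nat \<lfloor>s * Suc n\<rfloor>) = of_int \<lfloor>s * Suc n\<rfloor>" by simp
        then have "s * Suc n - 1 \<le> real (nat \<lfloor>s * Suc n\<rfloor>)" "real (nat \<lfloor>s * Suc n\<rfloor>) \<le> s * Suc n" by linarith+
        then have "(s * Suc n - 1) / Suc n \<le> q n" "q n \<le> s * Suc n / Suc n"
          unfolding q_def by (intro divide_right_mono; simp)+
        then show "s - 1 / Suc n \<le> q n" "q n \<le> s" by (simp_all add: diff_divide_distrib)
      qed
      have qlim: "q \<longlonglongrightarrow> s"
      proof (rule real_tendsto_sandwich[of "\<lambda>n. s - 1 / Suc n" q sequentially "\<lambda>n. s"])
        have "(\<lambda>n. s - 1 / real (Suc n)) \<longlonglongrightarrow> s - 0"
          by (intro tendsto_diff tendsto_const LIMSEQ_Suc lim_1_over_n)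
        then show "(\<lambda>n. s - 1 / Suc n) \<longlonglongrightarrow> s" by simp
      qed (use q in auto)
      have le: "\<bar>4 ^ i * (LINT z|lborel. w t z * \<xi> (2 ^ i *\<^sub>R flow (q n) s (z - X t))) - P (q n)\<bar> \<le> D (q n) + E" for n
        using * t q(2)[of n] sS unfolding q_def s_def[symmetric] by force
      have cont: "(\<lambda>n. f (q n)) \<longlonglongrightarrow> f s" if "continuous_on UNIV f" for f :: "real \<Rightarrow> 'b::real_normed_vector"
        using isCont_tendsto_compose[OF _ qlim] that continuous_on_eq_continuous_at[OF open_UNIV] by blast
      have fl: "(\<lambda>n. flow (q n) s x) \<longlonglongrightarrow> flow s s x" for x
        unfolding flow_def frame_map_def by (intro tendsto_add tendsto_scaleR tendsto_const cont e_cont)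
      have cont\<xi>: "isCont \<xi> x" for x using c\<xi> continuous_on_eq_continuous_at[OF open_UNIV] by blast
      have lim: "(\<lambda>n. LINT z|lborel. w t z * \<xi> (2 ^ i *\<^sub>R flow (q n) s (z - X t))) \<longlonglongrightarrow> (LINT z|lborel. w t z * \<xi> (2 ^ i *\<^sub>R flow s s (z - X t)))"
      proof (rule integral_dominated_convergence[where w="\<lambda>z. w t z * B"])
        have m: "(\<lambda>z. w t z * \<xi> (2 ^ i *\<^sub>R flow s' s (z - X t))) \<in> borel_measurable lborel" for s'
        proof -
          have "continuous_on UNIV (\<lambda>z. \<xi> (2 ^ i *\<^sub>R flow s' s (z - X t)))"
            by (rule continuous_on_compose2[OF c\<xi> _ subset_UNIV])
              (intro continuous_on_scaleR continuous_on_const bounded_linear.continuous_on[OF bounded_linear_flow] continuous_on_diff continuous_on_id)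
          from borel_measurable_times[OF vortex.meas[OF vortex] borel_measurable_continuous_onI[OF this]] show ?thesis by simp
        qed
        show "(\<lambda>z. w t z * \<xi> (2 ^ i *\<^sub>R flow s s (z - X t))) \<in> borel_measurable lborel"
          "(\<lambda>z. w t z * \<xi> (2 ^ i *\<^sub>R flow (q n) s (z - X t))) \<in> borel_measurable lborel" for n by (rule m)+
        show "integrable lborel (\<lambda>z. w t z * B)" using vortex.integrable[OF vortex] by simp
        show "AE z in lborel. (\<lambda>n. w t z * \<xi> (2 ^ i *\<^sub>R flow (q n) s (z - X t))) \<longlonglongrightarrow> w t z * \<xi> (2 ^ i *\<^sub>R flow s s (z - X t))"
          by (intro AE_I2 tendsto_mult tendsto_const isCont_tendsto_compose[OF cont\<xi>] tendsto_scaleR fl)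
        show "AE z in lborel. norm (w t z * \<xi> (2 ^ i *\<^sub>R flow (q n) s (z - X t))) \<le> w t z * B" for n
          using B(2) vortex.bounds[OF vortex] by (intro AE_I2) (simp add: abs_mult mult_left_mono)
      qed
      have "(\<lambda>n. \<bar>4 ^ i * (LINT z|lborel. w t z * \<xi> (2 ^ i *\<^sub>R flow (q n) s (z - X t))) - P (q n)\<bar>) \<longlonglongrightarrow>
         \<bar>4 ^ i * (LINT z|lborel. w t z * \<xi> (2 ^ i *\<^sub>R flow s s (z - X t))) - P s\<bar>"
        by (intro tendsto_rabs tendsto_diff tendsto_mult tendsto_const lim cont P)
      moreover have "(\<lambda>n. D (q n) + E) \<longlonglongrightarrow> D s + E"
        by (intro tendsto_add tendsto_const cont D)
      ultimately have "\<bar>4 ^ i * (LINT z|lborel. w t z * \<xi> (2 ^ i *\<^sub>R flow s s (z - X t))) - P s\<bar> \<le> D s + E"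
        by (rule LIMSEQ_le) (use le in blast)
      then show "\<bar>4 ^ i * (LINT z|lborel. w t z * \<xi> (2 ^ i *\<^sub>R (z - X t))) - P (shell_mass * i * t)\<bar> \<le> D (shell_mass * i * t) + E"
        unfolding flow_same s_def .
    qed
  qed
qed

text \<open>Since \<open>s * m s\<close> has derivative \<open>a\<close>, the difference of the
  model coefficients times \<open>t\<close> is the integral of \<open>a\<close> over a step of
  length \<open>h = shell_mass * t\<close>. Freezing \<open>a\<close> at the left end costs at most
  \<open>Q * h^2\<close>.\<close>

lemma model_increment:
  assumes t: "0 < t" "shell_mass * Suc i * t \<le> S" and Q: "\<And>s. 0 \<le> s \<Longrightarrow> s \<le> S \<Longrightarrow> norm (a' s) \<le> Q"
  shows "norm (model_coeff (Suc i) t - model_coeff i t - shell_mass * a (shell_mass * i * t)) \<le> Q * shell_mass\<^sup>2 * t"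
proof -
  define s h where "s = shell_mass * i * t" and "h = shell_mass * t"
  have s0: "0 \<le> s" and h0: "0 < h" using t shell_mass_pos by (auto simp: s_def h_def)
  have sh: "s + h = shell_mass * Suc i * t" by (simp add: s_def h_def algebra_simps)
  then have shS: "s + h \<le> S" using t(2) by simp
  have Q0: "0 \<le> Q" using Q[of 0] S_pos norm_ge_zero[of "a' 0"] by linarith
  have ax: "norm (a x - a s) \<le> Q * h" if "s \<le> x" "x \<le> s + h" for x
  proof -
    have "norm (a x - a s) \<le> Q * (x - s)"
      by (rule has_vector_derivative_bound[OF a_deriv]) (use Q that s0 shS in auto)
    also have "\<dots> \<le> Q * h" using that Q0 by (intro mult_left_mono) auto
    finally show ?thesis .
  qed
  define f where "f x = x * m x - x *\<^sub>R a s" for x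
  have "(f has_vector_derivative a x - 1 *\<^sub>R a s) (at x)" for x
    unfolding f_def
    by (rule has_vector_derivative_diff[OF m_mean]) (auto intro!: derivative_eq_intros)
  then have fd: "(f has_vector_derivative a x - a s) (at x)" for x by simp
  have "norm (f (s + h) - f s) \<le> (Q * h) * (s + h - s)"
    by (rule has_vector_derivative_bound[OF fd]) (use ax h0 in auto)
  then have fb: "norm (f (s + h) - f s) \<le> Q * h * h" by simp
  have "f (s + h) - f s = t * (model_coeff (Suc i) t - model_coeff i t - shell_mass * a (shell_mass * i * t))"
    unfolding f_def sh unfolding s_def model_coeff_def by (simp add: scaleR_conv_of_real algebra_simps)
  then have "t * norm (model_coeff (Suc i) t - model_coeff i t - shell_mass * a (shell_mass * i * t)) \<le> t * (Q * shell_mass\<^sup>2 * t)"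
    using fb t(1) by (simp add: norm_mult h_def power2_eq_square mult_ac)
  then show ?thesis using t(1) by simp
qed

text \<open>The increments of \<open>coeff\<close> and of \<open>model_coeff\<close> are both close
  to \<open>shell_mass * a\<close>, taken at the model time of scale \<open>i\<close>. The former
  relies on the bound \<open>M\<close> already known at scale \<open>i\<close>, the latter on the
  bound for the derivative of \<open>a\<close>.\<close>

lemma recursion_step:
  obtains C where "0 \<le> C" "\<And>i T M. 0 < T \<Longrightarrow> shell_mass * Suc i * T \<le> S \<Longrightarrow> 0 \<le> M \<Longrightarrow>
    (AE t in lborel. t \<in> {0..T} \<longrightarrow> norm (coeff i t - model_coeff i t) \<le> M) \<Longrightarrow>
    (AE t in lborel. t \<in> {0..T} \<longrightarrow> norm (coeff (Suc i) t - model_coeff (Suc i) t) \<le> M + C * (eps i + T * (1 + M)))"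
proof -
  define f1 f2 where "f1 = (\<lambda>z. Re (shell_strain z))" and "f2 = (\<lambda>z. Im (shell_strain z))"
  have C1f: "C1 f1" "C1 f2" unfolding f1_def f2_def
    by (rule C1_bounded_linear_compose[OF bounded_linear_Re C1_shell_strain] C1_bounded_linear_compose[OF bounded_linear_Im C1_shell_strain])+
  have f0: "f1 z = 0" "f2 z = 0" if "2 \<le> norm z" for z using shell_strain_0[OF that] by (auto simp: f1_def f2_def)
  obtain B1 where B1: "1 \<le> B1" "\<And>z. norm (f1 z) \<le> B1" "\<And>z v. norm (frechet_derivative f1 (at z) v) \<le> B1 * norm v"
    by (rule C1_compact_support_bound[OF C1f(1) f0(1)]) blast+
  obtain B2 where B2: "1 \<le> B2" "\<And>z. norm (f2 z) \<le> B2" "\<And>z v. norm (frechet_derivative f2 (at z) v) \<le> B2 * norm v"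
    by (rule C1_compact_support_bound[OF C1f(2) f0(2)]) blast+
  have "compact (a' ` {0..S})"
    by (intro compact_continuous_image continuous_on_subset[OF a'_cont]) auto
  from compact_imp_bounded[OF this] obtain Q where "\<forall>x\<in>a' ` {0..S}. norm x \<le> Q" unfolding bounded_iff by blast
  then have Q: "norm (a' s) \<le> Q" if "0 \<le> s" "s \<le> S" for s using that by auto
  have Q0: "0 \<le> Q" using Q[of 0] S_pos norm_ge_zero[of "a' 0"] by linarith
  define k where "k = (2 * K\<^sup>2) * (pi * R\<^sup>2)"
  have k: "0 \<le> k" by (simp add: k_def)
  \<comment> \<open>The three summands absorb the corner error, the transport error and the error of
    the Riemann sum.\<close>
  define C where "C = (B1 + B2) + (B1 + B2) * k * (CR + R) + Q * shell_mass\<^sup>2"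
  have C: "0 \<le> C" unfolding C_def using B1 B2 k CR_nonneg R_ge Q0 by simp
  have ca: "continuous_on UNIV a"
    by (intro continuous_at_imp_continuous_on ballI has_vector_derivative_continuous[OF a_deriv])
  show thesis
  proof (rule that[OF C])
    fix i T M
    assume T: "0 < T" "shell_mass * Suc i * T \<le> S" and M0: "0 \<le> M"
      and M: "AE t in lborel. t \<in> {0..T} \<longrightarrow> norm (coeff i t - model_coeff i t) \<le> M"
    have "shell_mass * i * T \<le> shell_mass * Suc i * T" using shell_mass_pos T by simp
    then have T': "shell_mass * i * T \<le> S" using T by linarith
    have cP: "continuous_on UNIV (\<lambda>s. shell_mass * Re (a s))" "continuous_on UNIV (\<lambda>s. shell_mass * Im (a s))"
      by (intro continuous_on_mult_left continuous_on_Re continuous_on_Im ca)+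
    have p: "polar_integral 2 (\<theta> s) (A s) f1 = shell_mass * Re (a s)" "polar_integral 2 (\<theta> s) (A s) f2 = shell_mass * Im (a s)" for s
      unfolding f1_def f2_def a_eq using polar_integral_shell_strain[of "A s" "\<theta> s"] A_bounds(1)[of s] by simp_all
    have "AE t in lborel. t \<in> {0..T} \<longrightarrow>
        \<bar>4 ^ i * (LINT z|lborel. w t z * f1 (2 ^ i *\<^sub>R (z - X t))) - shell_mass * Re (a (shell_mass * i * t))\<bar>
         \<le> 0 + (B1 * eps i + T * ((B1 * (2 * K\<^sup>2) * (CR + R * M)) * (pi * R\<^sup>2)))"
      by (rule scale_estimate[where D="\<lambda>_. 0", OF C1f(1) B1(3) _ f0(1) cP(1) continuous_on_const _ T(1) T' M0 M])
         (use B1(2) p in simp_all)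
    moreover have "AE t in lborel. t \<in> {0..T} \<longrightarrow>
        \<bar>4 ^ i * (LINT z|lborel. w t z * f2 (2 ^ i *\<^sub>R (z - X t))) - shell_mass * Im (a (shell_mass * i * t))\<bar>
         \<le> 0 + (B2 * eps i + T * ((B2 * (2 * K\<^sup>2) * (CR + R * M)) * (pi * R\<^sup>2)))"
      by (rule scale_estimate[where D="\<lambda>_. 0", OF C1f(2) B2(3) _ f0(2) cP(2) continuous_on_const _ T(1) T' M0 M])
         (use B2(2) p in simp_all)
    moreover have "AE t in lborel. t \<noteq> (0::real)" by (rule AE_lborel_singleton)
    ultimately show "AE t in lborel. t \<in> {0..T} \<longrightarrow> norm (coeff (Suc i) t - model_coeff (Suc i) t) \<le> M + C * (eps i + T * (1 + M))"
      using M
    proof eventually_elim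
      fix t
      let ?I1 = "4 ^ i * (LINT z|lborel. w t z * f1 (2 ^ i *\<^sub>R (z - X t)))"
        and ?I2 = "4 ^ i * (LINT z|lborel. w t z * f2 (2 ^ i *\<^sub>R (z - X t)))"
        and ?s = "shell_mass * i * t"
      assume I: "t \<in> {0..T} \<longrightarrow> \<bar>?I1 - shell_mass * Re (a ?s)\<bar> \<le> 0 + (B1 * eps i + T * ((B1 * (2 * K\<^sup>2) * (CR + R * M)) * (pi * R\<^sup>2)))"
        "t \<in> {0..T} \<longrightarrow> \<bar>?I2 - shell_mass * Im (a ?s)\<bar> \<le> 0 + (B2 * eps i + T * ((B2 * (2 * K\<^sup>2) * (CR + R * M)) * (pi * R\<^sup>2)))"
        and t0: "t \<noteq> 0" and Mt: "t \<in> {0..T} \<longrightarrow> norm (coeff i t - model_coeff i t) \<le> M"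
      show "t \<in> {0..T} \<longrightarrow> norm (coeff (Suc i) t - model_coeff (Suc i) t) \<le> M + C * (eps i + T * (1 + M))"
      proof
        assume tT: "t \<in> {0..T}"
        then have t: "0 < t" using t0 by auto
        have "shell_mass * Suc i * t \<le> shell_mass * Suc i * T"
          using tT shell_mass_pos by (intro mult_left_mono) auto
        then have "norm (model_coeff (Suc i) t - model_coeff i t - shell_mass * a ?s) \<le> Q * shell_mass\<^sup>2 * t"
          using T(2) by (intro model_increment[OF t _ Q]) linarith+
        also have "\<dots> \<le> Q * shell_mass\<^sup>2 * T" using tT Q0 by (intro mult_left_mono) auto
        finally have i1: "norm (model_coeff (Suc i) t - model_coeff i t - shell_mass * a ?s) \<le> Q * shell_mass\<^sup>2 * T" .
        have "norm (Complex ?I1 ?I2 - shell_mass * a ?s) \<le> \<bar>Re (Complex ?I1 ?I2 - shell_mass * a ?s)\<bar> + \<bar>Im (Complex ?I1 ?I2 - shell_mass * a ?s)\<bar>"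
          by (rule cmod_le)
        also have "\<dots> = \<bar>?I1 - shell_mass * Re (a ?s)\<bar> + \<bar>?I2 - shell_mass * Im (a ?s)\<bar>" by simp
        also have "\<dots> \<le> (B1 + B2) * eps i + T * ((B1 + B2) * k * (CR + R * M))"
          using I tT unfolding k_def by (simp add: algebra_simps)
        finally have i2: "norm (Complex ?I1 ?I2 - shell_mass * a ?s) \<le> (B1 + B2) * eps i + T * ((B1 + B2) * k * (CR + R * M))" .
        have "coeff (Suc i) t - model_coeff (Suc i) t = (coeff i t - model_coeff i t) + (Complex ?I1 ?I2 - shell_mass * a ?s)
            - (model_coeff (Suc i) t - model_coeff i t - shell_mass * a ?s)"
          unfolding coeff_Suc f1_def f2_def by simp
        then have "norm (coeff (Suc i) t - model_coeff (Suc i) t) \<le> norm (coeff i t - model_coeff i t) + norm (Complex ?I1 ?I2 - shell_mass * a ?s)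
            + norm (model_coeff (Suc i) t - model_coeff i t - shell_mass * a ?s)"
          using norm_triangle_ineq4 norm_triangle_ineq by (smt (verit, best))
        also have "\<dots> \<le> M + ((B1 + B2) * eps i + T * ((B1 + B2) * k * (CR + R * M))) + Q * shell_mass\<^sup>2 * T"
          using Mt tT i1 i2 by simp
        also have "\<dots> \<le> M + C * (eps i + T * (1 + M))"
        proof -
          have b: "0 \<le> B1 + B2" using B1(1) B2(1) by simp
          have "(B1 + B2) * eps i \<le> C * eps i"
            using eps_nonneg[of i] k CR_nonneg R_ge Q0 b by (intro mult_right_mono) (auto simp: C_def)
          moreover have "(B1 + B2) * k * (CR + R * M) + Q * shell_mass\<^sup>2 \<le> C * (1 + M)"
          proof -
            have "CR + R * M \<le> (CR + R) * (1 + M)" using CR_nonneg R_ge M0 by (simp add: algebra_simps)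
            then have "(B1 + B2) * k * (CR + R * M) \<le> (B1 + B2) * k * ((CR + R) * (1 + M))"
              using b k by (intro mult_left_mono) auto
            moreover have "Q * shell_mass\<^sup>2 * 1 \<le> Q * shell_mass\<^sup>2 * (1 + M)" using Q0 M0 by (intro mult_left_mono) auto
            moreover have "0 \<le> (B1 + B2) * (1 + M)" using b M0 by simp
            moreover have "C * (1 + M) = (B1 + B2) * (1 + M) + (B1 + B2) * k * ((CR + R) * (1 + M)) + Q * shell_mass\<^sup>2 * (1 + M)"
              unfolding C_def by (simp add: algebra_simps)
            ultimately show ?thesis by linarith
          qed
          then have "T * ((B1 + B2) * k * (CR + R * M) + Q * shell_mass\<^sup>2) \<le> T * (C * (1 + M))"
            using T(1) by (intro mult_left_mono) auto
          ultimately show ?thesis by (simp add: algebra_simps)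
        qed
        finally show "norm (coeff (Suc i) t - model_coeff (Suc i) t) \<le> M + C * (eps i + T * (1 + M))" .
      qed
    qed
  qed
qed

text \<open>A discrete Gronwall argument, starting from scale 0, where the model coefficient
  vanishes and \<open>coeff\<close> is at most \<open>C0\<close>. As long as \<open>T * J\<close>
  stays bounded, growth in \<open>J\<close> comes only from the sum of \<open>eps\<close>.\<close>

lemma coeff_error:
  obtains C where "0 \<le> C" "\<And>J T. 0 < T \<Longrightarrow> shell_mass * J * T \<le> S \<Longrightarrow>
    AE t in lborel. t \<in> {0..T} \<longrightarrow> norm (coeff J t - model_coeff J t) \<le> (C0 + C * (\<Sum>l<J. eps l) + C * T * J) * exp (C * T * J)"
proof -
  obtain C where C: "0 \<le> C" and step: "\<And>i T M. 0 < T \<Longrightarrow> shell_mass * Suc i * T \<le> S \<Longrightarrow> 0 \<le> M \<Longrightarrow>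
    (AE t in lborel. t \<in> {0..T} \<longrightarrow> norm (coeff i t - model_coeff i t) \<le> M) \<Longrightarrow>
    (AE t in lborel. t \<in> {0..T} \<longrightarrow> norm (coeff (Suc i) t - model_coeff (Suc i) t) \<le> M + C * (eps i + T * (1 + M)))"
    apply (rule recursion_step)
    subgoal premises p for C by (rule p(1)[OF p(2,3)])
    done
  show thesis
  proof (rule that[OF C])
    fix J :: nat and T :: real
    assume T: "0 < T" "shell_mass * J * T \<le> S"
    then show "AE t in lborel. t \<in> {0..T} \<longrightarrow> norm (coeff J t - model_coeff J t) \<le> (C0 + C * (\<Sum>l<J. eps l) + C * T * J) * exp (C * T * J)"
    proof (induction J)
      case 0
      then show ?case by (intro AE_I2) (simp add: model_coeff_def norm_coeff_0)
    next
      case (Suc i)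
      define b where "b j = C0 + C * (\<Sum>l<j. eps l) + C * T * j" for j :: nat
      have b0: "0 \<le> b j" for j
        unfolding b_def using C T vortex.C0_nonneg[OF vortex0] eps_nonneg by (intro add_nonneg_nonneg mult_nonneg_nonneg sum_nonneg) auto
      have "shell_mass * i * T \<le> shell_mass * Suc i * T" using shell_mass_pos T by simp
      then have "AE t in lborel. t \<in> {0..T} \<longrightarrow> norm (coeff i t - model_coeff i t) \<le> b i * exp (C * T * i)"
        using Suc unfolding b_def by simp
      from step[OF T(1) Suc.prems(2) _ this]
      have AE: "AE t in lborel. t \<in> {0..T} \<longrightarrow> norm (coeff (Suc i) t - model_coeff (Suc i) t)
          \<le> b i * exp (C * T * i) + C * (eps i + T * (1 + b i * exp (C * T * i)))"
        using b0[of i] by simp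
      have le: "b i * exp (C * T * i) + C * (eps i + T * (1 + b i * exp (C * T * i))) \<le> b (Suc i) * exp (C * T * Suc i)"
      proof -
        define E where "E = exp (C * T * i)"
        have e: "exp (C * T * Suc i) = E * exp (C * T)" unfolding E_def by (simp add: exp_add[symmetric] algebra_simps)
        have E1: "1 \<le> E" unfolding E_def using C T by simp
        have x: "1 + C * T \<le> exp (C * T)" by (rule exp_ge_add_one_self)
        have CT: "0 \<le> C * T" using C T by simp
        have "b i * E * (1 + C * T) \<le> b i * E * exp (C * T)" using x b0[of i] E1 by (intro mult_left_mono) auto
        moreover have "1 * 1 \<le> E * exp (C * T)" using E1 x CT by (intro mult_mono) auto
        then have "(C * eps i + C * T) * 1 \<le> (C * eps i + C * T) * (E * exp (C * T))"
          using C eps_nonneg[of i] CT by (intro mult_left_mono) auto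
        moreover have "b (Suc i) = b i + (C * eps i + C * T)" unfolding b_def by (simp add: algebra_simps)
        ultimately have "b i * E * (1 + C * T) + (C * eps i + C * T) \<le> b (Suc i) * (E * exp (C * T))"
          by (simp add: algebra_simps)
        then show ?thesis unfolding e E_def[symmetric] by (simp add: algebra_simps)
      qed
      show ?case unfolding b_def[symmetric]
        using AE by eventually_elim (use le order_trans in blast)
    qed
  qed
qed

text \<open>The function \<open>1 - far\<close> takes values in the unit interval and vanishes
  beyond radius 2, so its integral over a sector of opening \<open>A\<close> is at most
  \<open>4 * A\<close>. With \<open>T = S / (shell_mass * J)\<close> the transport error is of order
  \<open>(1 + M J) / J\<close>, which vanishes because the Cesaro means of \<open>eps\<close>
  do.\<close>

lemma ball_average_bound:
  obtains E where "E \<longlonglongrightarrow> 0" "\<And>J. 0 < J \<Longrightarrow> AE t in lborel. t \<in> {0..S / (shell_mass * J)} \<longrightarrow>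
     4 ^ J * (LINT z|lborel. w t z * (1 - far (2 ^ J *\<^sub>R (z - X t)))) \<le> A (shell_mass * J * t) * 4 + E J"
proof -
  define \<xi> where "\<xi> z = 1 - far z" for z
  have C1\<xi>: "C1 \<xi>" unfolding \<xi>_def by (intro C1_diff C1_const C1_far)
  have \<xi>0: "\<xi> z = 0" if "2 \<le> norm z" for z using far_cases(2)[OF that] by (simp add: \<xi>_def)
  have \<xi>1: "\<bar>\<xi> z\<bar> \<le> 1" for z using far_cases(3,4)[of z] by (simp add: \<xi>_def)
  obtain B where B: "1 \<le> B" "\<And>z. norm (\<xi> z) \<le> B" "\<And>z v. norm (frechet_derivative \<xi> (at z) v) \<le> B * norm v"
    by (rule C1_compact_support_bound[OF C1\<xi> \<xi>0]) blast+
  obtain C where C: "0 \<le> C" and err: "\<And>J T. 0 < T \<Longrightarrow> shell_mass * J * T \<le> S \<Longrightarrow>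
    AE t in lborel. t \<in> {0..T} \<longrightarrow> norm (coeff J t - model_coeff J t) \<le> (C0 + C * (\<Sum>l<J. eps l) + C * T * J) * exp (C * T * J)"
    apply (rule coeff_error)
    subgoal premises p for C by (rule p(1)[OF p(2,3)])
    done
  define c where "c = S / shell_mass"
  have c0: "0 < c" using S_pos shell_mass_pos by (simp add: c_def)
  define M where "M J = (C0 + C * (\<Sum>l<J. eps l) + C * c) * exp (C * c)" for J :: nat
  define E where "E J = B * eps J + (c / J) * ((B * (2 * K\<^sup>2) * (CR + R * M J)) * (pi * R\<^sup>2))" for J :: nat
  have M0: "0 \<le> M J" for J
    unfolding M_def using C c0 vortex.C0_nonneg[OF vortex0] eps_nonneg
    by (intro mult_nonneg_nonneg add_nonneg_nonneg sum_nonneg) auto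
  have lim: "E \<longlonglongrightarrow> 0"
  proof -
    have inv: "(\<lambda>J. k / real J) \<longlonglongrightarrow> 0" for k
      using tendsto_mult[OF tendsto_const[of k] lim_1_over_n] by simp
    have "(\<lambda>J. ((C0 + C * c) / real J + C * ((\<Sum>l<J. eps l) / J)) * exp (C * c)) \<longlonglongrightarrow> (0 + C * 0) * exp (C * c)"
      by (intro tendsto_mult tendsto_add tendsto_const inv cesaro_mean_zero[OF eps_lim])
    moreover have "((C0 + C * c) / real J + C * ((\<Sum>l<J. eps l) / J)) * exp (C * c) = M J / J" for J
      unfolding M_def by (simp add: add_divide_distrib distrib_left distrib_right)
    ultimately have "(\<lambda>J. M J / real J) \<longlonglongrightarrow> (0 + C * 0) * exp (C * c)" by (simp only:)
    then have MJ: "(\<lambda>J. M J / real J) \<longlonglongrightarrow> 0" by simp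
    have "(\<lambda>J. B * eps J + c * ((B * (2 * K\<^sup>2) * (CR / real J + R * (M J / real J))) * (pi * R\<^sup>2))) \<longlonglongrightarrow>
       B * 0 + c * ((B * (2 * K\<^sup>2) * (0 + R * 0)) * (pi * R\<^sup>2))"
      by (intro tendsto_mult tendsto_add tendsto_const inv MJ eps_lim)
    moreover have "B * eps J + c * ((B * (2 * K\<^sup>2) * (CR / real J + R * (M J / real J))) * (pi * R\<^sup>2)) = E J" for J
    proof -
      have "CR / real J + R * (M J / real J) = (CR + R * M J) / real J" by (simp add: add_divide_distrib)
      then show ?thesis unfolding E_def by simp
    qed
    ultimately show ?thesis by simp
  qed
  show thesis
  proof (rule that[OF lim])
    fix J :: nat assume J: "0 < J"
    define T where "T = S / (shell_mass * J)"
    have T: "0 < T" "shell_mass * J * T \<le> S" and TJ: "T * J = c" and Tc: "T = c / J"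
      unfolding T_def c_def using S_pos shell_mass_pos J by auto
    have M: "AE t in lborel. t \<in> {0..T} \<longrightarrow> norm (coeff J t - model_coeff J t) \<le> M J"
      using err[OF T] unfolding M_def mult.assoc[of C T] TJ .
    have D: "continuous_on UNIV (\<lambda>s. A s * 4)" by (intro continuous_on_mult_right A_cont)
    have PD: "\<bar>polar_integral 2 (\<theta> s) (A s) \<xi> - 0\<bar> \<le> A s * 4" for s
      using abs_polar_integral_le[OF C1_continuous[OF C1\<xi>] \<xi>1, of 2 "A s" "\<theta> s"] A_bounds(1)[of s] by simp
    have B2: "\<bar>\<xi> z\<bar> \<le> B" for z using B(2)[of z] by simp
    have "AE t in lborel. t \<in> {0..T} \<longrightarrow>
      \<bar>4 ^ J * (LINT z|lborel. w t z * \<xi> (2 ^ J *\<^sub>R (z - X t))) - 0\<bar>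
       \<le> A (shell_mass * J * t) * 4 + (B * eps J + T * ((B * (2 * K\<^sup>2) * (CR + R * M J)) * (pi * R\<^sup>2)))"
      by (rule scale_estimate[where P="\<lambda>_. 0", OF C1\<xi> B(3) B2 \<xi>0 continuous_on_const D PD T M0 M])
    then show "AE t in lborel. t \<in> {0..S / (shell_mass * J)} \<longrightarrow>
     4 ^ J * (LINT z|lborel. w t z * (1 - far (2 ^ J *\<^sub>R (z - X t)))) \<le> A (shell_mass * J * t) * 4 + E J"
      unfolding T_def[symmetric] E_def Tc[symmetric] \<xi>_def by eventually_elim auto
  qed
qed

end

context corner_evolution
begin

text \<open>Times near the end of \<open>{0..S / (shell_mass * J)}\<close> have model time near
  \<open>S\<close>, where the opening is small, and they tend to 0 as \<open>J\<close> grows. The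
  property \<open>P\<close> is carried along so that the time can be taken from a common set of full
  measure.\<close>

theorem cusp_average:
  assumes \<delta>: "0 < \<delta>" and \<tau>: "0 < \<tau>"
  obtains J0 where "\<And>J P. J0 \<le> J \<Longrightarrow> (AE t in lborel. 0 \<le> t \<longrightarrow> P t) \<Longrightarrow>
    \<exists>t. 0 < t \<and> t < \<tau> \<and> P t \<and> 4 ^ J * (LINT z|lborel. w t z * (1 - far (2 ^ J *\<^sub>R (z - X t)))) \<le> \<delta>"
proof -
  \<comment> \<open>The opening contributes at most
    \<open>4 * (\<delta> / 16 + \<delta> / 16) = \<delta> / 2\<close>, one term for
    \<open>A S\<close> and one for its oscillation near \<open>S\<close>. The other
    \<open>\<delta> / 2\<close> is left for \<open>E\<close>.\<close>
  obtain S where S: "0 < S" "A S < \<delta> / 16" using A_small[of "\<delta> / 16"] \<delta> by auto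
  have "compact ((\<lambda>s. norm (e1 s) + norm (e2 s)) ` {0..S})"
    by (intro compact_continuous_image continuous_on_add continuous_on_norm e_cont compact_Icc)
  from compact_imp_bounded[OF this] obtain k where k: "\<forall>x\<in>(\<lambda>s. norm (e1 s) + norm (e2 s)) ` {0..S}. norm x \<le> k"
    unfolding bounded_iff by blast
  have kb: "norm (e1 s) \<le> max 1 k" "norm (e2 s) \<le> max 1 k" if "0 \<le> s" "s \<le> S" for s
  proof -
    have "norm (norm (e1 s) + norm (e2 s)) \<le> k" using k that by (meson atLeastAtMost_iff imageI)
    then have "norm (e1 s) + norm (e2 s) \<le> k" by simp
    then show "norm (e1 s) \<le> max 1 k" "norm (e2 s) \<le> max 1 k"
      using norm_ge_zero[of "e1 s"] norm_ge_zero[of "e2 s"] by linarith+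
  qed
  interpret bd: corner_evolution_bounded w w0 X Y C0 \<alpha> \<beta> e1 e2 m a a' r1 r2 \<theta> A S "max 1 k"
    by unfold_locales (use S(1) kb in auto)
  obtain E where lim: "E \<longlonglongrightarrow> 0" and E: "\<And>J. 0 < J \<Longrightarrow> AE t in lborel. t \<in> {0..S / (shell_mass * J)} \<longrightarrow>
     4 ^ J * (LINT z|lborel. w t z * (1 - far (2 ^ J *\<^sub>R (z - X t)))) \<le> A (shell_mass * J * t) * 4 + E J"
    apply (rule bd.ball_average_bound)
    subgoal premises p for E by (rule p(1)[OF p(2,3)])
    done
  have "isCont A S" using A_cont continuous_on_eq_continuous_at[OF open_UNIV] by blast
  then obtain \<eta> where \<eta>: "0 < \<eta>" "\<And>s. \<bar>s - S\<bar> < \<eta> \<Longrightarrow> \<bar>A s - A S\<bar> < \<delta> / 16"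
    using \<delta> unfolding continuous_at_eps_delta dist_real_def by (metis divide_pos_pos zero_less_numeral)
  obtain N1 where N1: "\<And>J. N1 \<le> J \<Longrightarrow> \<bar>E J\<bar> < \<delta> / 2"
    using LIMSEQ_D[OF lim, of "\<delta> / 2"] \<delta> by auto
  obtain N2 :: nat where N2: "S / (shell_mass * \<tau>) < N2" using reals_Archimedean2 by blast
  show thesis
  proof (rule that[of "max N1 (Suc N2)"])
    fix J and P :: "real \<Rightarrow> bool" assume J: "max N1 (Suc N2) \<le> J" and P: "AE t in lborel. 0 \<le> t \<longrightarrow> P t"
    then have J0: "0 < J" "real N2 \<le> real J" by auto
    define T where "T = S / (shell_mass * J)"
    have cJ: "0 < shell_mass * J" using J0 shell_mass_pos by simp
    have T0: "0 < T" unfolding T_def using S(1) cJ by simp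
    have "S / (shell_mass * \<tau>) < J" using N2 J0 by linarith
    then have T\<tau>: "T < \<tau>" unfolding T_def using cJ \<tau> shell_mass_pos by (simp add: field_simps)
    \<comment> \<open>Between \<open>lo\<close> and \<open>T\<close> the model time is within
      \<open>\<eta>\<close> of \<open>S\<close>; this interval has positive length and thus meets
      every set of full measure.\<close>
    define lo where "lo = max 0 ((S - \<eta>) / (shell_mass * J))"
    have lo: "lo < T" unfolding lo_def using T0 \<eta>(1) cJ by (simp add: T_def divide_strict_right_mono)
    have "AE t in lborel. (0 \<le> t \<longrightarrow> P t) \<and> (t \<in> {0..T} \<longrightarrow>
     4 ^ J * (LINT z|lborel. w t z * (1 - far (2 ^ J *\<^sub>R (z - X t)))) \<le> A (shell_mass * J * t) * 4 + E J)"
      using P E[OF J0(1)] unfolding T_def by eventually_elim simp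
    from AE_obtain_in_interval[OF this lo]
    obtain t where t: "lo < t" "t < T" "0 \<le> t \<longrightarrow> P t" "t \<in> {0..T} \<longrightarrow>
     4 ^ J * (LINT z|lborel. w t z * (1 - far (2 ^ J *\<^sub>R (z - X t)))) \<le> A (shell_mass * J * t) * 4 + E J"
      by blast
    have t0: "0 < t" and t1: "(S - \<eta>) / (shell_mass * J) < t" using t(1) unfolding lo_def by auto
    have "S - \<eta> < shell_mass * J * t" using t1 cJ by (simp add: divide_less_eq mult.commute)
    moreover have "shell_mass * J * t < S" using t(2) cJ unfolding T_def by (simp add: less_divide_eq mult.commute)
    ultimately have "\<bar>A (shell_mass * J * t) - A S\<bar> < \<delta> / 16" by (intro \<eta>(2)) linarith
    moreover have "\<bar>E J\<bar> < \<delta> / 2" using N1[of J] J by simp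
    ultimately have "A (shell_mass * J * t) * 4 + E J \<le> \<delta>" using S(2) by linarith
    then show "\<exists>t. 0 < t \<and> t < \<tau> \<and> P t \<and> 4 ^ J * (LINT z|lborel. w t z * (1 - far (2 ^ J *\<^sub>R (z - X t)))) \<le> \<delta>"
      using t t0 T\<tau> by (intro exI[of _ t]) auto
  qed
qed

end

section \<open>Passage to complex notation\<close>

lemma integral_lebesgue_cx:
  fixes h :: "complex \<Rightarrow> 'a::{banach, second_countable_topology}"
  assumes [measurable]: "h \<in> borel_measurable borel"
  shows "(LINT x|lebesgue. h (cx x)) = (LINT z|lborel. h z)"
proof -
  have "(LINT x|lebesgue. h (cx x)) = (LINT x|lborel. h (cx x))"
    by (rule integral_completion) measurable
  also have "\<dots> = (LINT z|distr lborel borel cx. h z)"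
    by (rule integral_distr[symmetric]) measurable
  finally show ?thesis by (simp add: distr_cx)
qed

text \<open>Completeness of Lebesgue measure makes \<open>f\<close> measurable, although only its
  Borel counterpart \<open>g\<close> is known to be so.\<close>

lemma integral_cong_AE_borel:
  fixes f g :: "'a::euclidean_space \<Rightarrow> 'b::euclidean_space"
  assumes "g \<in> borel_measurable borel" "AE x in lborel. f x = g x"
  shows "integral\<^sup>L lebesgue f = integral\<^sup>L lebesgue g"
    and "f \<in> borel_measurable lebesgue"
proof -
  have g: "g \<in> borel_measurable lebesgue"
    by (rule measurable_completion) (use assms(1) in simp)
  have ae: "AE x in lebesgue. f x = g x" by (rule AE_completion[OF assms(2)])
  then have "AE x in lebesgue. g x = f x" by (simp add: eq_commute)
  from borel_measurable_AE[OF g this] show f: "f \<in> borel_measurable lebesgue" .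
  show "integral\<^sup>L lebesgue f = integral\<^sup>L lebesgue g"
    by (rule integral_cong_AE[OF f g ae])
qed

lemma AE_lborel_fst:
  assumes "AE t in lborel. P t"
  shows "AE p::'a::euclidean_space \<times> 'b::euclidean_space in lborel. P (fst p)"
proof -
  obtain N where N: "\<And>t. t \<in> space lborel - N \<Longrightarrow> P t" "N \<in> null_sets lborel"
    using AE_E3[OF assms] by blast
  have [measurable]: "N \<in> sets borel" using N(2) by auto
  have "AE p::'a \<times> 'b in lborel \<Otimes>\<^sub>M lborel. fst p \<notin> N"
  proof (rule lborel_pair.AE_pair_measure)
    show "{p \<in> space (lborel \<Otimes>\<^sub>M (lborel :: 'b measure)). fst p \<notin> N} \<in> sets (lborel \<Otimes>\<^sub>M lborel)"
      by measurable
    show "AE t in lborel. AE y::'b in lborel. fst (t, y) \<notin> N"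
      using AE_not_in[OF N(2)] by eventually_elim simp
  qed
  then show ?thesis unfolding lborel_prod by eventually_elim (use N(1) in auto)
qed

lemma perp_grad_bs:
  assumes "x \<noteq> 0"
  shows "perp_grad laplace_fundamental x = vc (bs (cx x))"
proof -
  have n: "(cmod (cx x))\<^sup>2 = (norm x)\<^sup>2" "norm x \<noteq> 0" using assms by auto
  have "bs (cx x) = \<i> * cx x / complex_of_real (2 * pi * (norm x)\<^sup>2)"
    unfolding bs_def using assms n(2) complex_norm_square[of "cx x"] norm_cx[of x]
    by (auto simp: field_simps)
  then show ?thesis
    unfolding perp_grad_laplace_fundamental[OF assms]
    by (simp add: vec_eq_iff forall_2 Re_divide_of_real Im_divide_of_real del: of_real_mult of_real_power)
qed

text \<open>Both the null set where the vorticity differs from its Borel version and the point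
  \<open>y = x\<close>, where the kernels may disagree, are invisible to the integral.\<close>

lemma velocity_eq:
  assumes v: "vortex f C0" and ae: "AE y in lborel. \<omega> y = f (cx y)"
  shows "velocity \<omega> x = vc (vel f (cx x))"
proof -
  have [measurable]: "f \<in> borel_measurable borel" "bs \<in> borel_measurable borel"
    by (rule vortex.meas[OF v] bs_borel)+
  let ?h = "\<lambda>z. vc (f z * bs (cx x - z))"
  have lin: "cx (x - y) = cx x - cx y" for y by (rule linear_diff[OF bounded_linear.linear[OF bounded_linear_cx]])
  have "AE y in lborel. y \<noteq> x" by (rule AE_lborel_singleton)
  with ae have "AE y in lborel. \<omega> y *\<^sub>R perp_grad laplace_fundamental (x - y) = ?h (cx y)"
  proof eventually_elim
    case (elim y)
    then have "perp_grad laplace_fundamental (x - y) = vc (bs (cx x - cx y))"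
      using perp_grad_bs[of "x - y"] lin by simp
    then show ?case
      using elim(1) linear_scale[OF bounded_linear.linear[OF bounded_linear_vc], of "f (cx y)" "bs (cx x - cx y)"]
      unfolding scaleR_conv_of_real[where 'a=complex] by simp
  qed
  then have "velocity \<omega> x = (LINT y|lebesgue. ?h (cx y))"
    unfolding velocity_def by (intro integral_cong_AE_borel(1)) measurable
  also have "\<dots> = (LINT z|lborel. ?h z)" by (rule integral_lebesgue_cx) measurable
  also have "\<dots> = vc (vel f (cx x))"
    unfolding vel_def by (rule integral_bounded_linear[OF bounded_linear_vc vortex.integrable_times_bs[OF v]])
  finally show ?thesis .
qed

lemma ex_borel_vorticity:
  assumes int: "integrable lebesgue \<omega>" and b: "\<And>x. 0 \<le> \<omega> x" "\<And>x. \<omega> x \<le> (1::real)"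
    and C: "(LINT x|lebesgue. \<omega> x) \<le> C"
  obtains f where "vortex f C" "AE y in lborel. \<omega> y = f (cx y)"
proof -
  obtain g where [measurable]: "g \<in> borel_measurable lborel" and g: "AE x in lborel. \<omega> x = g x"
    using completion_ex_borel_measurable_real[OF borel_measurable_integrable[OF int]] by blast
  \<comment> \<open>Clipping enforces the bounds at every point and changes nothing almost
    everywhere.\<close>
  define f where "f = (\<lambda>z. max 0 (min 1 (g (vc z))))"
  have [measurable]: "f \<in> borel_measurable borel" unfolding f_def by measurable
  from g have ae: "AE y in lborel. \<omega> y = f (cx y)"
    proof eventually_elim
    case (elim y)
    then show ?case using b[of y] by (simp add: f_def)
  qed
  have fm: "(\<lambda>y. f (cx y)) \<in> borel_measurable lborel" by measurable
  have L: "integrable lebesgue (\<lambda>y. f (cx y)) \<longleftrightarrow> integrable lebesgue \<omega>"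
    using AE_completion[OF ae] borel_measurable_integrable[OF int] measurable_completion[OF fm]
    by (intro integrable_cong_AE) (auto simp: eq_commute)
  then have "integrable (distr lborel borel cx) f"
    using int integrable_completion[OF fm] by (subst integrable_distr_eq) auto
  moreover have "(LINT z|lborel. f z) \<le> C"
    using C integral_cong_AE_borel(1)[OF _ ae] integral_lebesgue_cx[of f] fm by simp
  ultimately have "vortex f C"
    by unfold_locales (auto simp: distr_cx f_def)
  with ae show ?thesis by (intro that)
qed

text \<open>A Borel version on space-time may have slices of excessive mass for a null set of times.
  Such slices are replaced by 0, so that every slice is a \<open>vortex\<close>; since the mass
  \<open>I\<close> is a Borel function of time, the modified function is still jointly
  Borel.\<close>

lemma ex_joint_borel_vorticity:
  fixes \<omega> :: "real \<Rightarrow> real^2 \<Rightarrow> real"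
  assumes meas: "set_borel_measurable lebesgue ({0..} \<times> UNIV) (\<lambda>(t, x). \<omega> t x)"
    and int: "\<And>t. 0 \<le> t \<Longrightarrow> integrable lebesgue (\<omega> t)"
    and b: "\<And>t x. 0 \<le> t \<Longrightarrow> 0 \<le> \<omega> t x" "\<And>t x. 0 \<le> t \<Longrightarrow> \<omega> t x \<le> 1"
    and C: "\<And>t. 0 \<le> t \<Longrightarrow> (LINT x|lebesgue. \<omega> t x) \<le> C" and C_nonneg: "0 \<le> C"
  obtains w where "(\<lambda>p. w (fst p) (snd p)) \<in> borel_measurable borel" "\<And>t. vortex (w t) C"
    "AE t in lborel. 0 \<le> t \<longrightarrow> (AE x in lborel. \<omega> t x = w t (cx x))"
    "AE p in lborel. 0 \<le> fst p \<longrightarrow> \<omega> (fst p) (snd p) = w (fst p) (cx (snd p))"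
proof -
  obtain g' :: "real \<times> (real^2) \<Rightarrow> real" where [measurable]: "g' \<in> borel_measurable lborel"
    and g': "AE p in lborel. indicator ({0..} \<times> UNIV) p *\<^sub>R (case p of (t, x) \<Rightarrow> \<omega> t x) = g' p"
    using completion_ex_borel_measurable_real[OF meas[unfolded set_borel_measurable_def]] by blast
  define g where "g p = max 0 (min 1 (g' p))" for p
  define I where "I t = (\<integral>\<^sup>+x. ennreal (g (t, x)) \<partial>lborel)" for t
  define w where "w t z = (if I t \<le> ennreal C then g (t, vc z) else 0)" for t z
  have gm [measurable]: "g \<in> borel_measurable borel" unfolding g_def by measurable
  then have "(\<lambda>p. ennreal (g p)) \<in> borel_measurable (lborel \<Otimes>\<^sub>M lborel)" by (simp add: lborel_prod)
  then have Im [measurable]: "I \<in> borel_measurable borel"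
    unfolding I_def using lborel.borel_measurable_nn_integral_fst by fastforce
  have "(\<lambda>p. w (fst p) (snd p)) \<in> borel_measurable (borel \<Otimes>\<^sub>M borel)"
    unfolding w_def by measurable
  then have wm: "(\<lambda>p. w (fst p) (snd p)) \<in> borel_measurable borel" by (simp add: borel_prod)
  have I_cx: "I t = (\<integral>\<^sup>+z. ennreal (g (t, vc z)) \<partial>lborel)" for t
  proof -
    have "(\<integral>\<^sup>+z. ennreal (g (t, vc z)) \<partial>distr lborel borel cx) = I t"
      unfolding I_def by (subst nn_integral_distr) simp_all
    then show ?thesis by (simp add: distr_cx)
  qed
  have vw: "vortex (w t) C" for t
  proof
    show [measurable]: "w t \<in> borel_measurable borel" unfolding w_def by measurable
    show nn: "0 \<le> w t y" and "w t y \<le> 1" for y unfolding w_def g_def by auto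
    have le: "(\<integral>\<^sup>+z. ennreal (w t z) \<partial>lborel) \<le> ennreal C"
      by (cases "I t \<le> ennreal C") (simp_all add: w_def flip: I_cx)
    show int: "integrable lborel (w t)"
      by (rule integrableI_nonneg) (use nn le in \<open>auto intro: le_less_trans\<close>)
    then show "(LINT y|lborel. w t y) \<le> C"
      using le C_nonneg nn_integral_eq_integral[OF int] nn by simp
  qed
  have sl: "AE t in lborel. AE x in lborel. indicator ({0..} \<times> UNIV) (t, x) *\<^sub>R \<omega> t x = g' (t, x)"
    using lborel_pair.AE_pair[OF g'[folded lborel_prod]] by simp
  have I_le: "AE x in lborel. \<omega> t x = g (t, x)" "I t \<le> ennreal C"
    if t: "0 \<le> t" and ae: "AE x in lborel. indicator ({0..} \<times> UNIV) (t, x) *\<^sub>R \<omega> t x = g' (t, x)" for t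
  proof -
    from ae show *: "AE x in lborel. \<omega> t x = g (t, x)"
      proof eventually_elim
      case (elim x)
      then show ?case using b[OF t, of x] t by (simp add: g_def)
    qed
    obtain f where f: "vortex f C" "AE y in lborel. \<omega> t y = f (cx y)"
      using ex_borel_vorticity[OF int[OF t] b[OF t] C[OF t]] by blast
    have fm: "f \<in> borel_measurable borel" by (rule vortex.meas[OF f(1)])
    have "AE x in lborel. ennreal (g (t, x)) = ennreal (f (cx x))"
      using * f(2) by eventually_elim simp
    then have "I t = (\<integral>\<^sup>+x. ennreal (f (cx x)) \<partial>lborel)" unfolding I_def by (rule nn_integral_cong_AE)
    also have "\<dots> = (\<integral>\<^sup>+z. ennreal (f z) \<partial>distr lborel borel cx)"
      by (rule nn_integral_distr[symmetric]) (use fm in simp_all)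
    also have "\<dots> = ennreal (LINT z|lborel. f z)" unfolding distr_cx
      by (rule nn_integral_eq_integral[OF vortex.integrable[OF f(1)]]) (simp add: vortex.bounds[OF f(1)])
    finally show "I t \<le> ennreal C" using vortex.mass[OF f(1)] by (simp add: ennreal_leI)
  qed
  have good: "AE t in lborel. 0 \<le> t \<longrightarrow> I t \<le> ennreal C \<and> (AE x in lborel. \<omega> t x = w t (cx x))"
    using sl
  proof eventually_elim
    case (elim t)
    show ?case using I_le[OF _ elim] by (simp add: w_def)
  qed
  have "AE p::real \<times> (real^2) in lborel. 0 \<le> fst p \<longrightarrow> I (fst p) \<le> ennreal C"
  proof -
    have "AE t in lborel. 0 \<le> t \<longrightarrow> I t \<le> ennreal C" using good by eventually_elim simp
    then show ?thesis by (rule AE_lborel_fst)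
  qed
  then have "AE p in lborel. 0 \<le> fst p \<longrightarrow> \<omega> (fst p) (snd p) = w (fst p) (cx (snd p))"
    using g'
  proof eventually_elim
    case (elim p)
    show ?case using elim b[of "fst p" "snd p"] by (cases p) (auto simp: w_def g_def)
  qed
  moreover have "AE t in lborel. 0 \<le> t \<longrightarrow> (AE x in lborel. \<omega> t x = w t (cx x))"
    using good by eventually_elim simp
  ultimately show ?thesis using that[OF wm vw] by blast
qed

text \<open>The integral over the completed space-time measure is first replaced by that of a Borel
  function and then iterated by Fubini. Integrability rests on the bounded time support of the
  derivative and on the mass bound for each slice.\<close>

lemma weak_formulation_cx:
  fixes \<psi> :: "real \<times> complex \<Rightarrow> real"
  assumes wm: "(\<lambda>p. w (fst p) (snd p)) \<in> borel_measurable borel" and vw: "\<And>t. vortex (w t) C"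
    and ae_t: "AE t in lborel. 0 \<le> t \<longrightarrow> (AE x in lborel. \<omega> t x = w t (cx x))"
    and ae_p: "AE p in lborel. 0 \<le> fst p \<longrightarrow> \<omega> (fst p) (snd p) = w (fst p) (cx (snd p))"
    and \<psi>: "C1 \<psi>" and supp: "bounded {p. \<psi> p \<noteq> 0}"
  defines "\<phi> \<equiv> \<lambda>p. \<psi> (fst p, cx (snd p))"
  shows "test_function \<phi>"
    and "(LINT p:{0..} \<times> UNIV|lebesgue.
          (case p of (t, x) \<Rightarrow> \<omega> t x * frechet_derivative \<phi> (at (t, x)) (1, velocity (\<omega> t) x)))
       = (LINT t:{0..}|lborel. (LINT z|lborel. w t z * frechet_derivative \<psi> (at (t, z)) (1, vel (w t) z)))"
proof -
  let ?L = "\<lambda>p::real \<times> (real^2). (fst p, cx (snd p))"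
  have L: "bounded_linear ?L"
    by (intro bounded_linear_Pair bounded_linear_fst bounded_linear_compose[OF bounded_linear_cx bounded_linear_snd])
  have nL: "norm (?L p) = norm p" for p by (simp add: norm_prod_def)
  have C1\<phi>: "C1 \<phi>" unfolding \<phi>_def by (rule C1_compose[OF \<psi> C1_linear[OF L]])
  obtain R where R: "\<And>q. \<psi> q \<noteq> 0 \<Longrightarrow> norm q \<le> R"
    using supp unfolding bounded_iff by auto
  have "bounded {p. \<phi> p \<noteq> 0}"
    unfolding bounded_iff
  proof (intro exI[of _ R] ballI)
    fix p assume "p \<in> {p. \<phi> p \<noteq> 0}"
    then show "norm p \<le> R" using R[of "?L p"] nL[of p] by (simp add: \<phi>_def)
  qed
  then show "test_function \<phi>" using C1\<phi> unfolding test_function_def C1_def by blast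
  have d\<phi>: "frechet_derivative \<phi> (at p) v = frechet_derivative \<psi> (at (?L p)) (?L v)" for p v
  proof -
    have "frechet_derivative ?L (at p) = ?L"
      using frechet_derivative_at[OF bounded_linear_imp_has_derivative[OF L]] by simp
    then show ?thesis
      unfolding \<phi>_def using frechet_chain[OF \<psi> C1_linear[OF L], of p v] by simp
  qed
  have "\<psi> z = 0" if "R + 1 \<le> norm z" for z using R[of z] that by auto
  then obtain B where B: "1 \<le> B" "\<And>z v. norm (frechet_derivative \<psi> (at z) v) \<le> B * norm v"
    using C1_compact_support_bound[OF \<psi>, of "R + 1"] by metis
  define T where "T = R + 2"
  have zero: "frechet_derivative \<psi> (at (t, z)) v = 0" if "T \<le> t" for t z v
  proof (rule frechet_derivative_outside[where R="R + 1"])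
    show "\<psi> q = 0" if "R + 1 \<le> norm q" for q using R[of q] that by auto
    show "R + 1 < norm (t, z)" using that norm_fst_le[of t z] by (simp add: T_def)
  qed
  define V where "V = 4 * pi + C"
  have V: "norm (vel (w t) z) \<le> V" for t z unfolding V_def by (rule vortex.norm_vel_le[OF vw])
  define G where "G t z = indicator {0..} t * (w t z * frechet_derivative \<psi> (at (t, z)) (1, vel (w t) z))" for t z
  have wm' [measurable (raw)]: "(\<lambda>x. w (f x) (g x)) \<in> borel_measurable M" if "f \<in> borel_measurable M" "g \<in> borel_measurable M"
    for f :: "'x \<Rightarrow> real" and g and M
    using measurable_compose[OF borel_measurable_Pair[OF that] wm] by simp
  have [measurable]: "bs \<in> borel_measurable borel" by (rule bs_borel)
  have velm: "(\<lambda>q. vel (w (fst q)) (snd q)) \<in> borel_measurable (borel \<Otimes>\<^sub>M borel)"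
    unfolding vel_def by measurable
  have Gm: "(\<lambda>q. G (fst q) (snd q)) \<in> borel_measurable (borel \<Otimes>\<^sub>M borel)"
    unfolding G_def
    by (intro borel_measurable_times wm' borel_measurable_frechet[OF \<psi>] borel_measurable_Pair velm) measurable
  then have Gm' [measurable]: "(\<lambda>x. G (f x) (g x)) \<in> borel_measurable M" if "f \<in> borel_measurable M" "g \<in> borel_measurable M"
    for f :: "'x \<Rightarrow> real" and g and M
    using measurable_compose[OF measurable_Pair[OF that] Gm] by simp
  have GB: "norm (G t z) \<le> indicator {0..T} t * (B * (1 + V) * w t z)" for t z
  proof (cases "0 \<le> t \<and> t \<le> T")
    case True
    have "norm (1::real, vel (w t) z) \<le> 1 + V"
      using norm_Pair_le[of "1::real" "vel (w t) z"] V[of t z] by simp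
    then have "norm (frechet_derivative \<psi> (at (t, z)) (1, vel (w t) z)) \<le> B * (1 + V)"
      using B(1) order_trans[OF B(2) mult_left_mono] by fastforce
    then show ?thesis
      using True mult_right_mono[of _ "B * (1 + V)" "w t z"] vortex.bounds[OF vw, of t z]
      by (simp add: G_def abs_mult mult.commute[of "w t z"])
  next
    case False
    then show ?thesis using zero[of t z] by (auto simp: G_def indicator_def)
  qed
  let ?H = "\<lambda>p::real \<times> (real^2). G (fst p) (cx (snd p))"
  have Hm: "?H \<in> borel_measurable (lborel \<Otimes>\<^sub>M lborel)" by measurable
  have V0: "0 \<le> B * (1 + V)" using B(1) order_trans[OF norm_ge_zero V[of 0 0]] by simp
  have C0: "0 \<le> C" by (rule vortex.C0_nonneg[OF vw])
  have "(\<integral>\<^sup>+p. ennreal (norm (?H p)) \<partial>(lborel \<Otimes>\<^sub>M lborel)) = (\<integral>\<^sup>+t. \<integral>\<^sup>+x. ennreal (norm (?H (t, x))) \<partial>lborel \<partial>lborel)"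
    by (rule lborel.nn_integral_fst[symmetric]) measurable
  also have "\<dots> \<le> (\<integral>\<^sup>+t. ennreal (B * (1 + V) * C) * indicator {0..T} t \<partial>lborel)"
  proof (rule nn_integral_mono)
    fix t
    have "(\<integral>\<^sup>+x. ennreal (norm (?H (t, x))) \<partial>lborel) \<le> (\<integral>\<^sup>+x. ennreal (indicator {0..T} t * (B * (1 + V) * w t (cx x))) \<partial>lborel)"
      by (intro nn_integral_mono ennreal_leI) (use GB in auto)
    also have "\<dots> = (\<integral>\<^sup>+z. ennreal (indicator {0..T} t * (B * (1 + V) * w t z)) \<partial>distr lborel borel cx)"
      using vortex.meas[OF vw, of t] by (intro nn_integral_distr[symmetric]) measurable
    also have "\<dots> = ennreal (LINT z|lborel. indicator {0..T} t * (B * (1 + V) * w t z))"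
      unfolding distr_cx using V0 vortex.bounds[OF vw, of t] vortex.integrable[OF vw, of t]
      by (intro nn_integral_eq_integral) auto
    also have "\<dots> \<le> ennreal (indicator {0..T} t * (B * (1 + V) * C))"
      using V0 vortex.mass[OF vw, of t] by (intro ennreal_leI) (auto simp: indicator_def intro!: mult_left_mono)
    finally show "(\<integral>\<^sup>+x. ennreal (norm (?H (t, x))) \<partial>lborel) \<le> ennreal (B * (1 + V) * C) * indicator {0..T} t"
      by (auto simp: indicator_def)
  qed
  also have "\<dots> = ennreal (B * (1 + V) * C) * emeasure lborel {0..T}"
    by (rule nn_integral_cmult_indicator) simp
  also have "\<dots> < \<infinity>"
    using emeasure_lborel_Icc_eq[of 0 T] by (auto simp: ennreal_mult_less_top)
  finally have Hi: "integrable (lborel \<Otimes>\<^sub>M lborel) ?H"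
    using Hm by (intro integrableI_bounded)
  have Q: "AE p::real \<times> (real^2) in lborel. 0 \<le> fst p \<longrightarrow> (AE x in lborel. \<omega> (fst p) x = w (fst p) (cx x))"
    by (rule AE_lborel_fst[OF ae_t])
  have "AE p in lborel. indicator ({0..} \<times> UNIV) p *\<^sub>R (case p of (t, x) \<Rightarrow> \<omega> t x * frechet_derivative \<phi> (at (t, x)) (1, velocity (\<omega> t) x)) = ?H p"
    using Q ae_p
  proof eventually_elim
    case (elim p)
    show ?case
    proof (cases "0 \<le> fst p")
      case True
      with elim have ae: "AE x in lborel. \<omega> (fst p) x = w (fst p) (cx x)" by blast
      have "velocity (\<omega> (fst p)) x = vc (vel (w (fst p)) (cx x))" for x
        by (rule velocity_eq[OF vw ae])
      then show ?thesis using True elim by (cases p) (simp add: G_def d\<phi>)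
    qed (cases p, simp add: G_def)
  qed
  then have "(LINT p:{0..} \<times> UNIV|lebesgue. (case p of (t, x) \<Rightarrow> \<omega> t x * frechet_derivative \<phi> (at (t, x)) (1, velocity (\<omega> t) x)))
     = (LINT p|lebesgue. ?H p)"
    unfolding set_lebesgue_integral_def
    by (intro integral_cong_AE_borel(1)) (use Hm in \<open>simp add: lborel_prod\<close>)
  also have "\<dots> = (LINT p|(lborel \<Otimes>\<^sub>M lborel). ?H p)"
    using Hm unfolding lborel_prod by (rule integral_completion)
  also have "\<dots> = (LINT t|lborel. LINT x|lborel. ?H (t, x))"
    by (rule lborel_pair.integral_fst'[OF Hi, symmetric])
  also have "\<dots> = (LINT t|lborel. LINT z|lborel. G t z)"
  proof (intro Bochner_Integration.integral_cong refl)
    fix t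
    have "(LINT z|distr lborel borel cx. G t z) = (LINT x|lborel. ?H (t, x))"
      by (subst integral_distr) simp_all
    then show "(LINT x|lborel. ?H (t, x)) = (LINT z|lborel. G t z)" by (simp add: distr_cx)
  qed
  also have "\<dots> = (LINT t:{0..}|lborel. (LINT z|lborel. w t z * frechet_derivative \<psi> (at (t, z)) (1, vel (w t) z)))"
    unfolding set_lebesgue_integral_def G_def
    by (intro Bochner_Integration.integral_cong refl) simp
  finally show "(LINT p:{0..} \<times> UNIV|lebesgue.
          (case p of (t, x) \<Rightarrow> \<omega> t x * frechet_derivative \<phi> (at (t, x)) (1, velocity (\<omega> t) x)))
       = (LINT t:{0..}|lborel. (LINT z|lborel. w t z * frechet_derivative \<psi> (at (t, z)) (1, vel (w t) z)))" .
qed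

lemma sector_eq: "sector \<beta> \<alpha> = vc ` wedge \<beta> \<alpha>"
proof -
  have "vc (complex_of_real s * cis t) = vector [s * cos t, s * sin t]" for s t
    by (simp add: vec_eq_iff forall_2)
  moreover have "x \<in> vc ` wedge \<beta> \<alpha> \<longleftrightarrow> (\<exists>s t. x = vc (complex_of_real s * cis t) \<and> 0 < s \<and> \<beta> < t \<and> t < \<beta> + \<alpha>)" for x
    unfolding wedge_def by blast
  ultimately show ?thesis unfolding sector_def by (intro set_eqI) simp
qed

lemma measure_ball_R2: "0 \<le> r \<Longrightarrow> measure lebesgue (ball (c::real^2) r) = pi * r\<^sup>2"
  by (simp add: circle_area mult.commute)

lemma corner_integral:
  assumes \<Omega>: "\<Omega> \<in> sets lebesgue" and f: "vortex f C" "AE x in lborel. indicat_real \<Omega> x = f (cx x)"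
    and \<alpha>: "0 < \<alpha>" "\<alpha> < pi"
  shows "(LINT z|lborel. indicator (ball 0 r) z * \<bar>f z - indicator (wedge \<beta> \<alpha>) z\<bar>)
     = measure lebesgue (ball 0 r \<inter> sym_diff \<Omega> (sector \<beta> \<alpha>))"
proof -
  have [measurable]: "wedge \<beta> \<alpha> \<in> sets borel" using open_wedge[OF \<alpha>] by simp
  have [measurable]: "f \<in> borel_measurable borel" by (rule vortex.meas[OF f(1)])
  have [measurable]: "ball (0::complex) r \<in> sets borel" by simp
  let ?h = "\<lambda>z. indicator (ball 0 r) z * \<bar>f z - indicator (wedge \<beta> \<alpha>) z\<bar>"
  have sec: "x \<in> sector \<beta> \<alpha> \<longleftrightarrow> cx x \<in> wedge \<beta> \<alpha>" for x
    unfolding sector_eq by (metis cx_vc image_iff vc_cx)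
  have ae: "AE x in lborel. indicator (ball 0 r \<inter> sym_diff \<Omega> (sector \<beta> \<alpha>)) x = ?h (cx x)"
    using f(2)
  proof eventually_elim
    case (elim x)
    then show ?case unfolding elim[symmetric] by (auto simp: indicator_def sec)
  qed
  have "(LINT z|lborel. ?h z) = (LINT x|lebesgue. ?h (cx x))"
    by (rule integral_lebesgue_cx[symmetric]) measurable
  also have "\<dots> = (LINT x|lebesgue. indicator (ball 0 r \<inter> sym_diff \<Omega> (sector \<beta> \<alpha>)) x)"
    by (rule integral_cong_AE_borel(1)[OF _ ae, symmetric]) measurable
  finally show ?thesis by simp
qed

text \<open>On a disc of radius at most \<open>2^-J\<close> the rescaled cutoff
  \<open>1 - far\<close> equals 1, and it is nonnegative elsewhere.\<close>

lemma measure_ball_le: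
  assumes f: "vortex f C" "AE x in lborel. indicat_real \<Omega> x = f (cx x)"
    and r: "2 ^ J * r \<le> 1"
  shows "measure lebesgue (ball c r \<inter> \<Omega>) \<le> (LINT z|lborel. f z * (1 - far (2 ^ J *\<^sub>R (z - cx c))))"
proof -
  have [measurable]: "f \<in> borel_measurable borel" by (rule vortex.meas[OF f(1)])
  have [measurable]: "far \<in> borel_measurable borel"
    by (rule borel_measurable_continuous_onI[OF C1_continuous[OF C1_far]])
  have [measurable]: "ball (cx c) r \<in> sets borel" by simp
  have ball: "cx x \<in> ball (cx c) r \<longleftrightarrow> x \<in> ball c r" for x
    using linear_diff[OF bounded_linear.linear[OF bounded_linear_cx], of c x] norm_cx[of "c - x"]
    by (simp add: dist_norm)
  have ae: "AE x in lborel. indicat_real (ball c r \<inter> \<Omega>) x = f (cx x) * indicator (ball (cx c) r) (cx x)"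
    using f(2)
  proof eventually_elim
    case (elim x)
    then show ?case unfolding elim[symmetric] by (simp only: indicator_def ball) auto
  qed
  have "measure lebesgue (ball c r \<inter> \<Omega>) = (LINT x|lebesgue. indicator (ball c r \<inter> \<Omega>) x)" by simp
  also have "\<dots> = (LINT x|lebesgue. f (cx x) * indicator (ball (cx c) r) (cx x))"
    by (rule integral_cong_AE_borel(1)[OF _ ae]) measurable
  also have "\<dots> = (LINT z|lborel. f z * indicator (ball (cx c) r) z)"
    by (rule integral_lebesgue_cx[where h="\<lambda>z. f z * indicator (ball (cx c) r) z"]) measurable
  also have "\<dots> \<le> (LINT z|lborel. f z * (1 - far (2 ^ J *\<^sub>R (z - cx c))))"
  proof (rule integral_mono)
    show "integrable lborel (\<lambda>z. f z * indicator (ball (cx c) r) z)"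
      using vortex.integrable_times_bounded(1)[OF f(1), of "indicat_real (ball (cx c) r)" 1] by (simp add: borel_measurable_indicator)
    show "integrable lborel (\<lambda>z. f z * (1 - far (2 ^ J *\<^sub>R (z - cx c))))"
      using vortex.integrable_times_bounded(1)[OF f(1), of "\<lambda>z. 1 - far (2 ^ J *\<^sub>R (z - cx c))" 1] far_cases(3,4) by simp
    fix z
    show "f z * indicator (ball (cx c) r) z \<le> f z * (1 - far (2 ^ J *\<^sub>R (z - cx c)))"
    proof (intro mult_left_mono vortex.bounds(1)[OF f(1)])
      show "indicator (ball (cx c) r) z \<le> 1 - far (2 ^ J *\<^sub>R (z - cx c))"
      proof (cases "z \<in> ball (cx c) r")
        case True
        then have "norm (z - cx c) \<le> r" by (simp add: dist_norm norm_minus_commute)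
        then have "norm ((2::real) ^ J *\<^sub>R (z - cx c)) \<le> 1"
          using order_trans[OF mult_left_mono[of "norm (z - cx c)" r "2 ^ J"] r] by simp
        then show ?thesis using True by (simp add: far_cases(1))
      qed (simp add: far_cases(4))
    qed
  qed
  finally show ?thesis .
qed

section \<open>From dyadic scales to a function of the radius\<close>

text \<open>A diagonal choice: \<open>E r\<close> collects the tolerances attainable at radius
  \<open>r\<close>. Its infimum need not be attained, so \<open>t r\<close> is chosen for a
  tolerance below \<open>Inf (E r) + r\<close>, which still tends to 0.\<close>

lemma ex_vanishing_choice:
  fixes f :: "real \<Rightarrow> real \<Rightarrow> real"
  assumes ev: "\<And>\<epsilon>. 0 < \<epsilon> \<Longrightarrow> \<forall>\<^sub>F r in at_right 0. \<exists>t. 0 < t \<and> t < \<epsilon> \<and> \<bar>f t r\<bar> < \<epsilon>"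
  shows "\<exists>t. (\<forall>\<^sub>F r in at_right 0. 0 < t r) \<and> (t \<longlongrightarrow> 0) (at_right 0) \<and> ((\<lambda>r. f (t r) r) \<longlongrightarrow> 0) (at_right 0)"
proof -
  define E where "E r = {\<epsilon>. 0 < \<epsilon> \<and> (\<exists>t. 0 < t \<and> t < \<epsilon> \<and> \<bar>f t r\<bar> < \<epsilon>)}" for r
  have bdd: "bdd_below (E r)" for r by (rule bdd_belowI[of _ 0]) (auto simp: E_def)
  have "\<exists>t. 0 < t \<and> t < Inf (E r) + r \<and> \<bar>f t r\<bar> < Inf (E r) + r" if r: "0 < r" "E r \<noteq> {}" for r
  proof -
    obtain \<epsilon> where "\<epsilon> \<in> E r" "\<epsilon> < Inf (E r) + r"
      using cInf_lessD[OF r(2), of "Inf (E r) + r"] r(1) by auto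
    then show ?thesis unfolding E_def by force
  qed
  then obtain t where t: "\<And>r. 0 < r \<Longrightarrow> E r \<noteq> {} \<Longrightarrow> 0 < t r \<and> t r < Inf (E r) + r \<and> \<bar>f (t r) r\<bar> < Inf (E r) + r"
    by metis
  have small: "\<forall>\<^sub>F r in at_right 0. 0 < t r \<and> t r < \<epsilon> \<and> \<bar>f (t r) r\<bar> < \<epsilon>" if "0 < \<epsilon>" for \<epsilon>
  proof -
    have "\<forall>\<^sub>F r in at_right 0. 0 < r \<and> r < \<epsilon> / 2"
      using eventually_at_right_real[of 0 "\<epsilon> / 2"] that by simp
    moreover have "\<forall>\<^sub>F r in at_right 0. \<epsilon> / 2 \<in> E r"
      using ev[of "\<epsilon> / 2"] that by (simp add: E_def)
    ultimately show ?thesis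
    proof eventually_elim
      case (elim r)
      have "Inf (E r) \<le> \<epsilon> / 2" by (rule cInf_lower[OF elim(2) bdd])
      then show ?case using t[of r] elim by fastforce
    qed
  qed
  have "\<forall>\<^sub>F r in at_right 0. 0 < t r" using small[of 1] by (auto elim: eventually_mono)
  moreover have "(t \<longlongrightarrow> 0) (at_right 0)"
    unfolding tendsto_iff dist_norm by (auto intro!: eventually_mono[OF small])
  moreover have "((\<lambda>r. f (t r) r) \<longlongrightarrow> 0) (at_right 0)"
    unfolding tendsto_iff dist_norm by (auto intro!: eventually_mono[OF small])
  ultimately show ?thesis by blast
qed

text \<open>Thus \<open>r\<close> lies between \<open>2^-(J+1)\<close> and \<open>2^-J\<close>, and
  passing to the dyadic scale loses at most a factor 4 in area.\<close>

lemma ex_dyadic_scale: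
  fixes r :: real
  assumes "0 < r" "2 ^ J0 * r \<le> 1"
  obtains J where "J0 \<le> J" "2 ^ J * r \<le> 1" "1 < 2 * 2 ^ J * r"
proof -
  obtain n where "1 / r < 2 ^ n" using real_arch_pow[of 2 "1 / r"] by auto
  define m where "m = (LEAST n. 1 / r < 2 ^ n)"
  have m: "1 / r < 2 ^ m" unfolding m_def by (rule LeastI) fact
  have J0: "J0 < m"
  proof (rule ccontr)
    assume "\<not> J0 < m"
    then have "(2::real) ^ m \<le> 2 ^ J0" by (intro power_increasing) auto
    then have "1 / r < 2 ^ J0" using m by linarith
    then show False using assms by (simp add: divide_less_eq)
  qed
  then obtain J where J: "m = Suc J" by (cases m) auto
  have "\<not> 1 / r < 2 ^ J" using not_less_Least[of J "\<lambda>n. 1 / r < 2 ^ n"] J by (simp add: m_def)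
  then show ?thesis using m J J0 assms by (intro that[of J]) (auto simp: field_simps)
qed

theorem theorem1:
  fixes \<Omega>\<^sub>0 :: "(real^2) set" and \<alpha> :: real
    and \<omega> :: "real \<Rightarrow> real^2 \<Rightarrow> real"
    and \<Omega> :: "real \<Rightarrow> (real^2) set"
    and \<Phi> :: "real \<Rightarrow> real^2 \<Rightarrow> real^2"
  assumes "bounded \<Omega>\<^sub>0" "simply_connected \<Omega>\<^sub>0" "\<Omega>\<^sub>0 \<in> sets lebesgue"
    and "has_corner_at_0 \<Omega>\<^sub>0 \<alpha>" "\<alpha> < pi / 2"
    and "yudovich_solution (indicat_real \<Omega>\<^sub>0) \<omega>"
    and "flow_map (\<lambda>t. velocity (\<omega> t)) \<Phi>"
    and "\<And>t. 0 \<le> t \<Longrightarrow> \<Omega> t = \<Phi> t ` \<Omega>\<^sub>0"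
    and "\<And>t. 0 \<le> t \<Longrightarrow> \<omega> t = indicat_real (\<Omega> t)"
  shows "\<exists>t :: real \<Rightarrow> real.
           (\<forall>\<^sub>F r in at_right 0. 0 < t r) \<and>
           (t \<longlongrightarrow> 0) (at_right 0) \<and>
           ((\<lambda>r. measure lebesgue (ball (\<Phi> (t r) 0) r \<inter> \<Omega> (t r)) / measure lebesgue (ball (\<Phi> (t r) 0) r))
             \<longlongrightarrow> 0) (at_right 0)"
proof -
  obtain \<beta> where \<alpha>: "0 < \<alpha>" "\<alpha> < pi" and
    lim: "((\<lambda>r. measure lebesgue (ball 0 r \<inter> sym_diff \<Omega>\<^sub>0 (sector \<beta> \<alpha>)) / measure lebesgue (ball (0::real^2) r)) \<longlongrightarrow> 0) (at_right 0)"
    using assms(4) unfolding has_corner_at_0_def by blast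
  note sol = assms(6)[unfolded yudovich_solution_def]
  obtain C where C: "\<And>t. 0 \<le> t \<Longrightarrow> integrable lebesgue (\<omega> t)" "\<And>t. 0 \<le> t \<Longrightarrow> (LINT x|lebesgue. \<bar>\<omega> t x\<bar>) \<le> C"
    using sol by blast
  have b: "0 \<le> \<omega> t x" "\<omega> t x \<le> 1" if "0 \<le> t" for t x
    using assms(9)[OF that] by simp_all
  have C': "(LINT x|lebesgue. \<omega> t x) \<le> max C (measure lebesgue \<Omega>\<^sub>0)" if "0 \<le> t" for t
    using C(2)[OF that] b[OF that] by simp
  have "\<Omega>\<^sub>0 \<in> lmeasurable" using assms(1,3) by (rule bounded_set_imp_lmeasurable)
  then have int0: "integrable lebesgue (indicat_real \<Omega>\<^sub>0)" by (simp add: lmeasurable_iff_integrable)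
  \<comment> \<open>One mass bound for the initial datum and for all later times.\<close>
  define C0 where "C0 = max C (measure lebesgue \<Omega>\<^sub>0)"
  have "0 \<le> C0" unfolding C0_def by (simp add: le_max_iff_disj)
  obtain w0 where w0: "vortex w0 C0" "AE x in lborel. indicat_real \<Omega>\<^sub>0 x = w0 (cx x)"
    by (rule ex_borel_vorticity[OF int0, of C0]) (auto simp: C0_def)
  obtain w where wm: "(\<lambda>p. w (fst p) (snd p)) \<in> borel_measurable borel" and vw: "\<And>t. vortex (w t) C0"
    and ae_t: "AE t in lborel. 0 \<le> t \<longrightarrow> (AE x in lborel. \<omega> t x = w t (cx x))"
    and ae_p: "AE p in lborel. 0 \<le> fst p \<longrightarrow> \<omega> (fst p) (snd p) = w (fst p) (cx (snd p))"
    by (rule ex_joint_borel_vorticity[OF conjunct1[OF sol] C(1) b C'[folded C0_def] \<open>0 \<le> C0\<close>]) (assumption+, rule that)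
  \<comment> \<open>The trajectory is frozen at negative times, which makes \<open>X\<close>
    continuous on the whole line.\<close>
  define X where "X t = cx (\<Phi> (max 0 t) 0)" for t
  define Y where "Y t = cx (velocity (\<omega> t) (\<Phi> t 0))" for t
  have \<Phi>0: "\<Phi> 0 0 = 0" using assms(7) unfolding flow_map_def by blast
  have d\<Phi>: "((\<lambda>s. \<Phi> s 0) has_vector_derivative velocity (\<omega> t) (\<Phi> t 0)) (at t within {0..})"
    if "0 \<le> t" for t
    using assms(7) that unfolding flow_map_def by blast
  have cont: "continuous_on {0..} (\<lambda>s. \<Phi> s 0)"
    using has_vector_derivative_continuous[OF d\<Phi>] by (auto simp: continuous_on_eq_continuous_within)
  obtain e1 e2 m a a' :: "real \<Rightarrow> complex" and r1 r2 \<theta> A :: "real \<Rightarrow> real" where model: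
    "\<And>s. (e1 has_vector_derivative m s * cnj (e1 s)) (at s)"
    "\<And>s. (e2 has_vector_derivative m s * cnj (e2 s)) (at s)"
    "continuous_on UNIV m"
    "\<And>s. Im (cnj (e1 s) * e2 s) = 1"
    "\<And>s. e1 s = r1 s * cis (\<theta> s)" "\<And>s. e2 s = r2 s * cis (\<theta> s + A s)"
    "\<And>s. 0 < r1 s" "\<And>s. 0 < r2 s" "\<And>s. 0 < A s" "\<And>s. A s < pi"
    "\<theta> 0 = \<beta>" "A 0 = \<alpha>" "continuous_on UNIV A"
    "\<And>s. a s = (cis (2 * \<theta> s) - cis (2 * (\<theta> s + A s))) / (4 * pi)"
    "\<And>s. ((\<lambda>s. s * m s) has_vector_derivative a s) (at s)"
    "\<And>s. (a has_vector_derivative a' s) (at s)" "continuous_on UNIV a'"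
    "\<And>\<delta>. 0 < \<delta> \<Longrightarrow> \<exists>s>0. A s < \<delta>"
    by (rule ex_corner_model[OF \<alpha>(1) assms(5), of \<beta>]) (rule that)
  interpret corner_evolution w w0 X Y C0 \<alpha> \<beta> e1 e2 m a a' r1 r2 \<theta> A
  proof (intro corner_evolution.intro transported_vorticity.intro corner_evolution_axioms.intro)
    show "(\<lambda>p. w (fst p) (snd p)) \<in> borel_measurable borel" "\<And>t. vortex (w t) C0" "vortex w0 C0"
      by (fact wm vw w0)+
    show "continuous_on UNIV X"
      unfolding X_def
      by (intro linear_continuous_on_compose[OF _ bounded_linear.linear[OF bounded_linear_cx]]
          continuous_on_compose2[OF cont] continuous_intros) auto
    show "X 0 = 0" by (simp add: X_def \<Phi>0 linear_0[OF bounded_linear.linear[OF bounded_linear_cx]])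
    show "(X has_vector_derivative Y t) (at t within {0..})" if "0 \<le> t" for t
      unfolding Y_def
      by (rule has_vector_derivative_transform[OF _ _ bounded_linear.has_vector_derivative[OF bounded_linear_cx d\<Phi>[OF that]]])
         (use that in \<open>auto simp: X_def\<close>)
    show "norm (Y t) \<le> 4 * pi + C0" if t: "0 \<le> t" for t
    proof -
      obtain f where f: "vortex f C0" "AE y in lborel. \<omega> t y = f (cx y)"
        by (rule ex_borel_vorticity[OF C(1)[OF t] b[OF t] C'[OF t, folded C0_def]])
      show ?thesis unfolding Y_def velocity_eq[OF f] by (simp add: vortex.norm_vel_le[OF f(1)])
    qed
    show "AE t in lborel. 0 \<le> t \<longrightarrow> Y t = vel (w t) (X t)"
      using ae_t
    proof eventually_elim
      case (elim t)
      show ?case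
      proof
        assume "0 \<le> t"
        with elim have "AE x in lborel. \<omega> t x = w t (cx x)" by blast
        from velocity_eq[OF vw this] show "Y t = vel (w t) (X t)" using \<open>0 \<le> t\<close> by (simp add: Y_def X_def)
      qed
    qed
    show "(LINT t:{0..}|lborel. (LINT z|lborel. w t z * frechet_derivative \<psi> (at (t, z)) (1, vel (w t) z)))
       + (LINT z|lborel. w0 z * \<psi> (0, z)) = 0" if \<psi>: "C1 \<psi>" "bounded {p. \<psi> p \<noteq> 0}" for \<psi>
    proof -
      have \<psi>m: "(\<lambda>z. w0 z * \<psi> (0, z)) \<in> borel_measurable borel"
        by (intro borel_measurable_times vortex.meas[OF w0(1)] borel_measurable_continuous_onI
            continuous_on_compose2[OF C1_continuous[OF \<psi>(1)]] continuous_intros) auto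
      have "AE x in lborel. indicat_real \<Omega>\<^sub>0 x * \<psi> (0, cx x) = w0 (cx x) * \<psi> (0, cx x)"
        using w0(2) by eventually_elim simp
      then have "(LINT x|lebesgue. indicat_real \<Omega>\<^sub>0 x * \<psi> (0, cx x)) = (LINT x|lebesgue. w0 (cx x) * \<psi> (0, cx x))"
        by (rule integral_cong_AE_borel(1)[OF measurable_compose[OF cx_borel \<psi>m]])
      also have "\<dots> = (LINT z|lborel. w0 z * \<psi> (0, z))"
        by (rule integral_lebesgue_cx[OF \<psi>m])
      finally show ?thesis
        using weak_formulation_cx[OF wm vw ae_t ae_p \<psi>] conjunct2[OF conjunct2[OF sol]] by fastforce
    qed
    \<comment> \<open>The factor \<open>pi\<close> converts the normalisation by the area of the
      disc into the one by \<open>r^2\<close>.\<close>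
    have "\<forall>\<^sub>F r in at_right (0::real). 0 < r" by (simp add: eventually_at_right_less)
    then have "\<forall>\<^sub>F r in at_right 0. pi * (measure lebesgue (ball 0 r \<inter> sym_diff \<Omega>\<^sub>0 (sector \<beta> \<alpha>)) / measure lebesgue (ball (0::real^2) r))
       = (LINT z|lborel. indicator (ball 0 r) z * \<bar>w0 z - indicator (wedge \<beta> \<alpha>) z\<bar>) / r\<^sup>2"
      by eventually_elim (simp add: corner_integral[OF assms(3) w0 \<alpha>] measure_ball_R2 del: measure_completion)
    from Lim_transform_eventually[OF tendsto_mult_right_zero[OF lim] this]
    show "((\<lambda>r. (LINT z|lborel. indicator (ball 0 r) z * \<bar>w0 z - indicator (wedge \<beta> \<alpha>) z\<bar>) / r\<^sup>2) \<longlongrightarrow> 0) (at_right 0)" .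
  qed (fact model)+
  show ?thesis
  proof (rule ex_vanishing_choice)
    fix \<epsilon> :: real assume \<epsilon>: "0 < \<epsilon>"
    obtain J0 where J0: "\<And>J P. J0 \<le> J \<Longrightarrow> (AE t in lborel. 0 \<le> t \<longrightarrow> P t) \<Longrightarrow>
      \<exists>t. 0 < t \<and> t < \<epsilon> \<and> P t \<and> 4 ^ J * (LINT z|lborel. w t z * (1 - far (2 ^ J *\<^sub>R (z - X t)))) \<le> \<epsilon> / 2"
      by (rule cusp_average[of "\<epsilon> / 2" \<epsilon>]) (use \<epsilon> in auto)
    have "\<forall>\<^sub>F r in at_right (0::real). r \<in> {0<..<1 / 2 ^ J0}" by (rule eventually_at_right_real) simp
    then show "\<forall>\<^sub>F r in at_right 0. \<exists>t. 0 < t \<and> t < \<epsilon> \<and>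
      \<bar>measure lebesgue (ball (\<Phi> t 0) r \<inter> \<Omega> t) / measure lebesgue (ball (\<Phi> t 0) r)\<bar> < \<epsilon>"
    proof eventually_elim
      case (elim r)
      then have r: "0 < r" "2 ^ J0 * r \<le> 1" by (simp_all add: field_simps)
      obtain J where J: "J0 \<le> J" "2 ^ J * r \<le> 1" "1 < 2 * 2 ^ J * r" by (rule ex_dyadic_scale[OF r])
      \<comment> \<open>\<open>P\<close> is taken to be agreement of \<open>\<omega> t\<close> with
        its Borel version almost everywhere, so that the estimate transfers to the patch at the
        chosen time.\<close>
      obtain t where t: "0 < t" "t < \<epsilon>" "AE x in lborel. \<omega> t x = w t (cx x)"
        and le: "4 ^ J * (LINT z|lborel. w t z * (1 - far (2 ^ J *\<^sub>R (z - X t)))) \<le> \<epsilon> / 2"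
        using J0[OF J(1) ae_t] by blast
      let ?M = "measure lebesgue (ball (\<Phi> t 0) r \<inter> \<Omega> t)"
      have "AE x in lborel. indicat_real (\<Omega> t) x = w t (cx x)"
        using t(1,3) assms(9)[of t] by simp
      from measure_ball_le[OF vw this J(2), of "\<Phi> t 0"] have M: "?M \<le> (LINT z|lborel. w t z * (1 - far (2 ^ J *\<^sub>R (z - X t))))"
        using t(1) by (simp add: X_def)
      have "4 ^ J * ?M \<le> \<epsilon> / 2" using order_trans[OF mult_left_mono[OF M] le] by simp
      have "1\<^sup>2 \<le> (2 * 2 ^ J * r)\<^sup>2" using J(3) by (intro power_mono) auto
      moreover have "((2::real) ^ J)\<^sup>2 = 4 ^ J" by (simp add: power2_eq_square flip: power_mult_distrib)
      ultimately have "1 \<le> 4 * (4 ^ J * r\<^sup>2)" by (simp add: power_mult_distrib)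
      then have "?M * 1 \<le> ?M * (4 * (4 ^ J * r\<^sup>2))" by (rule mult_left_mono) simp
      also have "\<dots> = (4 ^ J * ?M) * (4 * r\<^sup>2)" by simp
      also have "\<dots> \<le> (\<epsilon> / 2) * (4 * r\<^sup>2)" using \<open>4 ^ J * ?M \<le> \<epsilon> / 2\<close> by (rule mult_right_mono) simp
      \<comment> \<open>The lost factor 4 times the margin 1/2 leaves \<open>2 < pi\<close>.\<close>
      also have "\<dots> < \<epsilon> * (pi * r\<^sup>2)" using \<epsilon> r(1) pi_gt3 by simp
      finally have "\<bar>?M / measure lebesgue (ball (\<Phi> t 0) r)\<bar> < \<epsilon>"
        using r(1) by (simp add: measure_ball_R2 divide_less_eq del: measure_completion)
      with t show ?case by blast
    qed
  qed
qed

end
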